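(* Let $n\ge1$. The A-matrix of the symplectic Renner monoid $RSp_{2n}$ (defined by $M=AY$) is $$A=\begin{pmatrix} Id & U\\ 0 & T\end{pmatrix},$$ where the first block of rows/columns is indexed by $\mathcal{SP}_n$ and the second by $\bigcup_{t=0}^n\mathcal P_t$, $Id$ is an identity matrix, $$T_{\alpha,\lambda}=\binom{\alpha}{\lambda},\qquad \alpha\in\mathcal P_{t_1},\ \lambda\in\mathcal P_{t_2},\ 0\le t_1,t_2\le n,$$ and $$U_{\alpha,\lambda}=2^{\sum_i\lambda_{(i)}}\cdot\binom{\gamma}{\lambda},\qquad \alpha=(\gamma,\delta)\in\mathcal{SP}_n,\ \lambda\in\mathcal P_t,\ 0\le t\le n.$$
   Context: Symplectic Renner monoid. Let $m=2n$, $\mathbf m=\{1,\dots,m\}$, $\overline i=m+1-i$. A subset $P\subseteq\mathbf m$ is admissible if $P=\mathbf m$ or if $i\in P$ implies $\overline i\notin P$. A bijection of $\mathbf m$ is symplectic if it sends admissible sets to admissible sets; these form the group $W_n=WSp_{2n}$ (the Weyl group of type $C_n$). An injective partial transformation of $\mathbf m$ (bijection between two subsets of $\mathbf m$) is symplectic if it is a symplectic bijection of $\mathbf m$ or if both its domain and range are proper admissible sets. $RSp_{2n}$ is the monoid of all symplectic injective partial transformations of $\mathbf m$ (composed from the left as partial maps); its unit group is $W_n$. Indexing. $\mathcal P_t$ is the set of partitions of $t$; $\mathcal{SP}_n$ is the set of pairs $(\gamma,\delta)$ of partitions with $|\gamma|+|\delta|=n$; $\mathcal Q_n=\mathcal{SP}_n\sqcup\bigcup_{t=0}^n\mathcal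 P_t$. The cross-section lattice of $RSp_{2n}$ is $\{1\}\cup\{e_t:0\le t\le n\}$, with $e_t$ the partial identity on $\{1,\dots,t\}$, and the associated groups are $W_1=W_n$ and $W_{e_t}\cong S_t$ (permutations of $\{1,\dots,t\}$, undefined elsewhere; $S_0$ trivial). Classes: for $\alpha=(\gamma,\delta)\in\mathcal{SP}_n$, $r_\alpha=w_\alpha\in W_n$ is a representative of the conjugacy class of elements whose cycles on $\mathbf m$ are: for each part $a$ of $\gamma$, a pair of disjoint cycles of length $a$ interchanged by the bar involution; for each part $a$ of $\delta$, one cycle of length $2a$ stable under the bar involution. For $\alpha\vdash t$, $r_\alpha\in W_{e_t}$ is a permutation of $\{1,\dots,t\}$ of cycle type $\alpha$. Characters. $\overline\chi_\lambda$ is the irreducible complex character of $W_n$ (if $\lambda\in\mathcal{SP}_n$) or $S_t$ (if $\lambda\vdash t$) indexed by $\lambda$, and $\chi_\lambda$ is the corresponding irreducible character of $RSp_{2n}$: it is afforded by the irreducible representation $V$ for which $e$ ($e=1$ if $\lambda\in\mathcal{SP}_n$, $e=e_t$ if $\lambda\vdash t$) is the minimal element of the cross-section lattice acting nontrivially (not as $0$) and such that $W_e$ acts on $eV$ with character $\overline\chi_\lambda$. $M=(\chi_\lambda(r_\alpha))_{\alpha,\lambda\in\mathcal Q_n}$ (row $\alpha$, column $\lambda$) and $Y$ is the block diagonal matrix, with the same indexing, whose blocks are the character tables of $W_n$ and of $S_t$, $0\le t\le n$. Both are invertible. For a partition $\lambda$, $\lambda_{(i)}$ is the number of parts of $\lambda$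 equal to $i$, and $\binom{\lambda}{\mu}:=\prod_{i\ge1}\binom{\lambda_{(i)}}{\mu_{(i)}}$. *)

theory Defs
  imports
    "Jordan_Normal_Form.VS_Connect"
    "HOL-Combinatorics.Orbits"
    "HOL-Library.Multiset"
    "HOL-Library.FuncSet"
begin

section \<open>The symplectic Renner monoid\<close>

text \<open>
  Partial transformations are maps \<open>nat \<rightharpoonup> nat\<close>, acting on the left:
  \<open>(f \<circ>\<^sub>m g) x = f (g x)\<close> where both are defined.
\<close>

definition ground :: "nat \<Rightarrow> nat set" where
  "ground n = {1..2*n}"

definition bar :: "nat \<Rightarrow> nat \<Rightarrow> nat" where
  "bar n i = 2*n + 1 - i"

definition admissible :: "nat \<Rightarrow> nat set \<Rightarrow> bool" where
  "admissible n P \<longleftrightarrow> P \<subseteq> ground n \<and> (P = ground n \<or> (\<forall>i\<in>P. bar n i \<notin> P))"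

definition map_image :: "('a \<rightharpoonup> 'b) \<Rightarrow> 'a set \<Rightarrow> 'b set" where
  "map_image f P = {y. \<exists>x\<in>P. f x = Some y}"

definition bij_between :: "'a set \<Rightarrow> 'b set \<Rightarrow> ('a \<rightharpoonup> 'b) \<Rightarrow> bool" where
  "bij_between X Y f \<longleftrightarrow> dom f = X \<and> ran f = Y \<and> inj_on f (dom f)"

definition symplectic_bij :: "nat \<Rightarrow> (nat \<rightharpoonup> nat) \<Rightarrow> bool" where
  "symplectic_bij n f \<longleftrightarrow> bij_between (ground n) (ground n) f
     \<and> (\<forall>P. admissible n P \<longrightarrow> admissible n (map_image f P))"

definition symplectic_inj :: "nat \<Rightarrow> (nat \<rightharpoonup> nat) \<Rightarrow> bool" where
  "symplectic_inj n f \<longleftrightarrow> symplectic_bij n f \<or>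
     (\<exists>X Y. bij_between X Y f \<and> admissible n X \<and> X \<noteq> ground n \<and> admissible n Y \<and> Y \<noteq> ground n)"

definition partial_id :: "'a set \<Rightarrow> ('a \<rightharpoonup> 'a)" where
  "partial_id X = (\<lambda>x. if x \<in> X then Some x else None)"

definition RSp :: "nat \<Rightarrow> (nat \<rightharpoonup> nat) monoid" where
  "RSp n = \<lparr>carrier = Collect (symplectic_inj n), monoid.mult = (\<circ>\<^sub>m), one = partial_id (ground n)\<rparr>"

definition WSp :: "nat \<Rightarrow> (nat \<rightharpoonup> nat) monoid" where
  "WSp n = \<lparr>carrier = Collect (symplectic_bij n), monoid.mult = (\<circ>\<^sub>m), one = partial_id (ground n)\<rparr>"

definition idem_e :: "nat \<Rightarrow> (nat \<rightharpoonup> nat)" where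
  "idem_e t = partial_id {1..t}"

definition We :: "nat \<Rightarrow> (nat \<rightharpoonup> nat) monoid" where
  "We t = \<lparr>carrier = Collect (bij_between {1..t} {1..t}), monoid.mult = (\<circ>\<^sub>m), one = idem_e t\<rparr>"

definition cross_section :: "nat \<Rightarrow> (nat \<rightharpoonup> nat) set" where
  "cross_section n = insert (partial_id (ground n)) (idem_e ` {0..n})"

definition idem_le :: "(nat \<rightharpoonup> nat) \<Rightarrow> (nat \<rightharpoonup> nat) \<Rightarrow> bool" where
  "idem_le e f \<longleftrightarrow> e \<circ>\<^sub>m f = e \<and> f \<circ>\<^sub>m e = e"


section \<open>Partitions and the index set\<close>

text \<open>
  A partition is the multiset of its (positive) parts, so \<open>count \<mu> i\<close> is the number of
  parts of \<open>\<mu>\<close> equal to \<open>i\<close>. The index set is a disjoint union: \<open>Inl (\<gamma>, \<delta>)\<close> belongs to the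
  unit group, \<open>Inr \<mu>\<close> to \<open>idem_e t\<close> where \<open>t = sum_mset \<mu>\<close>.
\<close>

type_synonym pindex = "nat multiset \<times> nat multiset + nat multiset"

definition Part :: "nat \<Rightarrow> nat multiset set" where
  "Part t = {\<mu>. 0 \<notin># \<mu> \<and> sum_mset \<mu> = t}"

definition SPart :: "nat \<Rightarrow> (nat multiset \<times> nat multiset) set" where
  "SPart n = {(\<gamma>, \<delta>). 0 \<notin># \<gamma> \<and> 0 \<notin># \<delta> \<and> sum_mset \<gamma> + sum_mset \<delta> = n}"

definition Qidx :: "nat \<Rightarrow> pindex set" where
  "Qidx n = SPart n <+> (\<Union>t\<in>{0..n}. Part t)"

text \<open>Indices outside the union of the supports would contribute factors \<open>0 choose 0 = 1\<close>.\<close>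

definition part_binom :: "nat multiset \<Rightarrow> nat multiset \<Rightarrow> nat" where
  "part_binom \<alpha> \<beta> = (\<Prod>i \<in> set_mset \<alpha> \<union> set_mset \<beta>. count \<alpha> i choose count \<beta> i)"

fun idem_of :: "nat \<Rightarrow> pindex \<Rightarrow> (nat \<rightharpoonup> nat)" where
  "idem_of n (Inl _) = partial_id (ground n)"
| "idem_of n (Inr \<mu>) = idem_e (sum_mset \<mu>)"

fun group_of :: "nat \<Rightarrow> pindex \<Rightarrow> (nat \<rightharpoonup> nat) monoid" where
  "group_of n (Inl _) = WSp n"
| "group_of n (Inr \<mu>) = We (sum_mset \<mu>)"


section \<open>Conjugacy classes\<close>

definition cycles_on :: "nat set \<Rightarrow> (nat \<rightharpoonup> nat) \<Rightarrow> nat set set" where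
  "cycles_on X f = orbit (\<lambda>x. the (f x)) ` X"

definition cycle_lengths :: "nat set set \<Rightarrow> nat multiset" where
  "cycle_lengths \<C> = image_mset card (mset_set \<C>)"

text \<open>
  Elements of the Weyl group commute with \<open>bar n\<close>, which therefore permutes the cycles. The cycles
  that it moves come in pairs of equal length, so each part of \<open>\<gamma>\<close> is the length of two of them.
\<close>

fun class_rep :: "nat \<Rightarrow> pindex \<Rightarrow> (nat \<rightharpoonup> nat) \<Rightarrow> bool" where
  "class_rep n (Inl (\<gamma>, \<delta>)) w \<longleftrightarrow> w \<in> carrier (WSp n)
     \<and> cycle_lengths {C \<in> cycles_on (ground n) w. bar n ` C \<noteq> C} = \<gamma> + \<gamma>
     \<and> cycle_lengths {C \<in> cycles_on (ground n) w. bar n ` C = C} = image_mset (\<lambda>a. 2 * a) \<delta>"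
| "class_rep n (Inr \<mu>) w \<longleftrightarrow> w \<in> carrier (We (sum_mset \<mu>))
     \<and> cycle_lengths (cycles_on {1..sum_mset \<mu>} w) = \<mu>"


section \<open>Complex representations and characters\<close>

definition mtrace :: "complex mat \<Rightarrow> complex" where
  "mtrace B = (\<Sum>i<dim_row B. B $$ (i, i))"

definition is_rep :: "('a, 'b) monoid_scheme \<Rightarrow> nat \<Rightarrow> ('a \<Rightarrow> complex mat) \<Rightarrow> bool" where
  "is_rep G d \<rho> \<longleftrightarrow> (\<forall>g\<in>carrier G. \<rho> g \<in> carrier_mat d d) \<and> \<rho> \<one>\<^bsub>G\<^esub> = 1\<^sub>m d
     \<and> (\<forall>g\<in>carrier G. \<forall>h\<in>carrier G. \<rho> (g \<otimes>\<^bsub>G\<^esub> h) = \<rho> g * \<rho> h)"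

definition is_irr_rep :: "('a, 'b) monoid_scheme \<Rightarrow> nat \<Rightarrow> ('a \<Rightarrow> complex mat) \<Rightarrow> bool" where
  "is_irr_rep G d \<rho> \<longleftrightarrow> is_rep G d \<rho> \<and> d > 0
     \<and> (\<forall>U. subspace class_ring U (module_vec TYPE(complex) d)
          \<and> (\<forall>g\<in>carrier G. \<forall>u\<in>U. \<rho> g *\<^sub>v u \<in> U)
          \<longrightarrow> U = {0\<^sub>v d} \<or> U = carrier_vec d)"

definition rep_char :: "('a, 'b) monoid_scheme \<Rightarrow> ('a \<Rightarrow> complex mat) \<Rightarrow> 'a \<Rightarrow> complex" where
  "rep_char G \<rho> = (\<lambda>g\<in>carrier G. mtrace (\<rho> g))"

definition irr_chars :: "('a, 'b) monoid_scheme \<Rightarrow> ('a \<Rightarrow> complex) set" where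
  "irr_chars G = {rep_char G \<rho> | d \<rho>. is_irr_rep G d \<rho>}"

text \<open>
  For \<open>V\<close> the space of column vectors of length \<open>d\<close>, \<open>H\<close> acts on the subspace \<open>eV\<close> through \<open>\<rho>\<close>
  with character \<open>\<phi>\<close>. The columns of \<open>J\<close> are a basis of \<open>eV\<close>, and \<open>\<sigma>\<close> is the action of \<open>H\<close> on
  \<open>eV\<close> in that basis.
\<close>

definition acts_on_image_with_char ::
  "('a, 'b) monoid_scheme \<Rightarrow> nat \<Rightarrow> ('a \<Rightarrow> complex mat) \<Rightarrow> 'a \<Rightarrow> ('a \<Rightarrow> complex) \<Rightarrow> bool" where
  "acts_on_image_with_char H d \<rho> e \<phi> \<longleftrightarrow>
     (\<exists>k J \<sigma>. J \<in> carrier_mat d k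
        \<and> inj_on (\<lambda>v. J *\<^sub>v v) (carrier_vec k)
        \<and> (\<lambda>v. J *\<^sub>v v) ` carrier_vec k = (\<lambda>v. \<rho> e *\<^sub>v v) ` carrier_vec d
        \<and> is_rep H k \<sigma>
        \<and> (\<forall>w\<in>carrier H. \<rho> w * J = J * \<sigma> w \<and> mtrace (\<sigma> w) = \<phi> w))"

text \<open>
  \<open>affords_irr n \<mu> \<phi> \<psi>\<close>: \<open>\<psi>\<close> is the character of the irreducible representation of \<open>RSp n\<close> whose
  apex is the idempotent of \<open>\<mu>\<close> and on whose \<open>eV\<close> the group \<open>group_of n \<mu>\<close> has character \<open>\<phi>\<close>.
\<close>

definition affords_irr ::
  "nat \<Rightarrow> pindex \<Rightarrow> ((nat \<rightharpoonup> nat) \<Rightarrow> complex) \<Rightarrow> ((nat \<rightharpoonup> nat) \<Rightarrow> complex) \<Rightarrow> bool" where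
  "affords_irr n \<mu> \<phi> \<psi> \<longleftrightarrow>
     (\<exists>d \<rho>. is_irr_rep (RSp n) d \<rho>
        \<and> (\<forall>g\<in>carrier (RSp n). \<psi> g = mtrace (\<rho> g))
        \<and> \<rho> (idem_of n \<mu>) \<noteq> 0\<^sub>m d d
        \<and> (\<forall>f\<in>cross_section n. \<rho> f \<noteq> 0\<^sub>m d d \<longrightarrow> idem_le (idem_of n \<mu>) f)
        \<and> acts_on_image_with_char (group_of n \<mu>) d \<rho> (idem_of n \<mu>) \<phi>)"


section \<open>The matrices\<close>

text \<open>Row \<open>\<alpha>\<close> is a conjugacy class with representative \<open>r \<alpha>\<close>, column \<open>\<mu>\<close> an irreducible character.\<close>

definition M_mat :: "(pindex \<Rightarrow> (nat \<rightharpoonup> nat) \<Rightarrow> complex) \<Rightarrow> (pindex \<Rightarrow> (nat \<rightharpoonup> nat)) \<Rightarrow>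
    pindex \<Rightarrow> pindex \<Rightarrow> complex" where
  "M_mat chi r \<alpha> \<mu> = chi \<mu> (r \<alpha>)"

fun same_block :: "pindex \<Rightarrow> pindex \<Rightarrow> bool" where
  "same_block (Inl _) (Inl _) = True"
| "same_block (Inr \<alpha>) (Inr \<mu>) = (sum_mset \<alpha> = sum_mset \<mu>)"
| "same_block _ _ = False"

definition Y_mat :: "(pindex \<Rightarrow> (nat \<rightharpoonup> nat) \<Rightarrow> complex) \<Rightarrow> (pindex \<Rightarrow> (nat \<rightharpoonup> nat)) \<Rightarrow>
    pindex \<Rightarrow> pindex \<Rightarrow> complex" where
  "Y_mat chibar r \<alpha> \<mu> = (if same_block \<alpha> \<mu> then chibar \<mu> (r \<alpha>) else 0)"

definition is_A_matrix :: "nat \<Rightarrow> (pindex \<Rightarrow> pindex \<Rightarrow> complex) \<Rightarrow> (pindex \<Rightarrow> pindex \<Rightarrow> complex) \<Rightarrow>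
    (pindex \<Rightarrow> pindex \<Rightarrow> complex) \<Rightarrow> bool" where
  "is_A_matrix n M Y A \<longleftrightarrow>
     (\<forall>\<alpha>\<in>Qidx n. \<forall>\<mu>\<in>Qidx n. M \<alpha> \<mu> = (\<Sum>\<beta>\<in>Qidx n. A \<alpha> \<beta> * Y \<beta> \<mu>))"

end

theory Submission
  imports
    Defs
    "Jordan_Normal_Form.Char_Poly"
    "HOL-Computational_Algebra.Fundamental_Theorem_Algebra"
begin

text \<open>
  Two things carry the theorem: the matrix \<open>A_entry\<close> with the stated entries satisfies \<open>M = A Y\<close>, and
  the rows of \<open>Y\<close> are linearly independent, so that no other matrix does.

  \<^bold>\<open>Existence.\<close> Let \<open>V\<close> be the irreducible representation of \<open>RSp n\<close> attached to a column \<open>\<mu>\<close>. If its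
  apex is \<open>1\<close>, then every \<open>idem_e t\<close> acts as \<open>0\<close>, hence so does every element of \<open>We t\<close>, and on the units
  \<open>V\<close> is just a representation of the Weyl group (\<open>top_apex_values\<close>). If the apex is \<open>e = idem_e t\<close>, then
  every element of rank below \<open>t\<close> acts as \<open>0\<close>, because it factors through some \<open>idem_e s\<close> with
  \<open>s < t\<close>. The partial identities on the proper admissible sets \<open>K\<close> of size \<open>t\<close> therefore act as
  pairwise orthogonal projections. The image of their sum is invariant, so by irreducibility the
  sum is the identity. This splits the trace of \<open>g\<close> into the traces of its restrictions to
  these \<open>K\<close>. A restriction has trace \<open>0\<close> unless \<open>g K = K\<close>; if \<open>g K = K\<close>, a bijection from \<open>{1..t}\<close> to \<open>K\<close>
  turns the restriction into a permutation of \<open>{1..t}\<close> of the same cycle type, whose trace on \<open>V\<close>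
  is its character value on \<open>eV\<close> (\<open>apex_rep.trace_eq_sum\<close>). So the entry of \<open>A\<close> at \<open>(\<alpha>, \<lambda>)\<close> is
  the number of proper admissible sets \<open>K\<close> with \<open>r \<alpha> K = K\<close> on which \<open>r \<alpha>\<close> has cycle type \<open>\<lambda>\<close>
  (\<open>lower_apex_values\<close>). Such a \<open>K\<close> is a union of cycles. For \<open>r \<alpha>\<close> in a symmetric group all unions are
  allowed, and choosing the cycles length by length gives the product of binomial coefficients.
  For \<open>r \<alpha>\<close> in the Weyl group no bar-stable cycle may be chosen, and at most one of two
  cycles interchanged by the bar; each chosen pair gives a factor \<open>2\<close>
  (\<open>card_partial_transversals\<close> counts both cases).

  \<^bold>\<open>Uniqueness.\<close> \<open>Y\<close> is block diagonal with square blocks. The columns of a block are the irreducible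
  characters of a finite group; they are linearly independent by Schur's orthogonality relations
  (\<open>irr_chars_linearly_independent\<close>), and remain so when evaluated only at the representatives, because
  these meet every conjugacy class (\<open>We_conjugate_to_rep\<close>, \<open>WSp_conjugate_to_rep\<close>). In a square
  matrix independent columns force independent rows.
\<close>

section \<open>Linear algebra\<close>

lemma index_mult_mat_sum:
  assumes "A \<in> carrier_mat a b" "B \<in> carrier_mat b c" "i < a" "j < c"
  shows "(A * B) $$ (i, j) = (\<Sum>l<b. A $$ (i, l) * B $$ (l, j))"
  using assms by (auto simp: scalar_prod_def atLeast0LessThan)

lemma index_mult_vec_sum:
  assumes "A \<in> carrier_mat a b" "v \<in> carrier_vec b" "i < a"
  shows "(A *\<^sub>v v) $ i = (\<Sum>l<b. A $$ (i, l) * v $ l)"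
  using assms by (auto simp: scalar_prod_def atLeast0LessThan)

lemma mtrace_sum: "A \<in> carrier_mat a b \<Longrightarrow> mtrace A = (\<Sum>i<a. A $$ (i, i))"
  by (auto simp: mtrace_def)

lemma mtrace_mult_commute:
  assumes A: "A \<in> carrier_mat a b" and B: "B \<in> carrier_mat b a"
  shows "mtrace (A * B) = mtrace (B * A)"
proof -
  have "mtrace (A * B) = (\<Sum>i<a. \<Sum>l<b. A $$ (i, l) * B $$ (l, i))"
    using A B by (simp add: mtrace_sum[of _ a a] index_mult_mat_sum[OF A B] del: index_mult_mat)
  also have "\<dots> = (\<Sum>l<b. \<Sum>i<a. B $$ (l, i) * A $$ (i, l))"
    by (subst sum.swap) (simp add: mult.commute)
  also have "\<dots> = mtrace (B * A)"
    using A B by (simp add: mtrace_sum[of _ b b] index_mult_mat_sum[OF B A] del: index_mult_mat)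
  finally show ?thesis .
qed

lemma subspace_module_vecI:
  fixes U :: "complex vec set"
  assumes "U \<subseteq> carrier_vec d" "0\<^sub>v d \<in> U"
    and "\<And>u v. u \<in> U \<Longrightarrow> v \<in> U \<Longrightarrow> u + v \<in> U"
    and "\<And>c u. u \<in> U \<Longrightarrow> c \<cdot>\<^sub>v u \<in> U"
  shows "VectorSpace.subspace class_ring U (module_vec TYPE(complex) d)"
proof -
  interpret vec_space "TYPE(complex)" d .
  have "submodule class_ring U (module_vec TYPE(complex) d)"
    using assms vec_module by (intro submodule.intro) (auto simp: module_vec_simps)
  then show ?thesis
    using vec_vs by (intro VectorSpace.subspace.intro)
qed

lemma mult_unit_vec_eq_col:
  fixes A :: "complex mat"
  shows "A \<in> carrier_mat a b \<Longrightarrow> j < b \<Longrightarrow> A *\<^sub>v unit_vec b j = col A j"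
  by (intro eq_vecI) (auto simp: scalar_prod_right_unit)

lemma mat_eqI_mult_vec:
  fixes A B :: "complex mat"
  assumes A: "A \<in> carrier_mat a b" and B: "B \<in> carrier_mat a b"
    and eq: "\<And>v. v \<in> carrier_vec b \<Longrightarrow> A *\<^sub>v v = B *\<^sub>v v"
  shows "A = B"
proof (rule mat_col_eqI)
  fix j assume j: "j < dim_col B"
  then have "A *\<^sub>v unit_vec b j = B *\<^sub>v unit_vec b j"
    using B by (intro eq) auto
  then show "col A j = col B j"
    using A B j by (simp add: mult_unit_vec_eq_col)
qed (use A B in auto)

text \<open>
  The coordinates of the columns of \<open>A\<close> with respect to the columns of \<open>J\<close> form a matrix.
\<close>

lemma factor_through_image:
  fixes J A :: "complex mat"
  assumes J: "J \<in> carrier_mat d k" and A: "A \<in> carrier_mat d m"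
    and im: "\<And>v. v \<in> carrier_vec m \<Longrightarrow> A *\<^sub>v v \<in> (\<lambda>v. J *\<^sub>v v) ` carrier_vec k"
  shows "\<exists>L \<in> carrier_mat k m. J * L = A"
proof -
  have "\<exists>u. u \<in> carrier_vec k \<and> J *\<^sub>v u = col A j" if "j < m" for j
    using im[of "unit_vec m j"] mult_unit_vec_eq_col[OF A that] by (auto simp: image_iff)
  then obtain u where u: "\<And>j. j < m \<Longrightarrow> u j \<in> carrier_vec k \<and> J *\<^sub>v u j = col A j"
    by metis
  define L where "L = mat_of_cols k (map u [0..<m])"
  have L: "L \<in> carrier_mat k m"
    by (simp add: L_def mat_of_cols_def)
  have "J * L = A"
  proof (rule mat_col_eqI)
    fix j assume "j < dim_col A"
    then have j: "j < m" using A by simp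
    have "col (J * L) j = J *\<^sub>v col L j"
      using col_mult2[OF J L j] .
    also have "col L j = u j"
      using u[OF j] j by (simp add: L_def)
    finally show "col (J * L) j = col A j"
      using u[OF j] by simp
  qed (use J L A in auto)
  with L show ?thesis by blast
qed

lemma inj_mult_mat_cancel:
  fixes J :: "complex mat"
  assumes J: "J \<in> carrier_mat d k" and inj: "inj_on (\<lambda>v. J *\<^sub>v v) (carrier_vec k)"
    and A: "A \<in> carrier_mat k m" and B: "B \<in> carrier_mat k m" and eq: "J * A = J * B"
  shows "A = B"
proof (rule mat_eqI_mult_vec[OF A B])
  fix v :: "complex vec" assume v: "v \<in> carrier_vec m"
  have "J *\<^sub>v (A *\<^sub>v v) = J *\<^sub>v (B *\<^sub>v v)"
    using eq assoc_mult_mat_vec[OF J A v] assoc_mult_mat_vec[OF J B v] by (simp del: assoc_mult_mat_vec)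
  then show "A *\<^sub>v v = B *\<^sub>v v"
    using inj A B v by (auto dest!: inj_onD)
qed

text \<open>
  A square matrix and its transpose have the same determinant, so a nontrivial relation between the
  rows yields one between the columns. The index sets are abstract, hence the enumerations \<open>p\<close>, \<open>q\<close>.
\<close>

lemma square_system_transpose:
  fixes F :: "'i \<Rightarrow> 'j \<Rightarrow> complex"
  assumes fin: "finite I" and bij: "finite J" "card I = card J"
    and cols: "\<And>a. (\<And>i. i \<in> I \<Longrightarrow> (\<Sum>j\<in>J. F i j * a j) = 0) \<Longrightarrow> \<forall>j\<in>J. a j = 0"
    and rows: "\<And>j. j \<in> J \<Longrightarrow> (\<Sum>i\<in>I. b i * F i j) = 0"
    and i: "i \<in> I"
  shows "b i = 0"
proof (rule ccontr)
  assume nz: "b i \<noteq> 0"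
  define m where "m = card I"
  obtain p where p: "bij_betw p {..<m} I"
    using ex_bij_betw_nat_finite[OF fin] by (auto simp: m_def atLeast0LessThan)
  obtain q where q: "bij_betw q {..<m} J"
    using ex_bij_betw_nat_finite[OF bij(1)] bij(2) by (auto simp: m_def atLeast0LessThan)
  define Y where "Y = mat m m (\<lambda>(x, y). F (p x) (q y))"
  have Y: "Y \<in> carrier_mat m m" by (simp add: Y_def)
  have "det (transpose_mat Y) = 0"
  proof -
    define v where "v = vec m (\<lambda>x. b (p x))"
    obtain x where x: "x < m" "p x = i"
      using p i by (auto simp: bij_betw_def)
    have "v \<noteq> 0\<^sub>v m"
      using x nz by (auto simp: v_def dest!: arg_cong[of _ _ "\<lambda>v. v $ x"])
    moreover have "transpose_mat Y *\<^sub>v v = 0\<^sub>v m"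
    proof (rule eq_vecI)
      fix y assume "y < dim_vec (0\<^sub>v m :: complex vec)"
      then have y: "y < m" by simp
      have "(transpose_mat Y *\<^sub>v v) $ y = (\<Sum>x<m. b (p x) * F (p x) (q y))"
        using y by (subst index_mult_vec_sum[of _ m m]) (auto simp: Y_def v_def mult.commute)
      also have "\<dots> = (\<Sum>i\<in>I. b i * F i (q y))"
        using sum.reindex_bij_betw[OF p, of "\<lambda>i. b i * F i (q y)"] .
      also have "\<dots> = 0"
        using q y by (intro rows) (auto simp: bij_betw_def)
      finally show "(transpose_mat Y *\<^sub>v v) $ y = 0\<^sub>v m $ y" using y by simp
    qed (simp add: Y_def)
    moreover have "v \<in> carrier_vec m" by (simp add: v_def)
    ultimately show ?thesis
      using det_0_iff_vec_prod_zero[of "transpose_mat Y" m] Y by auto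
  qed
  then have "det Y = 0" using det_transpose[OF Y] by simp
  then obtain v where v: "v \<in> carrier_vec m" "v \<noteq> 0\<^sub>v m" "Y *\<^sub>v v = 0\<^sub>v m"
    using det_0_iff_vec_prod_zero[OF Y] by auto
  define a where "a = (\<lambda>j. v $ inv_into {..<m} q j)"
  have aq: "a (q y) = v $ y" if "y < m" for y
    using q that by (simp add: a_def bij_betw_def)
  have "\<forall>j\<in>J. a j = 0"
  proof (rule cols)
    fix i assume "i \<in> I"
    then obtain x where x: "x < m" "p x = i"
      using p by (auto simp: bij_betw_def)
    have "(\<Sum>j\<in>J. F i j * a j) = (\<Sum>y<m. F i (q y) * a (q y))"
      using sum.reindex_bij_betw[OF q, of "\<lambda>j. F i j * a j"] by simp
    also have "\<dots> = (Y *\<^sub>v v) $ x"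
      using x v(1) by (subst index_mult_vec_sum[OF Y]) (auto simp: Y_def aq)
    finally show "(\<Sum>j\<in>J. F i j * a j) = 0" using v(3) x by simp
  qed
  then have "v $ y = 0" if "y < m" for y
    using aq[OF that] q that by (auto simp: bij_betw_def)
  then have "v = 0\<^sub>v m" using v(1) by (intro eq_vecI) auto
  with v(2) show False by simp
qed

text \<open>
  Matrices of size \<open>d\<close> do not form a type, so that a finite sum of them is taken entry by entry.
\<close>

definition mat_sum :: "nat \<Rightarrow> ('i \<Rightarrow> complex mat) \<Rightarrow> 'i set \<Rightarrow> complex mat" where
  "mat_sum d F S = mat d d (\<lambda>ij. \<Sum>s\<in>S. F s $$ ij)"

lemma mat_sum_carrier [simp]: "mat_sum d F S \<in> carrier_mat d d"
  by (simp add: mat_sum_def)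

lemma mult_mat_sum:
  assumes A: "A \<in> carrier_mat d d" and F: "\<And>s. s \<in> S \<Longrightarrow> F s \<in> carrier_mat d d"
  shows "A * mat_sum d F S = mat_sum d (\<lambda>s. A * F s) S"
proof (rule eq_matI)
  fix i j assume "i < dim_row (mat_sum d (\<lambda>s. A * F s) S)" "j < dim_col (mat_sum d (\<lambda>s. A * F s) S)"
  then have ij: "i < d" "j < d" by (simp_all add: mat_sum_def)
  have "(A * mat_sum d F S) $$ (i, j) = (\<Sum>l<d. \<Sum>s\<in>S. A $$ (i, l) * F s $$ (l, j))"
    using ij by (subst index_mult_mat_sum[OF A mat_sum_carrier ij]) (simp add: mat_sum_def sum_distrib_left)
  also have "\<dots> = (\<Sum>s\<in>S. \<Sum>l<d. A $$ (i, l) * F s $$ (l, j))" by (rule sum.swap)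
  also have "\<dots> = (\<Sum>s\<in>S. (A * F s) $$ (i, j))"
    by (intro sum.cong refl) (rule index_mult_mat_sum[OF A F ij, symmetric])
  finally show "(A * mat_sum d F S) $$ (i, j) = mat_sum d (\<lambda>s. A * F s) S $$ (i, j)"
    using ij by (simp add: mat_sum_def)
qed (use A in \<open>auto simp: mat_sum_def\<close>)

lemma mat_sum_mult:
  assumes A: "A \<in> carrier_mat d d" and F: "\<And>s. s \<in> S \<Longrightarrow> F s \<in> carrier_mat d d"
  shows "mat_sum d F S * A = mat_sum d (\<lambda>s. F s * A) S"
proof (rule eq_matI)
  fix i j assume "i < dim_row (mat_sum d (\<lambda>s. F s * A) S)" "j < dim_col (mat_sum d (\<lambda>s. F s * A) S)"
  then have ij: "i < d" "j < d" by (simp_all add: mat_sum_def)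
  have "(mat_sum d F S * A) $$ (i, j) = (\<Sum>l<d. \<Sum>s\<in>S. F s $$ (i, l) * A $$ (l, j))"
    using ij by (subst index_mult_mat_sum[OF mat_sum_carrier A ij]) (simp add: mat_sum_def sum_distrib_right)
  also have "\<dots> = (\<Sum>s\<in>S. \<Sum>l<d. F s $$ (i, l) * A $$ (l, j))" by (rule sum.swap)
  also have "\<dots> = (\<Sum>s\<in>S. (F s * A) $$ (i, j))"
    by (intro sum.cong refl) (rule index_mult_mat_sum[OF F A ij, symmetric])
  finally show "(mat_sum d F S * A) $$ (i, j) = mat_sum d (\<lambda>s. F s * A) S $$ (i, j)"
    using ij by (simp add: mat_sum_def)
qed (use A in \<open>auto simp: mat_sum_def\<close>)

lemma mat_sum_cong: "(\<And>s. s \<in> S \<Longrightarrow> F s = F' s) \<Longrightarrow> mat_sum d F S = mat_sum d F' S"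
  by (simp add: mat_sum_def)

lemma mat_sum_single:
  assumes "finite S" "k \<in> S" "F k \<in> carrier_mat d d" "\<And>s. s \<in> S \<Longrightarrow> s \<noteq> k \<Longrightarrow> F s = 0\<^sub>m d d"
  shows "mat_sum d F S = F k"
proof (rule eq_matI)
  fix i j assume "i < dim_row (F k)" "j < dim_col (F k)"
  then have ij: "i < d" "j < d" using assms(3) by auto
  have "(\<Sum>s\<in>S - {k}. F s $$ (i, j)) = 0"
    using assms(4) ij by (intro sum.neutral) auto
  then show "mat_sum d F S $$ (i, j) = F k $$ (i, j)"
    using ij by (simp add: mat_sum_def sum.remove[OF assms(1,2)])
qed (use assms(3) in \<open>auto simp: mat_sum_def\<close>)

lemma mtrace_mat_sum:
  assumes "\<And>s. s \<in> S \<Longrightarrow> F s \<in> carrier_mat d d"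
  shows "mtrace (mat_sum d F S) = (\<Sum>s\<in>S. mtrace (F s))"
proof -
  have "mtrace (mat_sum d F S) = (\<Sum>i<d. \<Sum>s\<in>S. F s $$ (i, i))"
    by (simp add: mtrace_sum[OF mat_sum_carrier]) (simp add: mat_sum_def)
  also have "\<dots> = (\<Sum>s\<in>S. \<Sum>i<d. F s $$ (i, i))" by (rule sum.swap)
  also have "\<dots> = (\<Sum>s\<in>S. mtrace (F s))"
    by (intro sum.cong refl) (simp add: mtrace_sum[OF assms])
  finally show ?thesis .
qed

section \<open>Orthogonality of irreducible characters\<close>

lemma is_irr_repD:
  assumes "is_irr_rep G d \<rho>"
  shows "d > 0" "\<rho> \<one>\<^bsub>G\<^esub> = 1\<^sub>m d"
    "\<And>g. g \<in> carrier G \<Longrightarrow> \<rho> g \<in> carrier_mat d d"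
    "\<And>g h. g \<in> carrier G \<Longrightarrow> h \<in> carrier G \<Longrightarrow> \<rho> (g \<otimes>\<^bsub>G\<^esub> h) = \<rho> g * \<rho> h"
  using assms by (auto simp: is_irr_rep_def is_rep_def)

lemma irr_rep_invariant_subspace:
  assumes irr: "is_irr_rep G d \<rho>"
    and U: "U \<subseteq> carrier_vec d" "0\<^sub>v d \<in> U"
      "\<And>u v. u \<in> U \<Longrightarrow> v \<in> U \<Longrightarrow> u + v \<in> U" "\<And>c u. u \<in> U \<Longrightarrow> c \<cdot>\<^sub>v u \<in> U"
    and inv: "\<And>g u. g \<in> carrier G \<Longrightarrow> u \<in> U \<Longrightarrow> \<rho> g *\<^sub>v u \<in> U"
  shows "U = {0\<^sub>v d} \<or> U = carrier_vec d"
  using irr subspace_module_vecI[OF U] inv by (auto simp: is_irr_rep_def)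

text \<open>
  Schur's lemma: the kernel and the image of an intertwiner are invariant subspaces, so a nonzero
  intertwiner is injective and surjective.
\<close>

lemma intertwiner_invertible:
  assumes irr: "is_irr_rep G d \<rho>" "is_irr_rep G k \<sigma>"
    and X: "X \<in> carrier_mat d k" "X \<noteq> 0\<^sub>m d k"
    and comm: "\<And>g. g \<in> carrier G \<Longrightarrow> \<rho> g * X = X * \<sigma> g"
  shows "\<exists>Z \<in> carrier_mat k d. X * Z = 1\<^sub>m d \<and> Z * X = 1\<^sub>m k"
proof -
  note \<rho> = is_irr_repD(3)[OF irr(1)] and \<sigma> = is_irr_repD(3)[OF irr(2)]
  have comm_vec: "\<rho> g *\<^sub>v (X *\<^sub>v v) = X *\<^sub>v (\<sigma> g *\<^sub>v v)" if "g \<in> carrier G" "v \<in> carrier_vec k" for g v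
    using assoc_mult_mat_vec[OF \<rho>[OF that(1)] X(1) that(2)] assoc_mult_mat_vec[OF X(1) \<sigma>[OF that(1)] that(2)]
      comm[OF that(1)] by (simp del: assoc_mult_mat_vec)
  define N where "N = {v \<in> carrier_vec k. X *\<^sub>v v = 0\<^sub>v d}"
  define R where "R = (\<lambda>v. X *\<^sub>v v) ` carrier_vec k"
  have "\<exists>v \<in> carrier_vec k. X *\<^sub>v v \<noteq> 0\<^sub>v d"
  proof (rule ccontr)
    assume "\<not> ?thesis"
    then have "X *\<^sub>v v = 0\<^sub>m d k *\<^sub>v v" if "v \<in> carrier_vec k" for v
      using that by auto
    then have "X = 0\<^sub>m d k"
      by (intro mat_eqI_mult_vec[OF X(1)]) auto
    with X(2) show False ..
  qed
  then obtain v where v: "v \<in> carrier_vec k" "X *\<^sub>v v \<noteq> 0\<^sub>v d" by blast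
  have "N = {0\<^sub>v k} \<or> N = carrier_vec k"
  proof (rule irr_rep_invariant_subspace[OF irr(2)])
    show "u + v \<in> N" if "u \<in> N" "v \<in> N" for u v
      using that mult_add_distrib_mat_vec[OF X(1), of u v] by (simp add: N_def)
    show "c \<cdot>\<^sub>v u \<in> N" if "u \<in> N" for c u
      using that mult_mat_vec[OF X(1), of u c] by (auto simp: N_def intro: eq_vecI)
    fix g u assume g: "g \<in> carrier G" and "u \<in> N"
    then have u: "u \<in> carrier_vec k" "X *\<^sub>v u = 0\<^sub>v d" by (auto simp: N_def)
    have "\<rho> g *\<^sub>v 0\<^sub>v d = 0\<^sub>v d" using \<rho>[OF g] by (intro eq_vecI) auto
    then have "X *\<^sub>v (\<sigma> g *\<^sub>v u) = 0\<^sub>v d"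
      using comm_vec[OF g u(1), symmetric] u(2) by simp
    then show "\<sigma> g *\<^sub>v u \<in> N"
      using \<sigma>[OF g] u by (auto simp: N_def)
  qed (use X(1) in \<open>auto simp: N_def\<close>)
  moreover have "v \<notin> N" using v by (simp add: N_def)
  ultimately have N: "N = {0\<^sub>v k}" using v(1) by blast
  have "R = {0\<^sub>v d} \<or> R = carrier_vec d"
  proof (rule irr_rep_invariant_subspace[OF irr(1)])
    show "0\<^sub>v d \<in> R"
      using X(1) by (auto simp: R_def image_iff intro!: bexI[of _ "0\<^sub>v k"])
    show "u + v \<in> R" if uv: "u \<in> R" "v \<in> R" for u v
    proof -
      obtain a b where ab: "a \<in> carrier_vec k" "u = X *\<^sub>v a" "b \<in> carrier_vec k" "v = X *\<^sub>v b"
        using uv unfolding R_def by blast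
      then have "u + v = X *\<^sub>v (a + b)" "a + b \<in> carrier_vec k"
        using mult_add_distrib_mat_vec[OF X(1)] by simp_all
      then show ?thesis unfolding R_def by (rule image_eqI)
    qed
    show "c \<cdot>\<^sub>v u \<in> R" if u: "u \<in> R" for c u
    proof -
      obtain a where a: "a \<in> carrier_vec k" "u = X *\<^sub>v a"
        using u unfolding R_def by blast
      then have "c \<cdot>\<^sub>v u = X *\<^sub>v (c \<cdot>\<^sub>v a)" "c \<cdot>\<^sub>v a \<in> carrier_vec k"
        using mult_mat_vec[OF X(1)] by simp_all
      then show ?thesis unfolding R_def by (rule image_eqI)
    qed
    show "\<rho> g *\<^sub>v u \<in> R" if g: "g \<in> carrier G" and u: "u \<in> R" for g u
    proof -
      obtain a where a: "a \<in> carrier_vec k" "u = X *\<^sub>v a"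
        using u unfolding R_def by blast
      then have "\<rho> g *\<^sub>v u = X *\<^sub>v (\<sigma> g *\<^sub>v a)"
        using comm_vec[OF g] by simp
      moreover have "\<sigma> g *\<^sub>v a \<in> carrier_vec k"
        using \<sigma>[OF g] a by simp
      ultimately show ?thesis unfolding R_def by (rule image_eqI)
    qed
  qed (use X(1) in \<open>auto simp: R_def\<close>)
  moreover have "X *\<^sub>v v \<in> R" using v(1) by (simp add: R_def)
  ultimately have R: "R = carrier_vec d" using v(2) by blast
  have inj: "inj_on (\<lambda>v. X *\<^sub>v v) (carrier_vec k)"
  proof (rule inj_onI)
    fix u w :: "complex vec" assume u: "u \<in> carrier_vec k" "w \<in> carrier_vec k" and eq: "X *\<^sub>v u = X *\<^sub>v w"
    have "X *\<^sub>v (u - w) = 0\<^sub>v d"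
      using X(1) u eq by (simp add: mult_minus_distrib_mat_vec)
    then have "u - w \<in> N" using u by (simp add: N_def)
    then have "u - w = 0\<^sub>v k" using N by simp
    then have "u $ i = w $ i" if "i < k" for i
      using u that by (auto dest!: arg_cong[of _ _ "\<lambda>v. v $ i"])
    then show "u = w" using u by (intro eq_vecI) auto
  qed
  obtain Z where Z: "Z \<in> carrier_mat k d" "X * Z = 1\<^sub>m d"
    using factor_through_image[OF X(1), of "1\<^sub>m d" d] R unfolding R_def by auto
  have "X * (Z * X) = X * 1\<^sub>m k"
    using assoc_mult_mat[OF X(1) Z(1) X(1)] X(1) Z by (simp del: assoc_mult_mat)
  then have "Z * X = 1\<^sub>m k"
    by (rule inj_mult_mat_cancel[OF X(1) inj mult_carrier_mat[OF Z(1) X(1)] one_carrier_mat])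
  with Z show ?thesis by blast
qed

text \<open>
  The second half of Schur's lemma: an eigenspace of \<open>X\<close> is invariant, and there is one because the
  characteristic polynomial has a complex root.
\<close>

lemma self_intertwiner_scalar:
  assumes irr: "is_irr_rep G d \<rho>" and X: "X \<in> carrier_mat d d"
    and comm: "\<And>g. g \<in> carrier G \<Longrightarrow> \<rho> g * X = X * \<rho> g"
  shows "\<exists>c. X = c \<cdot>\<^sub>m 1\<^sub>m d"
proof -
  note \<rho> = is_irr_repD(3)[OF irr]
  have "degree (char_poly X) = d" using degree_monic_char_poly[OF X] by simp
  then have "\<not> constant (poly (char_poly X))"
    using is_irr_repD(1)[OF irr] by (simp add: constant_degree)
  then obtain c where "poly (char_poly X) c = 0"
    using fundamental_theorem_of_algebra by blast
  then obtain v where v: "v \<in> carrier_vec d" "v \<noteq> 0\<^sub>v d" "X *\<^sub>v v = c \<cdot>\<^sub>v v"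
    using X by (auto simp: eigenvalue_root_char_poly[OF X, symmetric] eigenvalue_def eigenvector_def)
  define U where "U = {v \<in> carrier_vec d. X *\<^sub>v v = c \<cdot>\<^sub>v v}"
  have "U = {0\<^sub>v d} \<or> U = carrier_vec d"
  proof (rule irr_rep_invariant_subspace[OF irr])
    fix g u assume g: "g \<in> carrier G" and "u \<in> U"
    then have u: "u \<in> carrier_vec d" "X *\<^sub>v u = c \<cdot>\<^sub>v u" by (auto simp: U_def)
    have "X *\<^sub>v (\<rho> g *\<^sub>v u) = \<rho> g *\<^sub>v (X *\<^sub>v u)"
      using assoc_mult_mat_vec[OF \<rho>[OF g] X u(1)] assoc_mult_mat_vec[OF X \<rho>[OF g] u(1)] comm[OF g]
      by (simp del: assoc_mult_mat_vec)
    then show "\<rho> g *\<^sub>v u \<in> U"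
      using \<rho>[OF g] u by (auto simp: U_def mult_mat_vec)
  qed (use X in \<open>auto simp: U_def mult_add_distrib_mat_vec smult_add_distrib_vec mult_mat_vec[of _ d d] smult_smult_assoc mult.commute\<close>)
  moreover have "v \<in> U" using v by (simp add: U_def)
  ultimately have U: "U = carrier_vec d" using v(2) by blast
  have "X = c \<cdot>\<^sub>m 1\<^sub>m d"
  proof (rule mat_eqI_mult_vec[OF X])
    fix v :: "complex vec" assume v: "v \<in> carrier_vec d"
    then have "X *\<^sub>v v = c \<cdot>\<^sub>v v" using U by (auto simp: U_def)
    also have "\<dots> = c \<cdot>\<^sub>m 1\<^sub>m d *\<^sub>v v"
      using v by (intro eq_vecI) (auto simp: scalar_prod_left_unit)
    finally show "X *\<^sub>v v = c \<cdot>\<^sub>m 1\<^sub>m d *\<^sub>v v" .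
  qed auto
  then show ?thesis ..
qed

text \<open>
  \<open>X\<close> is the average, up to the factor \<open>card (carrier G)\<close>, of the elementary matrix with its entry \<open>1\<close> at
  \<open>(p, q)\<close> under the action \<open>E \<mapsto> \<rho> g * E * \<sigma> (inv g)\<close>. Summing over the whole group makes it invariant.
\<close>

lemma averaged_intertwines:
  assumes "group G" and irr: "is_irr_rep G d \<rho>" "is_irr_rep G k \<sigma>"
    and p: "p < d" and q: "q < k" and h: "h \<in> carrier G"
  defines "X \<equiv> mat d k (\<lambda>(i, j). \<Sum>g\<in>carrier G. \<rho> g $$ (i, p) * \<sigma> (inv\<^bsub>G\<^esub> g) $$ (q, j))"
  shows "\<rho> h * X = X * \<sigma> h"
proof (rule eq_matI)
  interpret group G by fact
  note \<rho> = is_irr_repD(3,4)[OF irr(1)] and \<sigma> = is_irr_repD(3,4)[OF irr(2)]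
  fix i j assume "i < dim_row (X * \<sigma> h)" "j < dim_col (X * \<sigma> h)"
  then have i: "i < d" and j: "j < k" using \<sigma>(1)[OF h] by (auto simp: X_def)
  have X: "X \<in> carrier_mat d k" by (simp add: X_def)
  have "(\<rho> h * X) $$ (i, j) = (\<Sum>l<d. \<rho> h $$ (i, l) * (\<Sum>g\<in>carrier G. \<rho> g $$ (l, p) * \<sigma> (inv\<^bsub>G\<^esub> g) $$ (q, j)))"
    using index_mult_mat_sum[OF \<rho>(1)[OF h] X i j] j by (simp add: X_def)
  also have "\<dots> = (\<Sum>g\<in>carrier G. (\<Sum>l<d. \<rho> h $$ (i, l) * \<rho> g $$ (l, p)) * \<sigma> (inv\<^bsub>G\<^esub> g) $$ (q, j))"
    by (simp add: sum_distrib_left sum_distrib_right mult.assoc) (rule sum.swap)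
  also have "\<dots> = (\<Sum>g\<in>carrier G. \<rho> (h \<otimes>\<^bsub>G\<^esub> g) $$ (i, p) * \<sigma> (inv\<^bsub>G\<^esub> g) $$ (q, j))"
    using h i p by (intro sum.cong refl) (simp add: \<rho> index_mult_mat_sum[of _ d d _ d] del: index_mult_mat)
  \<comment> \<open>\<open>g\<close> now stands for the former \<open>h \<otimes> g\<close>; this moves \<open>h\<close> from \<open>\<rho>\<close> to \<open>\<sigma>\<close>.\<close>
  also have "\<dots> = (\<Sum>g\<in>carrier G. \<rho> g $$ (i, p) * \<sigma> (inv\<^bsub>G\<^esub> g \<otimes>\<^bsub>G\<^esub> h) $$ (q, j))"
    by (rule sum.reindex_bij_witness[where i = "\<lambda>g. inv\<^bsub>G\<^esub> h \<otimes>\<^bsub>G\<^esub> g" and j = "\<lambda>g. h \<otimes>\<^bsub>G\<^esub> g"])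
      (use h in \<open>simp_all add: m_assoc[symmetric] inv_mult_group\<close>, simp add: m_assoc)
  also have "\<dots> = (\<Sum>g\<in>carrier G. \<rho> g $$ (i, p) * (\<Sum>l<k. \<sigma> (inv\<^bsub>G\<^esub> g) $$ (q, l) * \<sigma> h $$ (l, j)))"
    using h j q by (intro sum.cong refl) (simp add: \<sigma> index_mult_mat_sum[of _ k k _ k] del: index_mult_mat)
  also have "\<dots> = (\<Sum>l<k. (\<Sum>g\<in>carrier G. \<rho> g $$ (i, p) * \<sigma> (inv\<^bsub>G\<^esub> g) $$ (q, l)) * \<sigma> h $$ (l, j))"
    by (simp add: sum_distrib_left sum_distrib_right mult.assoc) (rule sum.swap)
  also have "\<dots> = (X * \<sigma> h) $$ (i, j)"
    using index_mult_mat_sum[OF X \<sigma>(1)[OF h] i j] i by (simp add: X_def)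
  finally show "(\<rho> h * X) $$ (i, j) = (X * \<sigma> h) $$ (i, j)" .
qed (use is_irr_repD(3)[OF irr(1) h] is_irr_repD(3)[OF irr(2) h] in \<open>auto simp: X_def\<close>)

text \<open>
  If an averaged elementary matrix were nonzero it would be invertible, and \<open>\<rho>\<close> and \<open>\<sigma>\<close> would have the same
  character. So all of them vanish, and the sum in question is made of their entries at \<open>(p, q)\<close>.
\<close>

lemma irr_char_orthogonal:
  assumes grp: "group G" and irr: "is_irr_rep G d \<rho>" "is_irr_rep G k \<sigma>"
    and ne: "\<exists>g\<in>carrier G. mtrace (\<rho> g) \<noteq> mtrace (\<sigma> g)"
  shows "(\<Sum>g\<in>carrier G. mtrace (\<rho> g) * mtrace (\<sigma> (inv\<^bsub>G\<^esub> g))) = 0"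
proof -
  interpret group G by fact
  note \<rho> = is_irr_repD(3)[OF irr(1)] and \<sigma> = is_irr_repD(3)[OF irr(2)]
  have zero: "(\<Sum>g\<in>carrier G. \<rho> g $$ (p, p) * \<sigma> (inv\<^bsub>G\<^esub> g) $$ (q, q)) = 0" if pq: "p < d" "q < k" for p q
  proof -
    define X where "X = mat d k (\<lambda>(i, j). \<Sum>g\<in>carrier G. \<rho> g $$ (i, p) * \<sigma> (inv\<^bsub>G\<^esub> g) $$ (q, j))"
    have X: "X \<in> carrier_mat d k" by (simp add: X_def)
    have comm: "\<rho> h * X = X * \<sigma> h" if "h \<in> carrier G" for h
      unfolding X_def by (rule averaged_intertwines[OF grp irr pq that])
    have "X = 0\<^sub>m d k"
    proof (rule ccontr)
      assume "X \<noteq> 0\<^sub>m d k"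
      then obtain Z where Z: "Z \<in> carrier_mat k d" "X * Z = 1\<^sub>m d" "Z * X = 1\<^sub>m k"
        using intertwiner_invertible[OF irr X _ comm] by blast
      have "mtrace (\<rho> g) = mtrace (\<sigma> g)" if g: "g \<in> carrier G" for g
      proof -
        have "\<rho> g = \<rho> g * (X * Z)" using \<rho>[OF g] Z by simp
        also have "\<dots> = X * \<sigma> g * Z"
          using assoc_mult_mat[OF \<rho>[OF g] X Z(1)] comm[OF g] by (simp del: assoc_mult_mat)
        finally have "mtrace (\<rho> g) = mtrace (Z * (X * \<sigma> g))"
          using mtrace_mult_commute[of "X * \<sigma> g" d k Z] X Z \<sigma>[OF g] by simp
        also have "Z * (X * \<sigma> g) = \<sigma> g"
          using assoc_mult_mat[OF Z(1) X \<sigma>[OF g]] Z \<sigma>[OF g] by (simp del: assoc_mult_mat)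
        finally show ?thesis .
      qed
      with ne show False by blast
    qed
    then have "X $$ (p, q) = 0" using pq by simp
    then show ?thesis using pq by (simp add: X_def)
  qed
  have "(\<Sum>g\<in>carrier G. mtrace (\<rho> g) * mtrace (\<sigma> (inv\<^bsub>G\<^esub> g)))
      = (\<Sum>g\<in>carrier G. \<Sum>p<d. \<Sum>q<k. \<rho> g $$ (p, p) * \<sigma> (inv\<^bsub>G\<^esub> g) $$ (q, q))"
    by (intro sum.cong refl) (simp add: mtrace_sum[OF \<rho>] mtrace_sum[OF \<sigma>] sum_product)
  also have "\<dots> = (\<Sum>p<d. \<Sum>q<k. \<Sum>g\<in>carrier G. \<rho> g $$ (p, p) * \<sigma> (inv\<^bsub>G\<^esub> g) $$ (q, q))"
    by (subst sum.swap) (intro sum.cong refl, rule sum.swap)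
  also have "\<dots> = 0" by (simp add: zero)
  finally show ?thesis .
qed

text \<open>
  Here the averaged elementary matrices are scalars \<open>c\<close>, which their trace \<open>d * c\<close> determines.
\<close>

lemma irr_char_norm:
  assumes grp: "group G" and irr: "is_irr_rep G d \<rho>"
  shows "(\<Sum>g\<in>carrier G. mtrace (\<rho> g) * mtrace (\<rho> (inv\<^bsub>G\<^esub> g))) = of_nat (card (carrier G))"
proof -
  interpret group G by fact
  note \<rho> = is_irr_repD(3)[OF irr] and mult = is_irr_repD(4)[OF irr]
  have d: "d > 0" by (rule is_irr_repD(1)[OF irr])
  have entry: "(\<Sum>g\<in>carrier G. \<rho> g $$ (p, p) * \<rho> (inv\<^bsub>G\<^esub> g) $$ (q, q))
      = (if p = q then of_nat (card (carrier G)) / of_nat d else 0)" if pq: "p < d" "q < d" for p q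
  proof -
    define X where "X = mat d d (\<lambda>(i, j). \<Sum>g\<in>carrier G. \<rho> g $$ (i, p) * \<rho> (inv\<^bsub>G\<^esub> g) $$ (q, j))"
    have X: "X \<in> carrier_mat d d" by (simp add: X_def)
    have comm: "\<rho> h * X = X * \<rho> h" if "h \<in> carrier G" for h
      unfolding X_def by (rule averaged_intertwines[OF grp irr irr pq that])
    obtain c where c: "X = c \<cdot>\<^sub>m 1\<^sub>m d"
      using self_intertwiner_scalar[OF irr X comm] by blast
    \<comment> \<open>The trace of \<open>X\<close>, computed in two ways: the diagonal entries sum to the entry of \<open>\<rho> (inv g) * \<rho> g = 1\<close> at \<open>(q, p)\<close>, for each \<open>g\<close>.\<close>
    have "of_nat d * c = (\<Sum>i<d. X $$ (i, i))" by (simp add: c)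
    also have "\<dots> = (\<Sum>i<d. \<Sum>g\<in>carrier G. \<rho> (inv\<^bsub>G\<^esub> g) $$ (q, i) * \<rho> g $$ (i, p))"
      by (intro sum.cong refl) (simp add: X_def mult.commute)
    also have "\<dots> = (\<Sum>g\<in>carrier G. (\<rho> (inv\<^bsub>G\<^esub> g) * \<rho> g) $$ (q, p))"
      by (subst sum.swap, intro sum.cong refl)
        (simp add: index_mult_mat_sum[OF \<rho> \<rho> pq(2,1)] del: index_mult_mat)
    also have "\<dots> = (\<Sum>g\<in>carrier G. if p = q then 1 else 0)"
      using pq by (intro sum.cong refl) (auto simp: mult[symmetric] is_irr_repD(2)[OF irr])
    finally have "c = (if p = q then of_nat (card (carrier G)) / of_nat d else 0)"
      using d by (auto simp: field_simps)
    moreover have "X $$ (p, q) = (if p = q then c else 0)" using pq by (simp add: c)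
    ultimately show ?thesis using pq by (auto simp: X_def)
  qed
  have "(\<Sum>g\<in>carrier G. mtrace (\<rho> g) * mtrace (\<rho> (inv\<^bsub>G\<^esub> g)))
      = (\<Sum>g\<in>carrier G. \<Sum>p<d. \<Sum>q<d. \<rho> g $$ (p, p) * \<rho> (inv\<^bsub>G\<^esub> g) $$ (q, q))"
    by (intro sum.cong refl) (simp add: mtrace_sum[OF \<rho>] sum_product)
  also have "\<dots> = (\<Sum>p<d. \<Sum>q<d. \<Sum>g\<in>carrier G. \<rho> g $$ (p, p) * \<rho> (inv\<^bsub>G\<^esub> g) $$ (q, q))"
    by (subst sum.swap) (intro sum.cong refl, rule sum.swap)
  also have "\<dots> = of_nat (card (carrier G))" using d by (simp add: entry)
  finally show ?thesis .
qed

text \<open>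
  Pairing a linear relation with \<open>\<psi>\<close> isolates the coefficient of \<open>\<psi>\<close>, by orthogonality.
\<close>

lemma irr_chars_linearly_independent:
  assumes grp: "group G" and fin: "finite (carrier G)" and F: "finite F" "F \<subseteq> irr_chars G"
    and zero: "\<And>g. g \<in> carrier G \<Longrightarrow> (\<Sum>\<phi>\<in>F. a \<phi> * \<phi> g) = 0"
    and \<psi>: "\<psi> \<in> F"
  shows "a \<psi> = 0"
proof -
  interpret group G by fact
  define ip where "ip \<phi> = (\<Sum>g\<in>carrier G. \<phi> g * \<psi> (inv\<^bsub>G\<^esub> g))" for \<phi>
  obtain d \<rho> where \<rho>: "is_irr_rep G d \<rho>" "\<psi> = rep_char G \<rho>"
    using \<psi> F by (auto simp: irr_chars_def)
  have self: "ip \<psi> = of_nat (card (carrier G))"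
    unfolding ip_def using irr_char_norm[OF grp \<rho>(1)] by (simp add: \<rho>(2) rep_char_def)
  have other: "ip \<phi> = 0" if \<phi>: "\<phi> \<in> F" "\<phi> \<noteq> \<psi>" for \<phi>
  proof -
    obtain k \<sigma> where \<sigma>: "is_irr_rep G k \<sigma>" "\<phi> = rep_char G \<sigma>"
      using \<phi> F by (auto simp: irr_chars_def)
    have "\<exists>g\<in>carrier G. mtrace (\<sigma> g) \<noteq> mtrace (\<rho> g)"
      using \<phi>(2) by (force simp: \<sigma>(2) \<rho>(2) rep_char_def)
    from irr_char_orthogonal[OF grp \<sigma>(1) \<rho>(1) this] show ?thesis
      by (simp add: ip_def \<sigma>(2) \<rho>(2) rep_char_def)
  qed
  have "0 = (\<Sum>g\<in>carrier G. (\<Sum>\<phi>\<in>F. a \<phi> * \<phi> g) * \<psi> (inv\<^bsub>G\<^esub> g))"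
    by (simp add: zero)
  also have "\<dots> = (\<Sum>\<phi>\<in>F. a \<phi> * ip \<phi>)"
    by (simp add: ip_def sum_distrib_left sum_distrib_right mult.assoc) (rule sum.swap)
  also have "\<dots> = a \<psi> * ip \<psi>"
    using F(1) \<psi> by (subst sum.remove[OF F(1) \<psi>]) (simp add: other)
  finally show ?thesis
    using self fin one_closed by auto
qed

section \<open>Partial injections and admissible sets\<close>

lemma bar_in_ground: "i \<in> ground n \<Longrightarrow> bar n i \<in> ground n"
  and bar_bar: "i \<in> ground n \<Longrightarrow> bar n (bar n i) = i"
  and bar_neq: "bar n i \<noteq> i"
  by (auto simp: ground_def bar_def) presburger

text \<open>
  The admissible sets other than \<open>ground n\<close>, as soon as \<open>n \<ge> 1\<close>; leaving out \<open>ground n\<close> makes the family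
  closed under subsets.
\<close>

definition proper_admissible :: "nat \<Rightarrow> nat set \<Rightarrow> bool" where
  "proper_admissible n K \<longleftrightarrow> K \<subseteq> ground n \<and> (\<forall>i\<in>K. bar n i \<notin> K)"

lemma finite_ground [simp]: "finite (ground n)"
  and card_ground: "card (ground n) = 2 * n"
  by (simp_all add: ground_def)

lemma proper_admissible_iff:
  assumes "n \<ge> 1"
  shows "proper_admissible n K \<longleftrightarrow> admissible n K \<and> K \<noteq> ground n"
proof -
  have "1 \<in> ground n" using assms by (simp add: ground_def)
  then show ?thesis
    using bar_in_ground[of 1 n] by (auto simp: proper_admissible_def admissible_def)
qed

lemma proper_admissible_subset:
  "proper_admissible n K \<Longrightarrow> L \<subseteq> K \<Longrightarrow> proper_admissible n L"
  by (auto simp: proper_admissible_def)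

lemma proper_admissible_initial: "t \<le> n \<Longrightarrow> proper_admissible n {1..t}"
  by (auto simp: proper_admissible_def ground_def bar_def)

lemma proper_admissible_finite: "proper_admissible n K \<Longrightarrow> finite K"
  using finite_subset[OF _ finite_ground] by (auto simp: proper_admissible_def)

lemma finite_proper_admissible: "finite {K. proper_admissible n K}"
  by (rule finite_subset[of _ "Pow (ground n)"]) (auto simp: proper_admissible_def)

lemma RSp_simps [simp]:
  "f \<in> carrier (RSp n) \<longleftrightarrow> symplectic_inj n f" "f \<otimes>\<^bsub>RSp n\<^esub> g = f \<circ>\<^sub>m g" "\<one>\<^bsub>RSp n\<^esub> = partial_id (ground n)"
  by (simp_all add: RSp_def)

lemma dom_partial_id [simp]: "dom (partial_id K) = K"
  and ran_partial_id [simp]: "ran (partial_id K) = K"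
  by (auto simp: partial_id_def dom_def ran_def split: if_splits)

lemma comp_partial_id: "g \<circ>\<^sub>m partial_id K = g |` K"
  by (auto simp: partial_id_def map_comp_def restrict_map_def fun_eq_iff)

lemma partial_id_comp: "ran g \<subseteq> K \<Longrightarrow> partial_id K \<circ>\<^sub>m g = g"
  by (auto simp: partial_id_def map_comp_def fun_eq_iff ran_def split: option.splits)

lemma restrict_dom_subset: "dom g \<subseteq> K \<Longrightarrow> g |` K = g"
  by (auto simp: restrict_map_def fun_eq_iff) (metis domIff subsetD)

lemma restrict_partial_id: "partial_id K |` L = partial_id (K \<inter> L)"
  by (auto simp: partial_id_def restrict_map_def fun_eq_iff)

lemma ran_restrict: "ran (g |` K) = map_image g K"
  by (auto simp: ran_def map_image_def restrict_map_def split: if_splits)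

lemma inj_on_partial_id: "inj_on (partial_id K) K"
  by (auto simp: inj_on_def partial_id_def)

lemma symplectic_injI:
  assumes "n \<ge> 1" "proper_admissible n (dom f)" "proper_admissible n (ran f)" "inj_on f (dom f)"
  shows "symplectic_inj n f"
  using assms unfolding symplectic_inj_def bij_between_def proper_admissible_iff[OF assms(1)] by blast

lemma card_map_image:
  assumes "inj_on g (dom g)" "K \<subseteq> dom g"
  shows "card (map_image g K) = card K"
proof -
  have "map_image g K = (\<lambda>x. the (g x)) ` K"
    using assms(2) by (force simp: map_image_def dom_def)
  moreover have "inj_on (\<lambda>x. the (g x)) K"
  proof (rule inj_onI)
    fix x y assume xy: "x \<in> K" "y \<in> K" "the (g x) = the (g y)"
    then have "g x = g y" using assms(2) by (metis domD option.sel subsetD)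
    then show "x = y" using assms xy by (auto dest: inj_onD)
  qed
  ultimately show ?thesis by (simp add: card_image)
qed

text \<open>
  The image of a proper admissible set is proper admissible also under a symplectic bijection: it is
  admissible, and too small to be all of \<open>ground n\<close>.
\<close>

lemma symplectic_injD:
  assumes n: "n \<ge> 1" and g: "symplectic_inj n g"
  shows "dom g \<subseteq> ground n" "inj_on g (dom g)"
    "\<And>K. K \<subseteq> dom g \<Longrightarrow> proper_admissible n K \<Longrightarrow> proper_admissible n (map_image g K)"
proof -
  show "dom g \<subseteq> ground n" "inj_on g (dom g)"
    using g by (auto simp: symplectic_inj_def symplectic_bij_def bij_between_def admissible_def)
  then have inj: "inj_on g (dom g)" by simp
  fix K assume K: "K \<subseteq> dom g" "proper_admissible n K"
  from g consider "symplectic_bij n g" | "admissible n (ran g)" "ran g \<noteq> ground n"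
    by (auto simp: symplectic_inj_def bij_between_def)
  then show "proper_admissible n (map_image g K)"
  proof cases
    case 1
    have "K \<subset> ground n" using K n by (auto simp: proper_admissible_iff admissible_def)
    then have "card K < card (ground n)" by (intro psubset_card_mono) simp_all
    then have "map_image g K \<noteq> ground n" using card_map_image[OF inj K(1)] by auto
    then show ?thesis
      using 1 K n by (auto simp: proper_admissible_iff symplectic_bij_def)
  next
    case 2
    then have "proper_admissible n (ran g)" using n by (simp add: proper_admissible_iff)
    then show ?thesis
      by (rule proper_admissible_subset) (auto simp: map_image_def ran_def)
  qed
qed

lemma symplectic_inj_restrict:
  assumes n: "n \<ge> 1" and g: "symplectic_inj n g" and K: "proper_admissible n K"
  shows "symplectic_inj n (g |` K)"
proof (rule symplectic_injI[OF n])
  note gD = symplectic_injD[OF n g]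
  have K': "proper_admissible n (dom g \<inter> K)" by (rule proper_admissible_subset[OF K]) simp
  show "proper_admissible n (dom (g |` K))" using K' by simp
  have "map_image g K = map_image g (dom g \<inter> K)" by (auto simp: map_image_def)
  then show "proper_admissible n (ran (g |` K))" using gD(3)[OF _ K'] by (simp add: ran_restrict)
  show "inj_on (g |` K) (dom (g |` K))"
    using gD(2) by (auto simp: inj_on_def restrict_map_def dom_def)
qed

lemma symplectic_inj_partial_id:
  "n \<ge> 1 \<Longrightarrow> proper_admissible n K \<Longrightarrow> symplectic_inj n (partial_id K)"
  by (rule symplectic_injI) (simp_all add: inj_on_partial_id)

definition map_on :: "('a \<Rightarrow> 'b) \<Rightarrow> 'a set \<Rightarrow> ('a \<rightharpoonup> 'b)" where
  "map_on h X = (\<lambda>x. if x \<in> X then Some (h x) else None)"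

lemma dom_map_on [simp]: "dom (map_on h X) = X"
  and ran_map_on [simp]: "ran (map_on h X) = h ` X"
  by (auto simp: map_on_def dom_def ran_def split: if_splits)

lemma inj_on_map_on [simp]: "inj_on (map_on h X) X \<longleftrightarrow> inj_on h X"
  by (auto simp: map_on_def inj_on_def)

lemma map_on_comp: "k ` X \<subseteq> Y \<Longrightarrow> map_on h Y \<circ>\<^sub>m map_on k X = map_on (\<lambda>x. h (k x)) X"
  by (auto simp: map_on_def map_comp_def fun_eq_iff)

lemma map_on_cong: "(\<And>x. x \<in> X \<Longrightarrow> h x = h' x) \<Longrightarrow> map_on h X = map_on h' X"
  by (auto simp: map_on_def)

lemma map_on_the: "dom g = X \<Longrightarrow> map_on (\<lambda>x. the (g x)) X = g"
  by (auto simp: map_on_def fun_eq_iff domIff)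

lemma partial_id_eq_map_on: "partial_id X = map_on (\<lambda>x. x) X"
  by (simp add: partial_id_def map_on_def)

lemma bij_between_map_on: "bij_between X Y (map_on h X) \<longleftrightarrow> bij_betw h X Y"
  by (auto simp: bij_between_def bij_betw_def)

lemma bij_betwD_the:
  assumes "bij_between X Y f"
  shows "bij_betw (\<lambda>x. the (f x)) X Y"
proof -
  have "map_on (\<lambda>x. the (f x)) X = f" using assms by (intro map_on_the) (simp add: bij_between_def)
  then show ?thesis using assms by (metis bij_between_map_on)
qed

lemma We_symplectic_inj:
  assumes "n \<ge> 1" "t \<le> n" "w \<in> carrier (We t)"
  shows "symplectic_inj n w"
  using proper_admissible_initial[OF assms(2)] assms(3)
  by (auto simp: We_def bij_between_def intro!: symplectic_injI[OF assms(1)])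

section \<open>Traces in a representation with given apex\<close>

text \<open>
  If \<open>J\<close> has as columns a basis of \<open>eV\<close>, then \<open>\<rho> e = J L\<close> for some \<open>L\<close> with \<open>L J = 1\<close>. Moving \<open>J\<close> around
  the trace of \<open>\<rho> w = \<rho> w J L = J \<sigma>(w) L\<close> leaves the trace of \<open>\<sigma>(w)\<close>, where \<open>\<sigma>\<close> is the action on \<open>eV\<close>.
\<close>

lemma trace_eq_image_char:
  assumes act: "acts_on_image_with_char H d \<rho> e \<phi>" and w: "w \<in> carrier H"
    and e: "\<rho> e \<in> carrier_mat d d" "\<rho> e * \<rho> e = \<rho> e"
    and we: "\<rho> w \<in> carrier_mat d d" "\<rho> w * \<rho> e = \<rho> w"
  shows "mtrace (\<rho> w) = \<phi> w"
proof -
  obtain k J \<sigma> where J: "J \<in> carrier_mat d k" and inj: "inj_on (\<lambda>v. J *\<^sub>v v) (carrier_vec k)"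
    and im: "(\<lambda>v. J *\<^sub>v v) ` carrier_vec k = (\<lambda>v. \<rho> e *\<^sub>v v) ` carrier_vec d"
    and \<sigma>: "is_rep H k \<sigma>" and act': "\<rho> w * J = J * \<sigma> w" "mtrace (\<sigma> w) = \<phi> w"
    using act w unfolding acts_on_image_with_char_def by blast
  have \<sigma>w: "\<sigma> w \<in> carrier_mat k k" using \<sigma> w by (simp add: is_rep_def)
  obtain L where L: "L \<in> carrier_mat k d" "J * L = \<rho> e"
    using factor_through_image[OF J e(1)] im by blast
  have "\<rho> e * J = J"
  proof (rule mat_eqI_mult_vec)
    fix v :: "complex vec" assume v: "v \<in> carrier_vec k"
    then have "J *\<^sub>v v \<in> (\<lambda>v. \<rho> e *\<^sub>v v) ` carrier_vec d" using im by blast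
    then obtain u where u: "u \<in> carrier_vec d" "J *\<^sub>v v = \<rho> e *\<^sub>v u" by blast
    have "(\<rho> e * J) *\<^sub>v v = \<rho> e *\<^sub>v (\<rho> e *\<^sub>v u)"
      using assoc_mult_mat_vec[OF e(1) J v] u(2) by simp
    also have "\<dots> = J *\<^sub>v v"
      using assoc_mult_mat_vec[OF e(1) e(1) u(1)] e(2) u(2) by simp
    finally show "(\<rho> e * J) *\<^sub>v v = J *\<^sub>v v" .
  qed (use e(1) J in auto)
  then have "J * (L * J) = J * 1\<^sub>m k"
    using assoc_mult_mat[OF J L(1) J] L(2) J by (simp del: assoc_mult_mat)
  then have LJ: "L * J = 1\<^sub>m k"
    by (rule inj_mult_mat_cancel[OF J inj mult_carrier_mat[OF L(1) J] one_carrier_mat])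
  have "\<rho> w = \<rho> w * J * L"
    using assoc_mult_mat[OF we(1) J L(1)] L(2) we(2) by (simp del: assoc_mult_mat)
  also have "\<dots> = J * (\<sigma> w * L)"
    using assoc_mult_mat[OF J \<sigma>w L(1)] act'(1) by simp
  finally have "mtrace (\<rho> w) = mtrace (\<sigma> w * L * J)"
    using mtrace_mult_commute[OF J mult_carrier_mat[OF \<sigma>w L(1)]] by simp
  also have "\<sigma> w * L * J = \<sigma> w"
    using assoc_mult_mat[OF \<sigma>w L(1) J] LJ \<sigma>w by simp
  finally show ?thesis using act'(2) by simp
qed

text \<open>
  The common situation of the columns with apex \<open>idem_e t\<close>; that \<open>idem_e t\<close> is the least idempotent of the
  cross section with nonzero action enters through \<open>below\<close>.
\<close>

locale apex_rep =
  fixes n t d :: nat and \<rho> :: "(nat \<rightharpoonup> nat) \<Rightarrow> complex mat"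
  assumes n: "n \<ge> 1" and t: "t \<le> n"
    and irr: "is_irr_rep (RSp n) d \<rho>"
    and apex: "\<rho> (idem_e t) \<noteq> 0\<^sub>m d d"
    and below: "\<And>s. s < t \<Longrightarrow> \<rho> (idem_e s) = 0\<^sub>m d d"
begin

lemma rep_carrier [simp]: "symplectic_inj n g \<Longrightarrow> \<rho> g \<in> carrier_mat d d"
  using is_irr_repD(3)[OF irr] by simp

lemma rep_comp:
  "symplectic_inj n g \<Longrightarrow> symplectic_inj n h \<Longrightarrow> \<rho> (g \<circ>\<^sub>m h) = \<rho> g * \<rho> h"
  using is_irr_repD(4)[OF irr] by simp

text \<open>
  With \<open>s = card (dom x)\<close> and a bijection \<open>b\<close> from \<open>{1..s}\<close> to \<open>dom x\<close>, the map \<open>x\<close> is the composition of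
  \<open>b\<inverse>\<close>, \<open>idem_e s\<close> and \<open>x b\<close>, and the middle factor acts as \<open>0\<close>.
\<close>

lemma rep_small_rank:
  assumes x: "symplectic_inj n x" and adm: "proper_admissible n (dom x)" and small: "card (dom x) < t"
  shows "\<rho> x = 0\<^sub>m d d"
proof -
  define s where "s = card (dom x)"
  have "s \<le> n" using small t by (simp add: s_def)
  have ran: "proper_admissible n (ran x)"
    using symplectic_injD(3)[OF n x _ adm] ran_restrict[of x "dom x"] by (simp add: restrict_dom_subset)
  obtain b where b: "bij_betw b {1..s} (dom x)"
    using ex_bij_betw_nat_finite_1[OF proper_admissible_finite[OF adm]] by (auto simp: s_def)
  define c where "c = inv_into {1..s} b"
  have c: "bij_betw c (dom x) {1..s}" using bij_betw_inv_into[OF b] by (simp add: c_def)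
  define y where "y = map_on (\<lambda>i. the (x (b i))) {1..s}"
  define z where "z = map_on c (dom x)"
  have the_x: "bij_betw (\<lambda>i. the (x i)) (dom x) (ran x)"
    using symplectic_injD(2)[OF n x] by (intro bij_betwD_the) (simp add: bij_between_def)
  have xb: "bij_betw (\<lambda>i. the (x (b i))) {1..s} (ran x)"
    using bij_betw_trans[OF b the_x] by (simp add: o_def)
  have y: "symplectic_inj n y"
    using xb ran proper_admissible_initial[OF \<open>s \<le> n\<close>]
    by (intro symplectic_injI[OF n]) (auto simp: y_def bij_betw_def)
  have z: "symplectic_inj n z"
    using c adm proper_admissible_initial[OF \<open>s \<le> n\<close>]
    by (intro symplectic_injI[OF n]) (auto simp: z_def bij_betw_def)
  have e: "symplectic_inj n (idem_e s)"
    unfolding idem_e_def by (rule symplectic_inj_partial_id[OF n proper_admissible_initial[OF \<open>s \<le> n\<close>]])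
  have ez: "idem_e s \<circ>\<^sub>m z = z"
    using c by (auto simp: idem_e_def z_def bij_betw_def intro: partial_id_comp)
  have "y \<circ>\<^sub>m z = map_on (\<lambda>i. the (x (b (c i)))) (dom x)"
    unfolding y_def z_def using c by (intro map_on_comp) (auto simp: bij_betw_def)
  also have "\<dots> = map_on (\<lambda>i. the (x i)) (dom x)"
    using b by (intro map_on_cong) (simp add: c_def bij_betw_inv_into_right)
  also have "\<dots> = x" by (rule map_on_the) simp
  finally have "\<rho> x = \<rho> y * \<rho> (idem_e s \<circ>\<^sub>m z)" using y z by (simp add: ez flip: rep_comp)
  also have "\<dots> = \<rho> y * (0\<^sub>m d d * \<rho> z)"
    using below[of s] small e z by (simp add: rep_comp s_def)
  also have "\<dots> = 0\<^sub>m d d" 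
    by (simp add: left_mult_zero_mat[OF rep_carrier[OF z]] right_mult_zero_mat[OF rep_carrier[OF y]])
  finally show ?thesis .
qed

definition rank_sets :: "nat set set" where
  "rank_sets = {K. proper_admissible n K \<and> card K = t}"

lemma finite_rank_sets: "finite rank_sets"
  by (rule finite_subset[OF _ finite_proper_admissible[of n]]) (auto simp: rank_sets_def)

lemma symplectic_inj_partial_id_rank [simp]: "K \<in> rank_sets \<Longrightarrow> symplectic_inj n (partial_id K)"
  by (simp add: rank_sets_def symplectic_inj_partial_id[OF n])

lemma symplectic_inj_restrict_rank [simp]: "symplectic_inj n g \<Longrightarrow> K \<in> rank_sets \<Longrightarrow> symplectic_inj n (g |` K)"
  by (simp add: rank_sets_def symplectic_inj_restrict[OF n])

text \<open>
  The product of two partial identities is the partial identity on the intersection, which has rank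
  below \<open>t\<close> if the sets differ.
\<close>

lemma rep_partial_id_mult:
  assumes "K \<in> rank_sets" "L \<in> rank_sets"
  shows "\<rho> (partial_id K) * \<rho> (partial_id L) = (if K = L then \<rho> (partial_id K) else 0\<^sub>m d d)"
proof -
  have "\<rho> (partial_id K) * \<rho> (partial_id L) = \<rho> (partial_id (K \<inter> L))"
    using assms by (simp add: comp_partial_id restrict_partial_id flip: rep_comp)
  moreover have "\<rho> (partial_id (K \<inter> L)) = 0\<^sub>m d d" if "K \<noteq> L"
  proof (rule rep_small_rank)
    have adm: "proper_admissible n (K \<inter> L)"
      using assms by (auto simp: rank_sets_def intro: proper_admissible_subset)
    then show "proper_admissible n (dom (partial_id (K \<inter> L)))" "symplectic_inj n (partial_id (K \<inter> L))"
      by (simp_all add: symplectic_inj_partial_id[OF n])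
    have fin: "finite K" "finite L" and card: "card K = t" "card L = t"
      using assms by (auto simp: rank_sets_def dest: proper_admissible_finite)
    have "K \<inter> L \<subset> K"
    proof
      show "K \<inter> L \<noteq> K"
        using card_subset_eq[OF fin(2), of K] card that by auto
    qed simp
    then show "card (dom (partial_id (K \<inter> L))) < t"
      using psubset_card_mono[OF fin(1)] card by simp
  qed
  ultimately show ?thesis by auto
qed

definition projection_sum :: "complex mat" where
  "projection_sum = mat_sum d (\<lambda>K. \<rho> (partial_id K)) rank_sets"

lemma projection_sum_carrier [simp]: "projection_sum \<in> carrier_mat d d"
  by (simp add: projection_sum_def)

lemma projection_sum_mult_partial_id: "K \<in> rank_sets \<Longrightarrow> projection_sum * \<rho> (partial_id K) = \<rho> (partial_id K)"
proof -
  assume K: "K \<in> rank_sets"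
  have "projection_sum * \<rho> (partial_id K) = mat_sum d (\<lambda>L. \<rho> (partial_id L) * \<rho> (partial_id K)) rank_sets"
    unfolding projection_sum_def using K by (intro mat_sum_mult) simp_all
  also have "\<dots> = \<rho> (partial_id K) * \<rho> (partial_id K)"
    using K by (intro mat_sum_single finite_rank_sets) (auto simp: rep_partial_id_mult)
  finally show ?thesis using K by (simp add: rep_partial_id_mult)
qed

lemma rep_mult_projection_sum: "symplectic_inj n g \<Longrightarrow> \<rho> g * projection_sum = mat_sum d (\<lambda>K. \<rho> (g |` K)) rank_sets"
proof -
  assume g: "symplectic_inj n g"
  have "\<rho> g * projection_sum = mat_sum d (\<lambda>K. \<rho> g * \<rho> (partial_id K)) rank_sets"
    unfolding projection_sum_def using g by (intro mult_mat_sum) simp_all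
  also have "\<dots> = mat_sum d (\<lambda>K. \<rho> (g |` K)) rank_sets"
    using g by (intro mat_sum_cong) (simp add: comp_partial_id flip: rep_comp)
  finally show ?thesis .
qed

lemma rep_restrict_zero:
  assumes g: "symplectic_inj n g" and K: "K \<in> rank_sets" and not: "\<not> K \<subseteq> dom g"
  shows "\<rho> (g |` K) = 0\<^sub>m d d"
proof (rule rep_small_rank)
  have adm: "proper_admissible n K" and card: "card K = t" using K by (auto simp: rank_sets_def)
  show "proper_admissible n (dom (g |` K))" by (rule proper_admissible_subset[OF adm]) simp
  have "dom (g |` K) \<subset> K" using not by auto
  then show "card (dom (g |` K)) < t"
    using psubset_card_mono[OF proper_admissible_finite[OF adm]] card by metis
qed (use g K in simp)

lemma map_image_rank_sets:
  assumes g: "symplectic_inj n g" and K: "K \<in> rank_sets" "K \<subseteq> dom g"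
  shows "map_image g K \<in> rank_sets"
  using symplectic_injD(3)[OF n g K(2)] card_map_image[OF symplectic_injD(2)[OF n g] K(2)] K(1)
  by (simp add: rank_sets_def)

lemma partial_id_image_restrict:
  "partial_id (map_image g K) \<circ>\<^sub>m (g |` K) = g |` K"
  by (rule partial_id_comp) (simp add: ran_restrict)

text \<open>
  A restriction of \<open>g\<close> to \<open>K\<close> either has rank below \<open>t\<close> or is fixed from the left by the partial identity
  on \<open>g K\<close>, which is one of the summands of \<open>projection_sum\<close>.
\<close>

lemma projection_sum_mult_restrict:
  assumes g: "symplectic_inj n g" and K: "K \<in> rank_sets"
  shows "projection_sum * \<rho> (g |` K) = \<rho> (g |` K)"
proof (cases "K \<subseteq> dom g")
  case True
  note L = map_image_rank_sets[OF g K True]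
  have eq: "\<rho> (g |` K) = \<rho> (partial_id (map_image g K)) * \<rho> (g |` K)"
    using g K L by (simp add: partial_id_image_restrict flip: rep_comp)
  have "projection_sum * \<rho> (g |` K) = (projection_sum * \<rho> (partial_id (map_image g K))) * \<rho> (g |` K)"
    using g K L by (subst eq) (simp add: assoc_mult_mat[of _ d d _ d _ d])
  then show ?thesis using projection_sum_mult_partial_id[OF L] eq by simp
next
  case False
  then show ?thesis by (simp add: rep_restrict_zero[OF g K] right_mult_zero_mat[OF projection_sum_carrier])
qed

text \<open>
  The fixed space of \<open>projection_sum\<close> is invariant under every \<open>\<rho> g\<close>, because \<open>\<rho> g * projection_sum\<close> is a sum
  of matrices \<open>\<rho> (g |` K)\<close>, each of which \<open>projection_sum\<close> fixes. It is not zero, since it contains the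
  image of \<open>\<rho> (idem_e t)\<close>.
\<close>

lemma projection_sum_eq_one: "projection_sum = 1\<^sub>m d"
proof -
  define U where "U = {v \<in> carrier_vec d. projection_sum *\<^sub>v v = v}"
  have te: "{1..t} \<in> rank_sets" using proper_admissible_initial[OF t] by (simp add: rank_sets_def)
  have Pg: "projection_sum * (\<rho> g * projection_sum) = \<rho> g * projection_sum" if g: "symplectic_inj n g" for g
  proof -
    have "projection_sum * (\<rho> g * projection_sum) = mat_sum d (\<lambda>K. projection_sum * \<rho> (g |` K)) rank_sets"
      unfolding rep_mult_projection_sum[OF g] using g by (intro mult_mat_sum) simp_all
    also have "\<dots> = \<rho> g * projection_sum"
      unfolding rep_mult_projection_sum[OF g] using g by (intro mat_sum_cong) (rule projection_sum_mult_restrict)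
    finally show ?thesis .
  qed
  have "U = {0\<^sub>v d} \<or> U = carrier_vec d"
  proof (rule irr_rep_invariant_subspace[OF irr])
    show "0\<^sub>v d \<in> U" using carrier_matD[OF projection_sum_carrier] by (auto simp: U_def intro!: eq_vecI)
    show "u + v \<in> U" if "u \<in> U" "v \<in> U" for u v
      using that mult_add_distrib_mat_vec[OF projection_sum_carrier, of u v] by (simp add: U_def)
    show "c \<cdot>\<^sub>v u \<in> U" if "u \<in> U" for c u
      using that mult_mat_vec[OF projection_sum_carrier, of u c] by (simp add: U_def)
    fix g u assume "g \<in> carrier (RSp n)" and "u \<in> U"
    then have g: "symplectic_inj n g" and u: "u \<in> carrier_vec d" "projection_sum *\<^sub>v u = u"
      by (simp_all add: U_def)
    have gu: "\<rho> g *\<^sub>v u = (\<rho> g * projection_sum) *\<^sub>v u"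
      using assoc_mult_mat_vec[OF rep_carrier[OF g] projection_sum_carrier u(1)] u(2) by simp
    have "projection_sum *\<^sub>v (\<rho> g *\<^sub>v u) = (projection_sum * (\<rho> g * projection_sum)) *\<^sub>v u"
      unfolding gu
      by (rule assoc_mult_mat_vec[OF projection_sum_carrier mult_carrier_mat[OF rep_carrier[OF g] projection_sum_carrier] u(1), symmetric])
    also have "\<dots> = \<rho> g *\<^sub>v u" unfolding Pg[OF g] gu ..
    finally show "\<rho> g *\<^sub>v u \<in> U" using rep_carrier[OF g] u by (simp add: U_def)
  qed (auto simp: U_def)
  moreover have "U \<noteq> {0\<^sub>v d}"
  proof
    assume U0: "U = {0\<^sub>v d}"
    have "\<rho> (idem_e t) = 0\<^sub>m d d"
    proof (rule mat_eqI_mult_vec)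
      show "\<rho> (idem_e t) \<in> carrier_mat d d" using te by (simp add: idem_e_def)
      fix v :: "complex vec" assume v: "v \<in> carrier_vec d"
      have e: "\<rho> (idem_e t) \<in> carrier_mat d d" using te by (simp add: idem_e_def)
      have "projection_sum *\<^sub>v (\<rho> (idem_e t) *\<^sub>v v) = \<rho> (idem_e t) *\<^sub>v v"
        using assoc_mult_mat_vec[OF projection_sum_carrier e v] projection_sum_mult_partial_id[OF te]
        by (simp add: idem_e_def del: assoc_mult_mat_vec)
      then have "\<rho> (idem_e t) *\<^sub>v v \<in> U" using e v by (simp add: U_def)
      then show "\<rho> (idem_e t) *\<^sub>v v = 0\<^sub>m d d *\<^sub>v v" using U0 v by auto
    qed auto
    with apex show False ..
  qed
  ultimately have U: "U = carrier_vec d" by blast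
  show ?thesis
  proof (rule mat_eqI_mult_vec[OF projection_sum_carrier])
    fix v :: "complex vec" assume "v \<in> carrier_vec d"
    then have "v \<in> U" "v \<in> carrier_vec d" using U by simp_all
    then show "projection_sum *\<^sub>v v = 1\<^sub>m d *\<^sub>v v" by (simp add: U_def)
  qed simp
qed

text \<open>
  The restriction absorbs the partial identities on \<open>K\<close> from the right and on \<open>g K\<close> from the left;
  under the trace they become adjacent, and their product is \<open>0\<close>.
\<close>

lemma trace_restrict_moved:
  assumes g: "symplectic_inj n g" and K: "K \<in> rank_sets" "K \<subseteq> dom g" "map_image g K \<noteq> K"
  shows "mtrace (\<rho> (g |` K)) = 0"
proof -
  note L = map_image_rank_sets[OF g K(1,2)]
  have "g |` K = partial_id (map_image g K) \<circ>\<^sub>m ((g |` K) \<circ>\<^sub>m partial_id K)"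
    by (simp add: comp_partial_id partial_id_image_restrict)
  then have "\<rho> (g |` K) = \<rho> (partial_id (map_image g K)) * \<rho> ((g |` K) \<circ>\<^sub>m partial_id K)"
    using g K L by (simp add: comp_partial_id flip: rep_comp)
  also have "\<rho> ((g |` K) \<circ>\<^sub>m partial_id K) = \<rho> (g |` K) * \<rho> (partial_id K)"
    using g K by (simp add: rep_comp)
  finally have "mtrace (\<rho> (g |` K))
      = mtrace (\<rho> (partial_id (map_image g K)) * (\<rho> (g |` K) * \<rho> (partial_id K)))"
    by (rule arg_cong)
  also have "\<dots> = mtrace (\<rho> (g |` K) * \<rho> (partial_id K) * \<rho> (partial_id (map_image g K)))"
    by (rule mtrace_mult_commute[OF rep_carrier mult_carrier_mat[OF rep_carrier rep_carrier]])
      (use g K L in simp_all)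
  also have "\<rho> (g |` K) * \<rho> (partial_id K) * \<rho> (partial_id (map_image g K)) = 0\<^sub>m d d"
    using g K L assoc_mult_mat[of "\<rho> (g |` K)" d d "\<rho> (partial_id K)" d "\<rho> (partial_id (map_image g K))" d]
    by (simp add: rep_partial_id_mult right_mult_zero_mat[of _ d d])
  finally show ?thesis by (simp add: mtrace_def)
qed

text \<open>
  Both \<open>h\<close> and its inverse are partial maps between proper admissible sets, hence lie in \<open>RSp n\<close>. The
  restriction of \<open>g\<close> is \<open>h w h\<inverse>\<close>, so the trace is that of \<open>w h\<inverse> h = w\<close>.
\<close>

lemma trace_restrict_fixed:
  assumes g: "symplectic_inj n g" and K: "K \<in> rank_sets" "K \<subseteq> dom g"
    and w: "w \<in> carrier (We t)" and h: "bij_betw h {1..t} K"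
    and conj: "\<And>i. i \<in> {1..t} \<Longrightarrow> the (g (h i)) = h (the (w i))"
  shows "mtrace (\<rho> (g |` K)) = mtrace (\<rho> w)"
proof -
  define a where "a = map_on h {1..t}"
  define c where "c = map_on (inv_into {1..t} h) K"
  have h': "bij_betw (inv_into {1..t} h) K {1..t}" by (rule bij_betw_inv_into[OF h])
  have adm: "proper_admissible n K" "proper_admissible n {1..t}"
    using K proper_admissible_initial[OF t] by (auto simp: rank_sets_def)
  have a: "symplectic_inj n a" and c: "symplectic_inj n c"
    using h h' adm by (auto simp: a_def c_def bij_betw_def intro!: symplectic_injI[OF n])
  have wb: "bij_betw (\<lambda>x. the (w x)) {1..t} {1..t}" and domw: "dom w = {1..t}"
    using w by (auto simp: We_def bij_between_def intro: bij_betwD_the)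
  define v where "v = (\<lambda>x. the (w x))"
  have w_eq: "w = map_on v {1..t}" using map_on_the[OF domw] by (simp add: v_def)
  have wc: "w \<circ>\<^sub>m c = map_on (\<lambda>x. v (inv_into {1..t} h x)) K"
    unfolding w_eq c_def using h' by (intro map_on_comp) (auto simp: bij_betw_def)
  have "a \<circ>\<^sub>m (w \<circ>\<^sub>m c) = map_on (\<lambda>x. h (v (inv_into {1..t} h x))) K"
    unfolding wc a_def using h' wb by (intro map_on_comp) (auto simp: bij_betw_def v_def)
  also have "\<dots> = map_on (\<lambda>x. the (g x)) K"
  proof (rule map_on_cong)
    fix x assume x: "x \<in> K"
    then have "inv_into {1..t} h x \<in> {1..t}" using h' by (auto simp: bij_betw_def)
    from conj[OF this] show "h (v (inv_into {1..t} h x)) = the (g x)"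
      using bij_betw_inv_into_right[OF h x] by (simp add: v_def)
  qed
  also have "\<dots> = g |` K" using K(2) by (auto simp: map_on_def restrict_map_def fun_eq_iff)
  finally have gK: "g |` K = a \<circ>\<^sub>m (w \<circ>\<^sub>m c)" ..
  have "c \<circ>\<^sub>m a = map_on (\<lambda>x. inv_into {1..t} h (h x)) {1..t}"
    unfolding c_def a_def using h by (intro map_on_comp) (auto simp: bij_betw_def)
  also have "\<dots> = map_on (\<lambda>x. x) {1..t}"
    using h by (intro map_on_cong) (simp add: bij_betw_inv_into_left)
  also have "\<dots> = partial_id {1..t}" by (simp add: partial_id_eq_map_on)
  finally have ca: "c \<circ>\<^sub>m a = partial_id {1..t}" .
  have wS: "symplectic_inj n w" by (rule We_symplectic_inj[OF n t w])
  have e: "symplectic_inj n (partial_id {1..t})" by (rule symplectic_inj_partial_id[OF n adm(2)])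
  have wcS: "symplectic_inj n (w \<circ>\<^sub>m c)"
  proof (rule symplectic_injI[OF n])
    have b: "bij_betw (\<lambda>x. v (inv_into {1..t} h x)) K {1..t}"
      using bij_betw_trans[OF h' wb] by (simp add: o_def v_def)
    show "proper_admissible n (dom (w \<circ>\<^sub>m c))" "proper_admissible n (ran (w \<circ>\<^sub>m c))"
      "inj_on (w \<circ>\<^sub>m c) (dom (w \<circ>\<^sub>m c))"
      unfolding wc using b adm by (auto simp: bij_betw_def)
  qed
  have "mtrace (\<rho> (g |` K)) = mtrace (\<rho> a * \<rho> (w \<circ>\<^sub>m c))"
    unfolding gK using a wcS by (simp add: rep_comp)
  also have "\<dots> = mtrace (\<rho> w * \<rho> c * \<rho> a)"
    using mtrace_mult_commute[OF rep_carrier[OF a] rep_carrier[OF wcS]] wS c by (simp add: rep_comp)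
  also have "\<rho> w * \<rho> c * \<rho> a = \<rho> w * \<rho> (c \<circ>\<^sub>m a)"
    using assoc_mult_mat[OF rep_carrier[OF wS] rep_carrier[OF c] rep_carrier[OF a]] a c by (simp add: rep_comp)
  also have "\<dots> = \<rho> (w \<circ>\<^sub>m partial_id {1..t})"
    unfolding ca using wS e by (simp add: rep_comp)
  also have "w \<circ>\<^sub>m partial_id {1..t} = w"
    by (simp add: comp_partial_id restrict_dom_subset domw)
  finally show ?thesis .
qed

text \<open>
  Inserting \<open>projection_sum = 1\<close> behind \<open>\<rho> g\<close> splits the trace over the sets of size \<open>t\<close>, of which only the
  invariant ones contribute.
\<close>

lemma trace_eq_sum:
  assumes g: "symplectic_inj n g" and act: "acts_on_image_with_char (We t) d \<rho> (idem_e t) \<phi>"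
    and conj: "\<And>K. \<lbrakk>proper_admissible n K; card K = t; K \<subseteq> dom g; map_image g K = K\<rbrakk> \<Longrightarrow>
      w K \<in> carrier (We t) \<and> (\<exists>h. bij_betw h {1..t} K \<and> (\<forall>i\<in>{1..t}. the (g (h i)) = h (the (w K i))))"
  shows "mtrace (\<rho> g)
    = (\<Sum>K | proper_admissible n K \<and> card K = t \<and> K \<subseteq> dom g \<and> map_image g K = K. \<phi> (w K))"
    (is "_ = sum _ ?F")
proof -
  have te: "{1..t} \<in> rank_sets" using proper_admissible_initial[OF t] by (simp add: rank_sets_def)
  have char: "mtrace (\<rho> w) = \<phi> w" if w: "w \<in> carrier (We t)" for w
  proof (rule trace_eq_image_char[OF act w])
    have "w |` {1..t} = w" using w by (simp add: restrict_dom_subset We_def bij_between_def)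
    then show "\<rho> w * \<rho> (idem_e t) = \<rho> w"
      using te We_symplectic_inj[OF n t w] by (simp add: idem_e_def comp_partial_id flip: rep_comp)
    show "\<rho> (idem_e t) * \<rho> (idem_e t) = \<rho> (idem_e t)"
      using te by (simp add: idem_e_def rep_partial_id_mult)
  qed (use te We_symplectic_inj[OF n t w] in \<open>simp_all add: idem_e_def\<close>)
  have F: "?F \<subseteq> rank_sets" by (auto simp: rank_sets_def)
  have "mtrace (\<rho> g) = mtrace (\<rho> g * projection_sum)" by (simp add: projection_sum_eq_one right_mult_one_mat[OF rep_carrier[OF g]])
  also have "\<dots> = (\<Sum>K\<in>rank_sets. mtrace (\<rho> (g |` K)))"
    unfolding rep_mult_projection_sum[OF g] using g by (intro mtrace_mat_sum) simp
  also have "\<dots> = (\<Sum>K\<in>?F. mtrace (\<rho> (g |` K)))"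
  proof (rule sum.mono_neutral_right[OF finite_rank_sets F], rule ballI)
    fix K assume "K \<in> rank_sets - ?F"
    then have K: "K \<in> rank_sets" and "\<not> K \<subseteq> dom g \<or> K \<subseteq> dom g \<and> map_image g K \<noteq> K"
      by (auto simp: rank_sets_def)
    from this(2) show "mtrace (\<rho> (g |` K)) = 0"
    proof
      assume "\<not> K \<subseteq> dom g"
      then show ?thesis using rep_restrict_zero[OF g K] by (simp add: mtrace_def)
    qed (use trace_restrict_moved[OF g K] in blast)
  qed
  also have "\<dots> = (\<Sum>K\<in>?F. \<phi> (w K))"
  proof (rule sum.cong[OF refl])
    fix K assume K: "K \<in> ?F"
    then obtain h where "w K \<in> carrier (We t)" "bij_betw h {1..t} K"
      "\<forall>i\<in>{1..t}. the (g (h i)) = h (the (w K i))" using conj by blast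
    moreover have "K \<in> rank_sets" "K \<subseteq> dom g" using K F by auto
    ultimately show "mtrace (\<rho> (g |` K)) = \<phi> (w K)"
      using trace_restrict_fixed[OF g, of K "w K" h] char by auto
  qed
  finally show ?thesis .
qed

end

section \<open>Counting partial transversals\<close>

lemma part_binom_superset:
  assumes "finite I" "set_mset \<alpha> \<union> set_mset \<beta> \<subseteq> I"
  shows "part_binom \<alpha> \<beta> = (\<Prod>i\<in>I. count \<alpha> i choose count \<beta> i)"
  unfolding part_binom_def using assms
  by (intro prod.mono_neutral_left) (auto simp: not_in_iff)

lemma part_binom_empty: "part_binom {#} \<beta> = (if \<beta> = {#} then 1 else 0)"
proof (cases "\<beta> = {#}")
  case False
  then obtain i where "i \<in># \<beta>" by auto
  then have "(\<Prod>i\<in>set_mset \<beta>. 0 choose count \<beta> i) = (0::nat)"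
    by (intro prod_zero bexI[of _ i]) (auto simp: binomial_eq_0)
  then show ?thesis using False by (simp add: part_binom_def)
qed (simp add: part_binom_def)

text \<open>
  Pascal's rule in the factor belonging to \<open>a\<close>.
\<close>

lemma part_binom_add_mset:
  "part_binom (add_mset a \<alpha>) \<beta>
    = part_binom \<alpha> \<beta> + (if a \<in># \<beta> then part_binom \<alpha> (\<beta> - {#a#}) else 0)"
proof -
  define I where "I = insert a (set_mset \<alpha> \<union> set_mset \<beta>)"
  have I: "finite I" "a \<in> I" by (auto simp: I_def)
  have split: "part_binom \<gamma> \<delta> = (count \<gamma> a choose count \<delta> a) * (\<Prod>i\<in>I - {a}. count \<gamma> i choose count \<delta> i)"
    if "set_mset \<gamma> \<union> set_mset \<delta> \<subseteq> I" for \<gamma> \<delta>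
    unfolding part_binom_superset[OF I(1) that] by (rule prod.remove[OF I])
  define Q where "Q = (\<Prod>i\<in>I - {a}. count \<alpha> i choose count \<beta> i)"
  have 1: "part_binom (add_mset a \<alpha>) \<beta> = (Suc (count \<alpha> a) choose count \<beta> a) * Q"
    by (subst split) (auto simp: I_def Q_def intro!: prod.cong)
  have 2: "part_binom \<alpha> \<beta> = (count \<alpha> a choose count \<beta> a) * Q"
    by (subst split) (auto simp: I_def Q_def)
  have 3: "part_binom \<alpha> (\<beta> - {#a#}) = (count \<alpha> a choose (count \<beta> a - 1)) * Q"
    by (subst split) (auto simp: I_def Q_def intro!: prod.cong dest: in_diffD)
  show ?thesis
  proof (cases "count \<beta> a")
    case 0
    then have "a \<notin># \<beta>" by (simp add: not_in_iff)
    then show ?thesis unfolding 1 2 using 0 by simp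
  next
    case (Suc m)
    then have "a \<in># \<beta>" by (metis count_eq_zero_iff nat.distinct(1))
    then show ?thesis unfolding 1 2 3 using Suc by (simp add: algebra_simps)
  qed
qed

text \<open>
  A choice of at most one of the \<open>k\<close> options from each \<open>b \<in> B\<close>, where all options of \<open>b\<close> carry the label
  \<open>L b\<close>: the binomials choose the elements \<open>b\<close> that are used, label by label, and every used one leaves
  \<open>k\<close> possibilities. By induction on \<open>B\<close>: a new element \<open>x\<close> is either not used, or used with one of its
  options, which takes the label \<open>L x\<close> out of \<open>\<beta>\<close>; \<open>part_binom\<close> follows the same recursion.
\<close>

lemma card_partial_transversals:
  fixes opt :: "'b \<Rightarrow> 'c set" and l :: "'c \<Rightarrow> nat"
  assumes "finite B" and "\<And>b. b \<in> B \<Longrightarrow> finite (opt b) \<and> card (opt b) = k"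
    and "disjoint_family_on opt B" and "\<And>b c. b \<in> B \<Longrightarrow> c \<in> opt b \<Longrightarrow> l c = L b"
  shows "card {S. S \<subseteq> (\<Union>b\<in>B. opt b) \<and> (\<forall>b\<in>B. \<forall>c\<in>opt b. \<forall>c'\<in>opt b. c \<in> S \<longrightarrow> c' \<in> S \<longrightarrow> c = c')
      \<and> image_mset l (mset_set S) = \<beta>} = k ^ size \<beta> * part_binom (image_mset L (mset_set B)) \<beta>"
  using assms
proof (induction B arbitrary: \<beta> rule: finite_induct)
  case empty
  have "{S :: 'c set. S \<subseteq> (\<Union>b\<in>{}. opt b) \<and> (\<forall>b\<in>{}. \<forall>c\<in>opt b. \<forall>c'\<in>opt b. c \<in> S \<longrightarrow> c' \<in> S \<longrightarrow> c = c')
      \<and> image_mset l (mset_set S) = \<beta>} = (if \<beta> = {#} then {{}} else {})"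
    by auto
  then show ?case by (simp add: part_binom_empty)
next
  case (insert x B)
  define F where "F C \<beta> = {S. S \<subseteq> (\<Union>b\<in>C. opt b) \<and> (\<forall>b\<in>C. \<forall>c\<in>opt b. \<forall>c'\<in>opt b. c \<in> S \<longrightarrow> c' \<in> S \<longrightarrow> c = c')
      \<and> image_mset l (mset_set S) = \<beta>}" for C \<beta>
  have IH: "card (F B \<beta>) = k ^ size \<beta> * part_binom (image_mset L (mset_set B)) \<beta>" for \<beta>
    unfolding F_def using insert.prems by (intro insert.IH) (auto simp: disjoint_family_on_def)
  define Y where "Y = (\<Union>b\<in>B. opt b)"
  have finY: "finite Y" using insert by (auto simp: Y_def)
  have disj: "opt x \<inter> Y = {}"
    using insert.prems(2) insert.hyps(2) by (force simp: Y_def disjoint_family_on_def)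
  have finF: "finite (F B \<beta>)" for \<beta>
    by (rule finite_subset[of _ "Pow Y"]) (use finY in \<open>auto simp: F_def Y_def\<close>)
  have optx: "finite (opt x)" "card (opt x) = k" "\<And>c. c \<in> opt x \<Longrightarrow> l c = L x"
    using insert.prems by auto
  \<comment> \<open>The selections that use \<open>x\<close>: its option \<open>c\<close>, and a selection from \<open>B\<close> with the remaining labels.\<close>
  define G where "G = (if L x \<in># \<beta> then (\<lambda>(c, S). insert c S) ` (opt x \<times> F B (\<beta> - {#L x#})) else {})"
  have FY: "S \<subseteq> Y" "finite S" if "S \<in> F B \<beta>" for S \<beta>
    using that finite_subset[OF _ finY] by (auto simp: F_def Y_def)
  have eq: "F (insert x B) \<beta> = F B \<beta> \<union> G"
  proof (intro equalityI subsetI)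
    fix S assume S: "S \<in> F (insert x B) \<beta>"
    then have sub: "S \<subseteq> opt x \<union> Y" by (auto simp: F_def Y_def)
    then have finS: "finite S" using optx finY by (auto intro: finite_subset)
    show "S \<in> F B \<beta> \<union> G"
    proof (cases "S \<inter> opt x = {}")
      case True
      then have "S \<in> F B \<beta>" using S sub by (auto simp: F_def Y_def)
      then show ?thesis ..
    next
      case False
      then obtain c where c: "c \<in> S" "c \<in> opt x" by blast
      define S' where "S' = S - {c}"
      have S_eq: "S = insert c S'" "c \<notin> S'" "finite S'" using c finS by (auto simp: S'_def)
      have "image_mset l (mset_set S) = \<beta>" using S by (simp add: F_def)
      then have \<beta>: "\<beta> = add_mset (L x) (image_mset l (mset_set S'))"
        using S_eq optx(3)[OF c(2)] by simp
      have "S' \<subseteq> Y"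
        using S sub c by (auto simp: S'_def F_def)
      then have "S' \<in> F B (\<beta> - {#L x#})"
        using S unfolding F_def \<beta> Y_def by (auto simp: S'_def)
      then have "S \<in> G" using c S_eq \<beta> by (auto simp: G_def image_iff)
      then show ?thesis ..
    qed
  next
    fix S assume "S \<in> F B \<beta> \<union> G"
    then show "S \<in> F (insert x B) \<beta>"
    proof
      assume S: "S \<in> F B \<beta>"
      then have "S \<inter> opt x = {}" using FY[OF S] disj by auto
      then show ?thesis using S by (auto simp: F_def)
    next
      assume "S \<in> G"
      then obtain c S' where S: "S = insert c S'" "c \<in> opt x" "S' \<in> F B (\<beta> - {#L x#})" "L x \<in># \<beta>"
        by (auto simp: G_def split: if_splits)
      note S' = FY[OF S(3)]
      have c: "c \<notin> S'" "c \<notin> Y" using S(2) S'(1) disj by auto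
      have "image_mset l (mset_set S) = \<beta>"
        using S c S' optx(3)[OF S(2)] by (simp add: F_def)
      moreover have "d \<in> S \<longrightarrow> d' \<in> S \<longrightarrow> d = d'" if "b \<in> insert x B" "d \<in> opt b" "d' \<in> opt b" for b d d'
      proof (cases "b = x")
        case True
        then show ?thesis using that S(1) S'(1) disj by auto
      next
        case False
        then have "d \<in> Y" "d' \<in> Y" "b \<in> B" using that by (auto simp: Y_def)
        then have "d \<noteq> c" "d' \<noteq> c" using c by auto
        then show ?thesis using S \<open>b \<in> B\<close> that by (auto simp: F_def)
      qed
      moreover have "S \<subseteq> (\<Union>b\<in>insert x B. opt b)" using S S' by (auto simp: Y_def)
      ultimately show ?thesis unfolding F_def by blast
    qed
  qed
  have "F B \<beta> \<inter> G = {}"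
    using FY(1) disj by (fastforce simp: G_def split: if_splits)
  moreover have finG: "finite G" using finF optx by (auto simp: G_def)
  ultimately have card: "card (F (insert x B) \<beta>) = card (F B \<beta>) + card G"
    unfolding eq using finF by (intro card_Un_disjoint)
  have "card G = (if L x \<in># \<beta> then k * card (F B (\<beta> - {#L x#})) else 0)"
  proof -
    have "inj_on (\<lambda>(c, S). insert c S) (opt x \<times> F B (\<beta> - {#L x#}))"
    proof (rule inj_onI, clarify)
      fix c S c' S'
      assume a: "c \<in> opt x" "c' \<in> opt x" "S \<in> F B (\<beta> - {#L x#})" "S' \<in> F B (\<beta> - {#L x#})"
        and e: "insert c S = insert c' S'"
      have *: "c \<notin> S" "c \<notin> S'" "c' \<notin> S" "c' \<notin> S'" using a FY(1) disj by blast+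
      then show "c = c' \<and> S = S'" using e by (metis insert_eq_iff insert_iff)
    qed
    then show ?thesis by (simp add: G_def card_image card_cartesian_product optx)
  qed
  moreover have "k * k ^ size (\<beta> - {#L x#}) = k ^ size \<beta>" if "L x \<in># \<beta>"
    using that by (metis Suc_pred' power_Suc size_Diff_singleton size_eq_Suc_imp_eq_union size_Suc_Diff1)
  ultimately have "card (F (insert x B) \<beta>)
      = k ^ size \<beta> * part_binom (image_mset L (mset_set (insert x B))) \<beta>"
    using insert.hyps card by (auto simp: IH part_binom_add_mset algebra_simps)
  then show ?case by (simp add: F_def)
qed

section \<open>Cycles of a permutation\<close>

lemma orbit_subset_invariant: "f ` X \<subseteq> X \<Longrightarrow> x \<in> X \<Longrightarrow> orbit f x \<subseteq> X"
proof
  fix y assume X: "f ` X \<subseteq> X" "x \<in> X" and "y \<in> orbit f x"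
  from this(3) show "y \<in> X" by induct (use X in auto)
qed

text \<open>
  Only the values of \<open>f\<close> on \<open>X\<close> matter, since \<open>f\<close> will be the total function obtained from a partial map by \<open>the\<close>.
\<close>

locale finite_perm =
  fixes X :: "'a set" and f :: "'a \<Rightarrow> 'a"
  assumes finite_X: "finite X" and bij: "bij_betw f X X"
begin

abbreviation cycles :: "'a set set" where
  "cycles \<equiv> orbit f ` X"

lemma f_in: "x \<in> X \<Longrightarrow> f x \<in> X"
  using bij by (auto simp: bij_betw_def)

lemma orbit_in: "x \<in> X \<Longrightarrow> orbit f x \<subseteq> X"
  using f_in by (intro orbit_subset_invariant) auto

lemma self_in_orbit:
  assumes x: "x \<in> X"
  shows "x \<in> orbit f x"
proof -
  have inj: "inj_on f X" using bij by (simp add: bij_betw_def)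
  have "f ` orbit f x = orbit f x"
  proof (rule endo_inj_surj)
    show "finite (orbit f x)" using finite_subset[OF orbit_in[OF x] finite_X] .
    show "inj_on f (orbit f x)" using inj_on_subset[OF inj orbit_in[OF x]] .
  qed (auto intro: orbit.step)
  then obtain y where y: "y \<in> orbit f x" "f y = f x" using orbit.base[of f x] by (metis imageE)
  then have "y = x" using inj_onD[OF inj] orbit_in[OF x] x by blast
  with y show ?thesis by simp
qed

lemma orbit_eq: "x \<in> X \<Longrightarrow> y \<in> orbit f x \<Longrightarrow> orbit f y = orbit f x"
  by (meson orbit_swap orbit_trans self_in_orbit subset_antisym subsetI)

lemma cycle_eq_orbit: "C \<in> cycles \<Longrightarrow> x \<in> C \<Longrightarrow> C = orbit f x"
  using orbit_eq by auto

lemma cycle_subset: "C \<in> cycles \<Longrightarrow> C \<subseteq> X"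
  using orbit_in by auto

lemma Union_cycles: "\<Union>cycles = X"
  using orbit_in self_in_orbit by blast

lemma finite_cycles [simp]: "finite cycles"
  using finite_X by simp

lemma cycle_nonempty: "C \<in> cycles \<Longrightarrow> C \<noteq> {}"
  by (auto simp: orbit_nonempty)

lemma cycle_card_pos: "C \<in> cycles \<Longrightarrow> card C > 0"
  using cycle_nonempty finite_subset[OF cycle_subset finite_X] by (auto simp: card_gt_0_iff)

lemma cycles_disjoint: "C \<in> cycles \<Longrightarrow> D \<in> cycles \<Longrightarrow> C \<noteq> D \<Longrightarrow> C \<inter> D = {}"
  using cycle_eq_orbit by blast

lemma sum_card_cycles: "\<S> \<subseteq> cycles \<Longrightarrow> (\<Sum>C\<in>\<S>. card C) = card (\<Union>\<S>)"
  using finite_subset[OF cycle_subset finite_X] cycles_disjoint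
  by (intro card_Union_disjoint[symmetric]) (simp_all add: pairwise_def disjnt_def subset_iff)

lemma orbit_range: "x \<in> X \<Longrightarrow> orbit f x = range (\<lambda>i. (f ^^ i) x)"
  using orbit_altdef_self_in[OF self_in_orbit] by auto

lemma funpow_eq_iff:
  assumes x: "x \<in> X"
  shows "(f ^^ i) x = (f ^^ j) x \<longleftrightarrow> i mod card (orbit f x) = j mod card (orbit f x)"
proof -
  note self = self_in_orbit[OF x]
  define p where "p = funpow_dist1 f x x"
  have orb: "orbit f x = (\<lambda>n. (f ^^ n) x) ` {0..<p}"
    using orbit_conv_funpow_dist1[OF self] by (simp only: p_def)
  have inj: "inj_on (\<lambda>n. (f ^^ n) x) {0..<p}"
    using inj_on_funpow_dist1[OF self] by (simp only: p_def)
  have p: "card (orbit f x) = p" unfolding orb by (simp add: card_image[OF inj])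
  have per: "(f ^^ p) x = x" using funpow_dist1_prop[OF self] by (simp only: p_def)
  have "p > 0" by (simp add: p_def)
  have mod: "(f ^^ (i mod p)) x = (f ^^ i) x" for i by (rule funpow_mod_eq[OF per])
  show ?thesis unfolding p
  proof
    assume "(f ^^ i) x = (f ^^ j) x"
    then have "(f ^^ (i mod p)) x = (f ^^ (j mod p)) x" by (simp only: mod)
    then show "i mod p = j mod p" using inj_onD[OF inj] \<open>p > 0\<close> by simp
  next
    assume "i mod p = j mod p"
    then show "(f ^^ i) x = (f ^^ j) x" by (metis mod)
  qed
qed

text \<open>
  An invariant set is the union of the cycles that it meets.
\<close>

lemma bij_invariant_sets_cycles:
  "bij_betw (\<lambda>K. orbit f ` K) {K. K \<subseteq> X \<and> f ` K = K} (Pow cycles)"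
proof (rule bij_betw_byWitness[where f' = "\<lambda>\<S>. \<Union>\<S>"])
  have U: "\<Union>(orbit f ` K) = K" if "K \<subseteq> X" "f ` K = K" for K
    using orbit_subset_invariant[of f K] that self_in_orbit by blast
  then show "\<forall>K\<in>{K. K \<subseteq> X \<and> f ` K = K}. \<Union>(orbit f ` K) = K" by simp
  show "\<forall>\<S>\<in>Pow cycles. orbit f ` \<Union>\<S> = \<S>"
  proof (intro ballI equalityI subsetI)
    fix \<S> C assume S: "\<S> \<in> Pow cycles"
    { assume "C \<in> orbit f ` \<Union>\<S>"
      then obtain x D where "x \<in> D" "D \<in> \<S>" "C = orbit f x" by auto
      then show "C \<in> \<S>" using S cycle_eq_orbit[of D x] by auto
    next
      assume C: "C \<in> \<S>"
      then obtain x where "x \<in> X" "C = orbit f x" using S by auto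
      then show "C \<in> orbit f ` \<Union>\<S>" using C self_in_orbit by blast }
  qed
  show "(\<lambda>K. orbit f ` K) ` {K. K \<subseteq> X \<and> f ` K = K} \<subseteq> Pow cycles" by auto
  show "(\<lambda>\<S>. \<Union>\<S>) ` Pow cycles \<subseteq> {K. K \<subseteq> X \<and> f ` K = K}"
  proof clarify
    fix \<S> assume S: "\<S> \<subseteq> cycles"
    have img: "f ` C = C" if C: "C \<in> \<S>" for C
    proof -
      obtain x where x: "x \<in> X" "C = orbit f x" using S C by auto
      show ?thesis unfolding x(2)
      proof (rule endo_inj_surj)
        show "finite (orbit f x)" using finite_subset[OF orbit_in[OF x(1)] finite_X] .
        show "inj_on f (orbit f x)"
          using bij orbit_in[OF x(1)] by (auto simp: bij_betw_def intro: inj_on_subset)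
      qed (auto intro: orbit.step)
    qed
    have "f ` \<Union>\<S> = (\<Union>C\<in>\<S>. f ` C)" by (rule image_Union)
    also have "\<dots> = \<Union>\<S>" using img by auto
    finally show "\<Union>\<S> \<subseteq> X \<and> f ` \<Union>\<S> = \<Union>\<S>" using S Union_cycles by auto
  qed
qed

end

text \<open>
  Two parametrizations that identify the same parameters have isomorphic images. This
  produces the equivariant bijections between cycles below.
\<close>

lemma bij_betw_same_kernel:
  assumes "\<And>i j. u i = u j \<longleftrightarrow> u' i = u' j"
  shows "\<exists>h. bij_betw h (range u) (range u') \<and> (\<forall>i. h (u i) = u' i)"
proof -
  define h where "h y = u' (SOME i. u i = y)" for y
  have h: "h (u i) = u' i" for i
    unfolding h_def using assms[of "SOME j. u j = u i" i] someI[of "\<lambda>j. u j = u i" i] by simp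
  have "inj_on h (range u)" using h assms by (auto simp: inj_on_def)
  moreover have "h ` range u = range u'" using h by (auto simp: image_iff)
  ultimately show ?thesis using h by (auto simp: bij_betw_def)
qed

lemma bij_betw_same_labels:
  assumes "finite I" "finite J" "image_mset a (mset_set I) = image_mset b (mset_set J)"
  shows "\<exists>\<beta>. bij_betw \<beta> I J \<and> (\<forall>i\<in>I. b (\<beta> i) = a i)"
  using assms
proof (induction I arbitrary: J rule: finite_induct)
  case empty
  then have "J = {}" by (simp add: mset_set_empty_iff)
  then show ?case by (simp add: bij_betw_def)
next
  case (insert i I)
  then have "a i \<in># image_mset b (mset_set J)" by (metis image_mset_add_mset mset_set.insert union_single_eq_member)
  then obtain j where j: "j \<in> J" "b j = a i" using insert.prems(1) by auto
  have "image_mset b (mset_set J) = add_mset (a i) (image_mset b (mset_set (J - {j})))"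
    using j insert.prems(1) mset_set.remove[of J j] by simp
  then have "image_mset a (mset_set I) = image_mset b (mset_set (J - {j}))"
    using insert by simp
  from insert.IH[OF _ this] obtain \<beta> where \<beta>: "bij_betw \<beta> I (J - {j})" "\<forall>i\<in>I. b (\<beta> i) = a i"
    using insert.prems(1) by auto
  have "bij_betw (\<beta>(i := j)) I (J - {j})"
    using \<beta>(1) insert.hyps by (subst bij_betw_cong[where g = \<beta>]) auto
  then have "bij_betw (\<beta>(i := j)) (I \<union> {i}) ((J - {j}) \<union> {j})"
    by (rule bij_betw_combine) auto
  moreover have "(J - {j}) \<union> {j} = J" using j by auto
  ultimately have "bij_betw (\<beta>(i := j)) (insert i I) J" by simp
  moreover have "\<forall>k\<in>insert i I. b ((\<beta>(i := j)) k) = a k"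
    using \<beta>(2) insert.hyps j by auto
  ultimately show ?case by blast
qed

text \<open>
  If two sets are cut into labelled blocks, with the same multiset of labels, and blocks with equal label
  are isomorphic, then the whole sets are isomorphic. \<open>Ops\<close> lists corresponding operations on the two
  sides: the permutations, and for signed permutations also the involutions.
\<close>

lemma bij_betw_glue_blocks:
  fixes A :: "'i \<Rightarrow> 'a set" and B :: "'j \<Rightarrow> 'b set"
  assumes fin: "finite I" "finite J" and labels: "image_mset a (mset_set I) = image_mset b (mset_set J)"
    and disj: "disjoint_family_on A I" "disjoint_family_on B J"
    and closed: "\<And>i x f f'. i \<in> I \<Longrightarrow> x \<in> A i \<Longrightarrow> (f, f') \<in> Ops \<Longrightarrow> f x \<in> A i"
    and iso: "\<And>i j. i \<in> I \<Longrightarrow> j \<in> J \<Longrightarrow> a i = b j \<Longrightarrow>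
      \<exists>h. bij_betw h (A i) (B j) \<and> (\<forall>(f, f')\<in>Ops. \<forall>x\<in>A i. h (f x) = f' (h x))"
  shows "\<exists>h. bij_betw h (\<Union>i\<in>I. A i) (\<Union>j\<in>J. B j) \<and> (\<forall>(f, f')\<in>Ops. \<forall>x\<in>(\<Union>i\<in>I. A i). h (f x) = f' (h x))"
proof -
  obtain \<beta> where \<beta>: "bij_betw \<beta> I J" "\<And>i. i \<in> I \<Longrightarrow> b (\<beta> i) = a i"
    using bij_betw_same_labels[OF fin labels] by blast
  then have \<beta>J: "\<beta> i \<in> J" if "i \<in> I" for i using that by (auto simp: bij_betw_def)
  have "\<forall>i\<in>I. \<exists>h. bij_betw h (A i) (B (\<beta> i)) \<and> (\<forall>(f, f')\<in>Ops. \<forall>x\<in>A i. h (f x) = f' (h x))"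
    using iso \<beta> \<beta>J by simp
  then obtain k where k: "\<And>i. i \<in> I \<Longrightarrow> bij_betw (k i) (A i) (B (\<beta> i))"
    "\<And>i f f' x. i \<in> I \<Longrightarrow> (f, f') \<in> Ops \<Longrightarrow> x \<in> A i \<Longrightarrow> k i (f x) = f' (k i x)"
    unfolding bchoice_iff by blast
  \<comment> \<open>\<open>k i\<close> is the chosen isomorphism of the \<open>i\<close>-th block; the blocks are disjoint, so \<open>x\<close> determines \<open>i\<close>.\<close>
  define h where "h x = k (THE i. i \<in> I \<and> x \<in> A i) x" for x
  have h: "h x = k i x" if "i \<in> I" "x \<in> A i" for i x
  proof -
    have "(THE i. i \<in> I \<and> x \<in> A i) = i"
      using that disj(1) by (intro the_equality) (auto simp: disjoint_family_on_def)
    then show ?thesis by (simp add: h_def)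
  qed
  have "bij_betw h (\<Union>i\<in>I. A i) (\<Union>i\<in>I. B (\<beta> i))"
  proof (rule bij_betw_UNION_disjoint)
    show "disjoint_family_on (\<lambda>i. B (\<beta> i)) I"
    proof (unfold disjoint_family_on_def, intro ballI impI)
      fix i j assume "i \<in> I" "j \<in> I" "i \<noteq> j"
      moreover from this have "\<beta> i \<noteq> \<beta> j" using \<beta>(1) by (auto simp: bij_betw_def inj_on_def)
      ultimately show "B (\<beta> i) \<inter> B (\<beta> j) = {}"
        using disj(2) \<beta>J by (simp add: disjoint_family_on_def)
    qed
    show "bij_betw h (A i) (B (\<beta> i))" if "i \<in> I" for i
      using k(1)[OF that] h[OF that] by (metis bij_betw_cong)
  qed
  moreover have "(\<Union>i\<in>I. B (\<beta> i)) = (\<Union>j\<in>J. B j)" using \<beta>(1) by (auto simp: bij_betw_def)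
  moreover have "\<forall>(f, f')\<in>Ops. \<forall>x\<in>(\<Union>i\<in>I. A i). h (f x) = f' (h x)"
  proof clarify
    fix f f' x i assume ops: "(f, f') \<in> Ops" and i: "i \<in> I" "x \<in> A i"
    show "h (f x) = f' (h x)"
      using k(2)[OF i(1) ops i(2)] h[OF i] h[OF i(1) closed[OF i ops]] by simp
  qed
  ultimately show ?thesis by (intro exI[of _ h] conjI) simp_all
qed

text \<open>
  The blocks are the cycles, labelled by length.
\<close>

lemma conjugate_if_same_cycle_type:
  assumes "finite_perm X f" "finite_perm X' f'"
    and type: "image_mset card (mset_set (orbit f ` X)) = image_mset card (mset_set (orbit f' ` X'))"
  shows "\<exists>h. bij_betw h X X' \<and> (\<forall>x\<in>X. h (f x) = f' (h x))"
proof -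
  interpret F: finite_perm X f by fact
  interpret F': finite_perm X' f' by fact
  have "\<exists>h. bij_betw h (\<Union>C\<in>F.cycles. C) (\<Union>C\<in>F'.cycles. C)
      \<and> (\<forall>(g, g')\<in>{(f, f')}. \<forall>x\<in>(\<Union>C\<in>F.cycles. C). h (g x) = g' (h x))"
  proof (rule bij_betw_glue_blocks[OF _ _ type])
    show "disjoint_family_on (\<lambda>C. C) F.cycles" "disjoint_family_on (\<lambda>C. C) F'.cycles"
      using F.cycles_disjoint F'.cycles_disjoint by (auto simp: disjoint_family_on_def)
    show "g x \<in> C" if "C \<in> F.cycles" "x \<in> C" "(g, g') \<in> {(f, f')}" for C x g g'
      using that by (auto intro: orbit.step)
    fix C C' assume C: "C \<in> F.cycles" "C' \<in> F'.cycles" "card C = card C'"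
    then obtain x x' where x: "x \<in> X" "C = orbit f x" and x': "x' \<in> X'" "C' = orbit f' x'" by auto
    have "\<exists>h. bij_betw h (range (\<lambda>i. (f ^^ i) x)) (range (\<lambda>i. (f' ^^ i) x'))
        \<and> (\<forall>i. h ((f ^^ i) x) = (f' ^^ i) x')"
      using C x x' by (intro bij_betw_same_kernel) (simp add: F.funpow_eq_iff F'.funpow_eq_iff)
    then obtain h where h: "bij_betw h C C'" "\<And>i. h ((f ^^ i) x) = (f' ^^ i) x'"
      using x x' by (auto simp: F.orbit_range F'.orbit_range)
    have "h (f y) = f' (h y)" if "y \<in> C" for y
    proof -
      obtain i where "y = (f ^^ i) x" using \<open>y \<in> C\<close> x by (auto simp: F.orbit_range)
      then show ?thesis using h(2)[of i] h(2)[of "Suc i"] by simp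
    qed
    then show "\<exists>h. bij_betw h C C' \<and> (\<forall>(g, g')\<in>{(f, f')}. \<forall>x\<in>C. h (g x) = g' (h x))"
      using h(1) by auto
  qed simp_all
  then show ?thesis using F.Union_cycles F'.Union_cycles by simp
qed

section \<open>Permutations commuting with a free involution\<close>

lemma (in finite_perm) card_invariant_sets_of_type:
  "card {K. K \<subseteq> X \<and> f ` K = K \<and> image_mset card (mset_set (orbit f ` K)) = \<beta>}
    = part_binom (image_mset card (mset_set cycles)) \<beta>"
proof -
  have "bij_betw (\<lambda>K. orbit f ` K) {K \<in> {K. K \<subseteq> X \<and> f ` K = K}. image_mset card (mset_set (orbit f ` K)) = \<beta>}
      {\<S> \<in> Pow cycles. image_mset card (mset_set \<S>) = \<beta>}"
    by (rule bij_betw_Collect[OF bij_invariant_sets_cycles]) simp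
  from bij_betw_same_card[OF this]
  have "card {K. K \<subseteq> X \<and> f ` K = K \<and> image_mset card (mset_set (orbit f ` K)) = \<beta>}
      = card {\<S>. \<S> \<subseteq> cycles \<and> image_mset card (mset_set \<S>) = \<beta>}"
    by (simp add: conj_assoc)
  also have "\<dots> = 1 ^ size \<beta> * part_binom (image_mset card (mset_set cycles)) \<beta>"
    using card_partial_transversals[of cycles "\<lambda>C. {C}" 1 card card \<beta>]
    by (simp add: disjoint_family_on_def)
  finally show ?thesis by simp
qed

text \<open>
  Each pair contributes its label twice.
\<close>

lemma image_mset_Union_pairs:
  fixes g :: "'c \<Rightarrow> 'd"
  assumes "finite \<D>" "\<And>D. D \<in> \<D> \<Longrightarrow> card D = 2" "pairwise disjnt \<D>"
    and "\<And>D C. D \<in> \<D> \<Longrightarrow> C \<in> D \<Longrightarrow> g C = L D"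
  shows "image_mset g (mset_set (\<Union>\<D>)) = image_mset L (mset_set \<D>) + image_mset L (mset_set \<D>)"
  using assms
proof (induction \<D> rule: finite_induct)
  case (insert D \<D>)
  then have IH: "image_mset g (mset_set (\<Union>\<D>)) = image_mset L (mset_set \<D>) + image_mset L (mset_set \<D>)"
    by (auto simp: pairwise_insert)
  have "card D = 2" using insert.prems by simp
  then obtain C C' where D: "D = {C, C'}" "C \<noteq> C'" by (meson card_2_iff)
  have "finite E" if "E \<in> \<D>" for E
    using insert.prems(1)[of E] that by (intro card_ge_0_finite) simp
  then have fin: "finite (\<Union>\<D>)" using insert.hyps(1) by simp
  have "D \<inter> E = {}" if "E \<in> \<D>" for E
    using insert.prems(2) insert.hyps(2) that by (auto simp: pairwise_insert disjnt_def)
  then have "C \<notin> \<Union>\<D>" "C' \<notin> \<Union>\<D>" using D by auto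
  moreover have "\<Union>(insert D \<D>) = insert C (insert C' (\<Union>\<D>))" using D by auto
  ultimately have "mset_set (\<Union>(insert D \<D>)) = add_mset C (add_mset C' (mset_set (\<Union>\<D>)))"
    using fin D by simp
  moreover have "g C = L D" "g C' = L D" using insert.prems(3)[of D] D by auto
  ultimately show ?case using IH insert.hyps by simp
qed simp

text \<open>
  In the application \<open>X = ground n\<close>, \<open>b = bar n\<close>, and \<open>f\<close> is an element of the Weyl group.
\<close>

locale signed_perm = finite_perm X f for X :: "'a set" and f +
  fixes b :: "'a \<Rightarrow> 'a"
  assumes b_in: "x \<in> X \<Longrightarrow> b x \<in> X" and b_b: "x \<in> X \<Longrightarrow> b (b x) = x"
    and b_neq: "x \<in> X \<Longrightarrow> b x \<noteq> x" and commute: "x \<in> X \<Longrightarrow> f (b x) = b (f x)"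
begin

lemma funpow_in: "x \<in> X \<Longrightarrow> (f ^^ i) x \<in> X"
  by (induction i) (auto intro: f_in)

lemma funpow_b: "x \<in> X \<Longrightarrow> (f ^^ i) (b x) = b ((f ^^ i) x)"
  by (induction i) (auto simp: commute funpow_in)

lemma orbit_b:
  assumes "x \<in> X"
  shows "orbit f (b x) = b ` orbit f x"
proof (rule orbit_inverse[symmetric, OF self_in_orbit[OF assms]])
  fix y assume "y \<in> orbit f x"
  then show "f (b y) = b (f y)" using orbit_in[OF assms] by (intro commute) auto
qed

lemma b_image_cycle: "C \<in> cycles \<Longrightarrow> b ` C \<in> cycles"
proof -
  assume "C \<in> cycles"
  then obtain x where "x \<in> X" "C = orbit f x" by blast
  then show ?thesis using orbit_b[of x] b_in[of x] by (metis imageI)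
qed

lemma b_image_image: "C \<in> cycles \<Longrightarrow> b ` b ` C = C"
  using cycle_subset[of C] b_b by (force simp: image_iff)

lemma card_b_image: "C \<in> cycles \<Longrightarrow> card (b ` C) = card C"
  using cycle_subset[of C] b_b by (intro card_image) (metis inj_on_def subsetD)

text \<open>
  On a stable cycle \<open>b\<close> is a power \<open>f^k\<close> of \<open>f\<close> with \<open>0 < k < p\<close>, where \<open>p\<close> is the length. As \<open>b\<close> is an
  involution, \<open>p\<close> divides \<open>2k < 2p\<close>, so that \<open>p = 2k\<close>. Hence a stable cycle has even length, and its length
  determines how \<open>b\<close> acts on it.
\<close>

lemma stable_half_turn:
  assumes x: "x \<in> X" and st: "b ` orbit f x = orbit f x"
  shows "\<exists>m. card (orbit f x) = 2 * m \<and> b x = (f ^^ m) x"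
proof -
  define p where "p = card (orbit f x)"
  have p: "p > 0" using cycle_card_pos x by (simp add: p_def)
  note eq = funpow_eq_iff[OF x, folded p_def]
  have "b x \<in> orbit f x" using self_in_orbit[OF x] st by blast
  then obtain k' where "b x = (f ^^ k') x" using orbit_range[OF x] by auto
  then obtain k where k: "b x = (f ^^ k) x" "k < p"
    using eq[of k' "k' mod p"] p by (metis mod_less_divisor mod_mod_trivial)
  have "(f ^^ (k + k)) x = (f ^^ k) (b x)" by (simp only: funpow_add o_apply k(1))
  also have "\<dots> = b ((f ^^ k) x)" by (rule funpow_b[OF x])
  also have "\<dots> = (f ^^ 0) x" by (simp add: b_b[OF x] flip: k(1))
  finally have "(k + k) mod p = 0 mod p" by (simp only: eq)
  then have "p dvd k + k" by (simp add: dvd_eq_mod_eq_0)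
  moreover have "k \<noteq> 0" using k(1) b_neq[OF x] by (auto intro: ccontr)
  moreover from calculation(1) obtain q where q: "k + k = p * q" by (rule dvdE)
  ultimately have q: "k + k = p * q" "q > 0" by (auto intro!: Nat.gr0I)
  then have "q < 2" using k(2) by (metis add_less_mono mult.commute mult_2 mult_less_cancel1 p)
  then have "q = 1" using q(2) by simp
  then have "p = 2 * k" using q(1) by simp
  with k(1) show ?thesis by (auto simp: p_def)
qed

definition moved :: "'a set set" where "moved = {C \<in> cycles. b ` C \<noteq> C}"
definition stable :: "'a set set" where "stable = {C \<in> cycles. b ` C = C}"
definition moved_pairs :: "'a set set set" where "moved_pairs = (\<lambda>C. {C, b ` C}) ` moved"
definition pairs :: "'a set set set" where "pairs = (\<lambda>C. {C, b ` C}) ` cycles"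
text \<open>
  The partition \<open>\<gamma>\<close> of the class: one part for each pair \<open>{C, b ` C}\<close> of moved cycles, namely the length
  \<open>card (\<Union>D) div 2\<close> of either of them.
\<close>

definition paired_type :: "nat multiset" where
  "paired_type = image_mset (\<lambda>D. card (\<Union>D) div 2) (mset_set moved_pairs)"

lemma finite_moved [simp]: "finite moved" "finite stable" "finite moved_pairs" "finite pairs"
  by (simp_all add: moved_def stable_def moved_pairs_def pairs_def)

lemma pair_eq: "D \<in> pairs \<Longrightarrow> C \<in> D \<Longrightarrow> C \<in> cycles \<and> D = {C, b ` C}"
proof -
  assume D: "D \<in> pairs" and CD: "C \<in> D"
  then obtain C0 where "C0 \<in> cycles" "D = {C0, b ` C0}" unfolding pairs_def by blast
  moreover from this have "C = C0 \<or> C = b ` C0" using CD by blast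
  ultimately show ?thesis using b_image_cycle[of C0] b_image_image[of C0] by (elim disjE) (simp_all add: insert_commute)
qed

lemma moved_pairs_subset: "moved_pairs \<subseteq> pairs"
  by (auto simp: moved_pairs_def pairs_def moved_def)

lemma pairs_disjoint: "pairwise disjnt pairs"
  unfolding pairwise_def disjnt_def using pair_eq by blast

lemma Union_moved_pairs: "\<Union>moved_pairs = moved"
proof -
  have "b ` C \<in> moved" if "C \<in> moved" for C
  proof -
    have C: "C \<in> cycles" "b ` C \<noteq> C" using that by (simp_all add: moved_def)
    show ?thesis using b_image_cycle[OF C(1)] b_image_image[OF C(1)] C(2) by (simp add: moved_def)
  qed
  then show ?thesis unfolding moved_pairs_def by blast
qed

lemma pairs_split: "pairs = moved_pairs \<union> (\<lambda>C. {C}) ` stable"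
proof -
  have "cycles = moved \<union> stable" unfolding moved_def stable_def by blast
  moreover have "(\<lambda>C. {C, b ` C}) ` stable = (\<lambda>C. {C}) ` stable"
    by (rule image_cong) (simp_all add: stable_def)
  ultimately show ?thesis by (simp only: pairs_def moved_pairs_def image_Un)
qed

lemma moved_pair_card:
  assumes "D \<in> moved_pairs" "C \<in> D"
  shows "card D = 2" "card (\<Union>D) = 2 * card C"
proof -
  have C: "C \<in> moved" using assms Union_moved_pairs by auto
  have D: "C \<in> cycles" "D = {C, b ` C}"
    using pair_eq[of D C] assms moved_pairs_subset by blast+
  have neq: "b ` C \<noteq> C" using C by (simp add: moved_def)
  then show "card D = 2" using D(2) by simp
  have "card (C \<union> b ` C) = card C + card (b ` C)"
    using D finite_subset[OF cycle_subset finite_X] cycles_disjoint[OF D(1) b_image_cycle[OF D(1)]] neq b_image_cycle[OF D(1)]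
    by (intro card_Un_disjoint) auto
  then show "card (\<Union>D) = 2 * card C" using D card_b_image by simp
qed

lemma moved_type: "image_mset card (mset_set moved) = paired_type + paired_type"
  unfolding paired_type_def Union_moved_pairs[symmetric]
proof (rule image_mset_Union_pairs)
  show "pairwise disjnt moved_pairs" by (rule pairwise_subset[OF pairs_disjoint moved_pairs_subset])
  show "card D = 2" if "D \<in> moved_pairs" for D
    using that moved_pair_card(1)[OF that] by (auto simp: moved_pairs_def)
qed (simp_all add: moved_pair_card(2))

text \<open>
  For a pair \<open>D = {C, b ` C}\<close> the label is \<open>(2, 2 * card C)\<close> if \<open>C\<close> is moved and \<open>(1, card C)\<close> if it is stable.
  So the multiset of labels, on which the gluing of blocks depends, is determined by the signed cycle type.
\<close>

lemma pair_labels: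
  "image_mset (\<lambda>D. (card D, card (\<Union>D))) (mset_set pairs)
    = image_mset (\<lambda>a. (2, 2 * a)) paired_type + image_mset (\<lambda>a. (1, a)) (image_mset card (mset_set stable))"
proof -
  have disj: "moved_pairs \<inter> (\<lambda>C. {C}) ` stable = {}"
    by (auto simp: moved_pairs_def moved_def)
  have inj: "inj_on (\<lambda>C. {C}) stable" by simp
  have "mset_set pairs = mset_set moved_pairs + image_mset (\<lambda>C. {C}) (mset_set stable)"
    unfolding pairs_split image_mset_mset_set[OF inj] using disj by (intro mset_set_Union) simp_all
  moreover have "image_mset (\<lambda>D. (card D, card (\<Union>D))) (mset_set moved_pairs)
      = image_mset (\<lambda>D. (2, 2 * (card (\<Union>D) div 2))) (mset_set moved_pairs)"
  proof (rule image_mset_cong)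
    fix D assume "D \<in># mset_set moved_pairs"
    then have D: "D \<in> moved_pairs" by simp
    then obtain C where "C \<in> D" by (auto simp: moved_pairs_def)
    then show "(card D, card (\<Union>D)) = (2, 2 * (card (\<Union>D) div 2))" using moved_pair_card[OF D] by simp
  qed
  ultimately show ?thesis by (simp add: paired_type_def image_mset.compositionality o_def)
qed

lemma blocks_disjoint: "disjoint_family_on Union pairs"
proof (unfold disjoint_family_on_def, intro ballI impI)
  fix D E assume D: "D \<in> pairs" "E \<in> pairs" "D \<noteq> E"
  show "\<Union>D \<inter> \<Union>E = {}"
  proof (rule ccontr)
    assume "\<Union>D \<inter> \<Union>E \<noteq> {}"
    then obtain x C C' where x: "x \<in> C" "C \<in> D" "x \<in> C'" "C' \<in> E" by blast
    then have "C \<in> cycles" "C' \<in> cycles" using pair_eq D by blast+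
    then have "C = C'" using x cycles_disjoint by blast
    then show False using x pair_eq D by blast
  qed
qed

lemma Union_blocks: "(\<Union>D\<in>pairs. \<Union>D) = X"
proof -
  have "(\<Union>D\<in>pairs. \<Union>D) = \<Union>cycles"
    unfolding pairs_def using b_image_cycle by blast
  then show ?thesis using Union_cycles by simp
qed

text \<open>
  A parametrization of the block of \<open>x\<close>, the union of \<open>orbit f x\<close> and its image under \<open>b\<close>, by a power of \<open>f\<close>
  and a sign. Both \<open>f\<close> and \<open>b\<close> act on the parameters in a way that does not depend on \<open>x\<close>, so blocks are
  isomorphic when their walks identify the same parameters.
\<close>

definition walk :: "'a \<Rightarrow> nat \<times> bool \<Rightarrow> 'a" where
  "walk x = (\<lambda>(i, s). (f ^^ i) (if s then b x else x))"

lemma range_walk: "x \<in> X \<Longrightarrow> range (walk x) = \<Union>{orbit f x, b ` orbit f x}"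
proof -
  assume x: "x \<in> X"
  have "range (walk x) = range (\<lambda>i. (f ^^ i) x) \<union> range (\<lambda>i. (f ^^ i) (b x))"
  proof (intro equalityI subsetI)
    fix y assume "y \<in> range (walk x)"
    then obtain i s where "y = walk x (i, s)" by (metis imageE prod.exhaust)
    then show "y \<in> range (\<lambda>i. (f ^^ i) x) \<union> range (\<lambda>i. (f ^^ i) (b x))" by (simp add: walk_def)
  next
    fix y assume "y \<in> range (\<lambda>i. (f ^^ i) x) \<union> range (\<lambda>i. (f ^^ i) (b x))"
    then obtain i where "y = walk x (i, False) \<or> y = walk x (i, True)" by (auto simp: walk_def)
    then show "y \<in> range (walk x)" by blast
  qed
  then show ?thesis using x orbit_range[OF x] orbit_range[OF b_in[OF x]] orbit_b[OF x] by simp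
qed

lemma f_walk: "f (walk x (i, s)) = walk x (Suc i, s)"
  by (simp add: walk_def)

lemma b_walk: "x \<in> X \<Longrightarrow> b (walk x (i, s)) = walk x (i, \<not> s)"
  by (simp add: walk_def funpow_b funpow_in b_b)

lemma walk_eq_moved:
  assumes x: "x \<in> X" and mv: "b ` orbit f x \<noteq> orbit f x"
  shows "walk x (i, s) = walk x (j, s') \<longleftrightarrow> s = s' \<and> i mod card (orbit f x) = j mod card (orbit f x)"
proof -
  have bx: "b x \<in> X" and card: "card (orbit f (b x)) = card (orbit f x)"
    using x b_in card_b_image orbit_b by auto
  have "orbit f x \<inter> orbit f (b x) = {}"
    using cycles_disjoint[of "orbit f x" "orbit f (b x)"] mv x bx orbit_b[OF x] by auto
  then have "(f ^^ i) x \<noteq> (f ^^ j) (b x)" for i j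
    using orbit_range[OF x] orbit_range[OF bx] by blast
  then show ?thesis
    using funpow_eq_iff[OF x] funpow_eq_iff[OF bx] card by (auto simp: walk_def) metis+
qed

lemma walk_eq_stable:
  assumes x: "x \<in> X" and st: "b ` orbit f x = orbit f x"
  defines "p \<equiv> card (orbit f x)"
  shows "walk x (i, s) = walk x (j, s')
    \<longleftrightarrow> (i + (if s then p div 2 else 0)) mod p = (j + (if s' then p div 2 else 0)) mod p"
proof -
  obtain m where m: "p = 2 * m" "b x = (f ^^ m) x"
    using stable_half_turn[OF x st] by (auto simp: p_def)
  have "walk x (i, s) = (f ^^ (i + (if s then p div 2 else 0))) x" for i s
    using m by (simp add: walk_def funpow_add)
  then show ?thesis using funpow_eq_iff[OF x, folded p_def] by simp
qed

lemma class_type_exists: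
  "\<exists>\<gamma> \<delta>. 0 \<notin># \<gamma> \<and> 0 \<notin># \<delta> \<and> 2 * (sum_mset \<gamma> + sum_mset \<delta>) = card X
    \<and> image_mset card (mset_set moved) = \<gamma> + \<gamma> \<and> image_mset card (mset_set stable) = image_mset (\<lambda>a. 2 * a) \<delta>"
proof -
  define \<delta> where "\<delta> = image_mset (\<lambda>C. card C div 2) (mset_set stable)"
  have even: "card C = 2 * (card C div 2)" "card C > 0" if C: "C \<in> stable" for C
  proof -
    obtain x where "x \<in> X" "C = orbit f x" using C unfolding stable_def by blast
    then show "card C = 2 * (card C div 2)" "card C > 0"
      using stable_half_turn[of x] C cycle_card_pos by (auto simp: stable_def)
  qed
  have st: "image_mset card (mset_set stable) = image_mset (\<lambda>a. 2 * a) \<delta>"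
    unfolding \<delta>_def image_mset.compositionality using even(1) by (intro image_mset_cong) simp
  have "0 \<notin># paired_type"
  proof
    assume "0 \<in># paired_type"
    then have "0 \<in># image_mset card (mset_set moved)" unfolding moved_type by simp
    then obtain C where "C \<in> moved" "card C = 0" by auto
    then show False using cycle_card_pos[of C] unfolding moved_def by simp
  qed
  moreover have "0 \<notin># \<delta>"
  proof
    assume "0 \<in># \<delta>"
    then obtain C where "C \<in> stable" "card C div 2 = 0" by (auto simp: \<delta>_def)
    then show False using even[of C] by simp
  qed
  moreover have "2 * (sum_mset paired_type + sum_mset \<delta>) = card X"
  proof -
    have double: "sum_mset (image_mset (\<lambda>a. 2 * a) M) = 2 * sum_mset M" for M :: "nat multiset"
      by (induction M) simp_all
    have "2 * (sum_mset paired_type + sum_mset \<delta>)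
        = sum_mset (image_mset card (mset_set moved)) + sum_mset (image_mset card (mset_set stable))"
      unfolding moved_type st double sum_mset.union by (simp only: mult_2 add_mult_distrib2 add.assoc)
    also have "\<dots> = (\<Sum>C\<in>moved. card C) + (\<Sum>C\<in>stable. card C)"
      by (simp add: sum_unfold_sum_mset)
    also have "\<dots> = (\<Sum>C\<in>cycles. card C)"
    proof -
      have "cycles = moved \<union> stable" "moved \<inter> stable = {}" by (auto simp: moved_def stable_def)
      then show ?thesis by (metis finite_moved(1,2) sum.union_disjoint)
    qed
    also have "\<dots> = card X" using sum_card_cycles[of cycles] Union_cycles by simp
    finally show ?thesis .
  qed
  ultimately show ?thesis using moved_type st by blast
qed

text \<open>
  An invariant set contains no \<open>x\<close> together with \<open>b x\<close> exactly if its cycles are all moved and include at most one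
  from each pair. So these sets are the partial transversals of the moved pairs, with two options each.
\<close>

lemma card_invariant_admissible_sets_of_type:
  "card {K. K \<subseteq> X \<and> f ` K = K \<and> (\<forall>x\<in>K. b x \<notin> K) \<and> image_mset card (mset_set (orbit f ` K)) = \<beta>}
    = 2 ^ size \<beta> * part_binom paired_type \<beta>"
proof -
  have adm: "(\<forall>x\<in>K. b x \<notin> K) \<longleftrightarrow> (\<forall>C\<in>orbit f ` K. b ` C \<notin> orbit f ` K)" if "K \<subseteq> X" "f ` K = K" for K
  proof
    have orbK: "orbit f y \<subseteq> K" if "y \<in> K" for y
      using orbit_subset_invariant[of f K] that \<open>f ` K = K\<close> by simp
    { assume *: "\<forall>x\<in>K. b x \<notin> K"
      show "\<forall>C\<in>orbit f ` K. b ` C \<notin> orbit f ` K"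
      proof (intro ballI notI)
        fix C assume "C \<in> orbit f ` K" "b ` C \<in> orbit f ` K"
        then obtain x y where "x \<in> K" "C = orbit f x" "y \<in> K" "b ` C = orbit f y" by auto
        then have "b x \<in> orbit f y" "x \<in> K" "y \<in> K"
          using self_in_orbit that(1) by auto
        then show False using orbK * by blast
      qed
    next
      assume *: "\<forall>C\<in>orbit f ` K. b ` C \<notin> orbit f ` K"
      show "\<forall>x\<in>K. b x \<notin> K"
        using * orbit_b that(1) by (metis imageI subsetD) }
  qed
  have "bij_betw (\<lambda>K. orbit f ` K)
      {K \<in> {K. K \<subseteq> X \<and> f ` K = K}. (\<forall>x\<in>K. b x \<notin> K) \<and> image_mset card (mset_set (orbit f ` K)) = \<beta>}
      {\<S> \<in> Pow cycles. (\<forall>C\<in>\<S>. b ` C \<notin> \<S>) \<and> image_mset card (mset_set \<S>) = \<beta>}"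
    by (rule bij_betw_Collect[OF bij_invariant_sets_cycles]) (use adm in auto)
  from bij_betw_same_card[OF this]
  have "card {K. K \<subseteq> X \<and> f ` K = K \<and> (\<forall>x\<in>K. b x \<notin> K) \<and> image_mset card (mset_set (orbit f ` K)) = \<beta>}
      = card {\<S>. \<S> \<subseteq> cycles \<and> (\<forall>C\<in>\<S>. b ` C \<notin> \<S>) \<and> image_mset card (mset_set \<S>) = \<beta>}"
    by (simp add: conj_assoc)
  also have "{\<S>. \<S> \<subseteq> cycles \<and> (\<forall>C\<in>\<S>. b ` C \<notin> \<S>) \<and> image_mset card (mset_set \<S>) = \<beta>}
      = {\<S>. \<S> \<subseteq> (\<Union>D\<in>moved_pairs. D)
          \<and> (\<forall>D\<in>moved_pairs. \<forall>C\<in>D. \<forall>C'\<in>D. C \<in> \<S> \<longrightarrow> C' \<in> \<S> \<longrightarrow> C = C')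
          \<and> image_mset card (mset_set \<S>) = \<beta>}"
  proof -
    have "\<S> \<subseteq> cycles \<and> (\<forall>C\<in>\<S>. b ` C \<notin> \<S>)
        \<longleftrightarrow> \<S> \<subseteq> moved \<and> (\<forall>D\<in>moved_pairs. \<forall>C\<in>D. \<forall>C'\<in>D. C \<in> \<S> \<longrightarrow> C' \<in> \<S> \<longrightarrow> C = C')" for \<S>
    proof
      assume L: "\<S> \<subseteq> cycles \<and> (\<forall>C\<in>\<S>. b ` C \<notin> \<S>)"
      then have "\<S> \<subseteq> moved" by (auto simp: moved_def)
      moreover have "C = C'" if "D \<in> moved_pairs" "C \<in> D" "C' \<in> D" "C \<in> \<S>" "C' \<in> \<S>" for D C C'
      proof -
        have "D = {C, b ` C}" using pair_eq[of D C] moved_pairs_subset that(1,2) by blast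
        moreover have "C' \<noteq> b ` C" using L that(4,5) by blast
        ultimately show ?thesis using that(3) by blast
      qed
      ultimately show "\<S> \<subseteq> moved \<and> (\<forall>D\<in>moved_pairs. \<forall>C\<in>D. \<forall>C'\<in>D. C \<in> \<S> \<longrightarrow> C' \<in> \<S> \<longrightarrow> C = C')"
        by blast
    next
      assume Rr: "\<S> \<subseteq> moved \<and> (\<forall>D\<in>moved_pairs. \<forall>C\<in>D. \<forall>C'\<in>D. C \<in> \<S> \<longrightarrow> C' \<in> \<S> \<longrightarrow> C = C')"
      have "b ` C \<notin> \<S>" if C: "C \<in> \<S>" for C
      proof
        assume bC: "b ` C \<in> \<S>"
        have "C \<in> moved" using Rr C by auto
        then have "{C, b ` C} \<in> moved_pairs" "b ` C \<noteq> C" by (auto simp: moved_pairs_def moved_def)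
        then show False using Rr C bC by (metis insertI1 insertI2)
      qed
      moreover have "\<S> \<subseteq> cycles" using Rr by (auto simp: moved_def)
      ultimately show "\<S> \<subseteq> cycles \<and> (\<forall>C\<in>\<S>. b ` C \<notin> \<S>)" by blast
    qed
    then show ?thesis by (simp add: Union_moved_pairs flip: conj_assoc)
  qed
  also have "card \<dots> = 2 ^ size \<beta> * part_binom paired_type \<beta>"
    unfolding paired_type_def
  proof (rule card_partial_transversals)
    show "disjoint_family_on (\<lambda>D. D) moved_pairs"
      using pairwise_subset[OF pairs_disjoint moved_pairs_subset]
      by (auto simp: disjoint_family_on_def pairwise_def disjnt_def)
    show "finite D \<and> card D = 2" if "D \<in> moved_pairs" for D
      using that moved_pair_card(1)[OF that] by (auto simp: moved_pairs_def)
  qed (simp_all add: moved_pair_card(2))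
  finally show ?thesis .
qed

end

text \<open>
  The blocks are the unions of the pairs \<open>{C, b ` C}\<close>, whose labels tell moved from stable and give the length.
\<close>

lemma conjugate_if_same_signed_cycle_type:
  assumes "signed_perm X f b" "signed_perm X' f' b'"
    and moved: "image_mset card (mset_set (signed_perm.moved X f b)) = image_mset card (mset_set (signed_perm.moved X' f' b'))"
    and stable: "image_mset card (mset_set (signed_perm.stable X f b)) = image_mset card (mset_set (signed_perm.stable X' f' b'))"
  shows "\<exists>h. bij_betw h X X' \<and> (\<forall>x\<in>X. h (f x) = f' (h x)) \<and> (\<forall>x\<in>X. h (b x) = b' (h x))"
proof -
  interpret F: signed_perm X f b by fact
  interpret F': signed_perm X' f' b' by fact
  have "F.paired_type + F.paired_type = F'.paired_type + F'.paired_type"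
    using moved by (simp add: F.moved_type F'.moved_type)
  then have half: "F.paired_type = F'.paired_type"
    by (intro multiset_eqI) (metis add_self_div_2 count_union)
  have labels: "image_mset (\<lambda>D. (card D, card (\<Union>D))) (mset_set F.pairs)
      = image_mset (\<lambda>D. (card D, card (\<Union>D))) (mset_set F'.pairs)"
    by (simp add: F.pair_labels F'.pair_labels half stable)
  have "\<exists>h. bij_betw h (\<Union>D\<in>F.pairs. \<Union>D) (\<Union>D\<in>F'.pairs. \<Union>D)
      \<and> (\<forall>(g, g')\<in>{(f, f'), (b, b')}. \<forall>x\<in>(\<Union>D\<in>F.pairs. \<Union>D). h (g x) = g' (h x))"
  proof (rule bij_betw_glue_blocks[OF _ _ labels F.blocks_disjoint F'.blocks_disjoint])
    fix D x g g' assume D: "D \<in> F.pairs" "x \<in> \<Union>D" "(g, g') \<in> {(f, f'), (b, b')}"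
    then obtain C where C: "C \<in> D" "x \<in> C" by blast
    then have "C \<in> F.cycles" "D = {C, b ` C}" using F.pair_eq[OF D(1)] by auto
    moreover have "f x \<in> C" using F.cycle_eq_orbit[OF calculation(1) C(2)] orbit.base by metis
    ultimately show "g x \<in> \<Union>D" using D(3) C by auto
  next
    fix D D' assume D: "D \<in> F.pairs" "D' \<in> F'.pairs" "(card D, card (\<Union>D)) = (card D', card (\<Union>D'))"
    obtain x where x: "x \<in> X" "D = {orbit f x, b ` orbit f x}" using D by (auto simp: F.pairs_def)
    obtain x' where x': "x' \<in> X'" "D' = {orbit f' x', b' ` orbit f' x'}" using D by (auto simp: F'.pairs_def)
    have kernel: "F.walk x p = F.walk x q \<longleftrightarrow> F'.walk x' p = F'.walk x' q" for p q
    proof (cases "b ` orbit f x = orbit f x")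
      case True
      then have "b' ` orbit f' x' = orbit f' x'" "card (orbit f x) = card (orbit f' x')"
        using D(3) x x' by (auto simp: card_insert_if split: if_splits)
      then show ?thesis
        using F.walk_eq_stable[OF x(1) True] F'.walk_eq_stable[OF x'(1)] by (cases p; cases q) simp
    next
      case False
      then have m: "b' ` orbit f' x' \<noteq> orbit f' x'"
        using D(3) x x' by (auto simp: card_insert_if split: if_splits)
      have "D \<in> F.moved_pairs" "D' \<in> F'.moved_pairs"
        using x x' m False by (auto simp: F.moved_pairs_def F.moved_def F'.moved_pairs_def F'.moved_def)
      then have "card (orbit f x) = card (orbit f' x')"
        using F.moved_pair_card(2)[of D "orbit f x"] F'.moved_pair_card(2)[of D' "orbit f' x'"] D(3) x x' by simp
      then show ?thesis
        using F.walk_eq_moved[OF x(1) False] F'.walk_eq_moved[OF x'(1) m] by (cases p; cases q) simp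
    qed
    obtain h where h: "bij_betw h (range (F.walk x)) (range (F'.walk x'))" "\<And>p. h (F.walk x p) = F'.walk x' p"
      using bij_betw_same_kernel[of "F.walk x" "F'.walk x'", OF kernel] by blast
    have D_eq: "\<Union>D = range (F.walk x)" "\<Union>D' = range (F'.walk x')"
      using F.range_walk[OF x(1)] F'.range_walk[OF x'(1)] x(2) x'(2) by simp_all
    have "h (f y) = f' (h y)" "h (b y) = b' (h y)" if y: "y \<in> \<Union>D" for y
    proof -
      obtain i s where "y = F.walk x (i, s)" using y unfolding D_eq by (metis imageE prod.exhaust)
      then show "h (f y) = f' (h y)" "h (b y) = b' (h y)"
        using h(2) x(1) x'(1) by (simp_all add: F.f_walk F'.f_walk F.b_walk F'.b_walk)
    qed
    then show "\<exists>h. bij_betw h (\<Union>D) (\<Union>D') \<and> (\<forall>(g, g')\<in>{(f, f'), (b, b')}. \<forall>x\<in>\<Union>D. h (g x) = g' (h x))"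
      using h(1) unfolding D_eq by (intro exI[of _ h]) auto
  qed simp_all
  then show ?thesis unfolding F.Union_blocks F'.Union_blocks by auto
qed

section \<open>The groups and their conjugacy classes\<close>

lemma bij_betweenE:
  assumes "bij_between X X f"
  obtains g where "f = map_on g X" "bij_betw g X X"
  using assms bij_betwD_the[OF assms] map_on_the[of f X] by (metis bij_between_def)

lemma group_of_partial_bijections:
  assumes S: "\<And>f. f \<in> S \<Longrightarrow> bij_between X X f" and one: "partial_id X \<in> S"
    and comp: "\<And>f g. f \<in> S \<Longrightarrow> g \<in> S \<Longrightarrow> f \<circ>\<^sub>m g \<in> S"
    and inv: "\<And>g. bij_betw g X X \<Longrightarrow> map_on g X \<in> S \<Longrightarrow> map_on (inv_into X g) X \<in> S"
  shows "group \<lparr>carrier = S, monoid.mult = (\<circ>\<^sub>m), one = partial_id X\<rparr>"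
proof (rule groupI)
  let ?G = "\<lparr>carrier = S, monoid.mult = (\<circ>\<^sub>m), one = partial_id X\<rparr>"
  fix f assume f: "f \<in> carrier ?G"
  obtain g where g: "f = map_on g X" "bij_betw g X X" using f by (auto elim: bij_betweenE[OF S])
  have "map_on (inv_into X g) X \<circ>\<^sub>m f = map_on (\<lambda>x. inv_into X g (g x)) X"
    unfolding g(1) using g(2) by (intro map_on_comp) (auto simp: bij_betw_def)
  also have "\<dots> = partial_id X"
    unfolding partial_id_eq_map_on using g(2) by (intro map_on_cong) (simp add: bij_betw_inv_into_left)
  finally show "\<exists>y\<in>carrier ?G. y \<otimes>\<^bsub>?G\<^esub> f = \<one>\<^bsub>?G\<^esub>" using inv[OF g(2)] f g(1) by auto
  have "ran f \<subseteq> X" using S f by (auto simp: bij_between_def)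
  then show "\<one>\<^bsub>?G\<^esub> \<otimes>\<^bsub>?G\<^esub> f = f" by (simp add: partial_id_comp)
next
  let ?G = "\<lparr>carrier = S, monoid.mult = (\<circ>\<^sub>m), one = partial_id X\<rparr>"
  fix f g h
  show "f \<otimes>\<^bsub>?G\<^esub> g \<otimes>\<^bsub>?G\<^esub> h = f \<otimes>\<^bsub>?G\<^esub> (g \<otimes>\<^bsub>?G\<^esub> h)"
    by (auto simp: map_comp_def fun_eq_iff split: option.splits)
qed (use one comp in simp_all)

lemma bij_between_comp:
  assumes "bij_between X X f" "bij_between X X g"
  shows "bij_between X X (f \<circ>\<^sub>m g)"
proof -
  obtain f' g' where f: "f = map_on f' X" "bij_betw f' X X" and g: "g = map_on g' X" "bij_betw g' X X"
    using assms by (meson bij_betweenE)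
  have "f \<circ>\<^sub>m g = map_on (\<lambda>x. f' (g' x)) X"
    unfolding f(1) g(1) using g(2) by (intro map_on_comp) (auto simp: bij_betw_def)
  then show ?thesis
    using bij_betw_trans[OF g(2) f(2)] by (simp add: bij_between_map_on o_def)
qed

lemma finite_bij_between: "finite X \<Longrightarrow> finite {f. bij_between X X f}"
  using finite_set_of_finite_maps[of X X] by (rule finite_subset[rotated]) (auto simp: bij_between_def)

lemma group_We: "group (We t)" and finite_We: "finite (carrier (We t))"
proof -
  show "group (We t)"
    unfolding We_def idem_e_def
  proof (rule group_of_partial_bijections)
    show "partial_id {1..t} \<in> Collect (bij_between {1..t} {1..t})"
      by (simp add: partial_id_eq_map_on bij_between_map_on bij_betw_def)
  qed (auto simp: bij_between_comp bij_between_map_on intro: bij_betw_inv_into)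
  show "finite (carrier (We t))" using finite_bij_between[of "{1..t}"] by (simp add: We_def)
qed

lemma map_image_map_on: "K \<subseteq> X \<Longrightarrow> map_image (map_on g X) K = g ` K"
  by (auto simp: map_image_def map_on_def split: if_splits)

text \<open>
  If \<open>g\<close> preserves admissibility, let \<open>j\<close> be the preimage of \<open>bar n (g i)\<close>. Were \<open>j\<close> different from
  \<open>bar n i\<close>, then \<open>{i, j}\<close> would be admissible while its image \<open>{g i, bar n (g i)}\<close> is admissible only if it is all of
  \<open>ground n\<close>, which is too large to have only these two elements.
\<close>

lemma symplectic_bij_map_on_iff:
  "symplectic_bij n (map_on g (ground n))
    \<longleftrightarrow> bij_betw g (ground n) (ground n) \<and> (\<forall>i\<in>ground n. g (bar n i) = bar n (g i))"
  (is "?L \<longleftrightarrow> ?R")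
proof
  assume L: ?L
  then have bij: "bij_betw g (ground n) (ground n)"
    and adm: "\<And>P. admissible n P \<Longrightarrow> admissible n (map_image (map_on g (ground n)) P)"
    by (auto simp: symplectic_bij_def bij_between_map_on)
  have "g (bar n i) = bar n (g i)" if i: "i \<in> ground n" for i
  proof -
    have "bar n (g i) \<in> ground n" using bij i by (auto simp: bij_betw_def intro: bar_in_ground)
    then obtain j where j: "j \<in> ground n" "g j = bar n (g i)"
      using bij by (metis bij_betw_def imageE)
    have "j \<noteq> i" using j(2) bar_neq by metis
    have "j = bar n i"
    proof (rule ccontr)
      assume ne: "j \<noteq> bar n i"
      then have ne': "bar n j \<noteq> i" using bar_bar[OF j(1)] by auto
      have "admissible n {i, j}"
        using i j ne ne' bar_neq by (auto simp: admissible_def)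
      from adm[OF this] have "admissible n {g i, bar n (g i)}"
        using i j by (simp add: map_image_map_on)
      then have "ground n = {g i, bar n (g i)}" by (auto simp: admissible_def)
      then have "card (ground n) \<le> 2" using card_insert_le_m1[of 2 "{bar n (g i)}" "g i"] by simp
      moreover have "card {i, bar n i, j} \<le> card (ground n)"
        using i j bar_in_ground[OF i] by (intro card_mono) auto
      moreover have "card {i, bar n i, j} = 3" using \<open>j \<noteq> i\<close> ne bar_neq[of n i] by auto
      ultimately show False by simp
    qed
    then show ?thesis using j(2) by simp
  qed
  with bij show ?R by blast
next
  assume R: ?R
  have "admissible n (g ` P)" if P: "admissible n P" for P
  proof (cases "P = ground n")
    case True
    then show ?thesis using R by (simp add: bij_betw_def admissible_def)
  next
    case False
    then have P: "P \<subseteq> ground n" "\<And>i. i \<in> P \<Longrightarrow> bar n i \<notin> P" using P by (auto simp: admissible_def)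
    have inj: "inj_on g (ground n)" and img: "g ` ground n = ground n" using R by (auto simp: bij_betw_def)
    have "bar n (g i) \<notin> g ` P" if i: "i \<in> P" for i
    proof
      assume "bar n (g i) \<in> g ` P"
      then obtain j where j: "j \<in> P" "g j = g (bar n i)" using R P i by auto
      have "j = bar n i" using inj_onD[OF inj j(2)] P(1) i j bar_in_ground by blast
      then show False using P(2) i j by blast
    qed
    moreover have "g ` P \<subseteq> ground n" using P(1) img by blast
    ultimately show ?thesis by (auto simp: admissible_def)
  qed
  moreover have "P \<subseteq> ground n" if "admissible n P" for P using that by (simp add: admissible_def)
  ultimately show ?L using R by (simp add: symplectic_bij_def bij_between_map_on map_image_map_on)
qed

lemma symplectic_bijE:
  assumes "symplectic_bij n f"
  obtains g where "f = map_on g (ground n)" "bij_betw g (ground n) (ground n)"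
    "\<And>i. i \<in> ground n \<Longrightarrow> g (bar n i) = bar n (g i)"
proof -
  obtain g where g: "f = map_on g (ground n)"
    using assms by (auto simp: symplectic_bij_def elim: bij_betweenE)
  with assms that show ?thesis by (metis symplectic_bij_map_on_iff)
qed

lemma group_WSp: "group (WSp n)" and finite_WSp: "finite (carrier (WSp n))"
proof -
  show "group (WSp n)"
    unfolding WSp_def
  proof (rule group_of_partial_bijections)
    show "partial_id (ground n) \<in> Collect (symplectic_bij n)"
      unfolding partial_id_eq_map_on by (simp add: symplectic_bij_map_on_iff bij_betw_def)
    fix f g assume "f \<in> Collect (symplectic_bij n)" "g \<in> Collect (symplectic_bij n)"
    then obtain f' g' where f: "f = map_on f' (ground n)" "bij_betw f' (ground n) (ground n)"
      "\<And>i. i \<in> ground n \<Longrightarrow> f' (bar n i) = bar n (f' i)"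
      and g: "g = map_on g' (ground n)" "bij_betw g' (ground n) (ground n)"
      "\<And>i. i \<in> ground n \<Longrightarrow> g' (bar n i) = bar n (g' i)"
      by (metis mem_Collect_eq symplectic_bijE)
    have "f \<circ>\<^sub>m g = map_on (\<lambda>x. f' (g' x)) (ground n)"
      unfolding f(1) g(1) using g(2) by (intro map_on_comp) (auto simp: bij_betw_def)
    moreover have "g' i \<in> ground n" if "i \<in> ground n" for i using g(2) that by (auto simp: bij_betw_def)
    ultimately show "f \<circ>\<^sub>m g \<in> Collect (symplectic_bij n)"
      using bij_betw_trans[OF g(2) f(2)] f(3) g(3) by (simp add: symplectic_bij_map_on_iff o_def)
  next
    fix g assume g: "bij_betw g (ground n) (ground n)" "map_on g (ground n) \<in> Collect (symplectic_bij n)"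
    have bar: "g (bar n i) = bar n (g i)" if "i \<in> ground n" for i
      using g(2) that by (simp add: symplectic_bij_map_on_iff)
    have "inv_into (ground n) g (bar n i) = bar n (inv_into (ground n) g i)" if i: "i \<in> ground n" for i
    proof -
      define j where "j = inv_into (ground n) g i"
      have j: "j \<in> ground n" "g j = i"
        using bij_betw_inv_into[OF g(1)] bij_betw_inv_into_right[OF g(1) i] i by (auto simp: j_def bij_betw_def)
      then have "inv_into (ground n) g (g (bar n j)) = bar n j"
        by (intro bij_betw_inv_into_left[OF g(1)] bar_in_ground)
      then show ?thesis using j bar[OF j(1)] by (simp add: j_def)
    qed
    then show "map_on (inv_into (ground n) g) (ground n) \<in> Collect (symplectic_bij n)"
      using bij_betw_inv_into[OF g(1)] by (simp add: symplectic_bij_map_on_iff)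
  qed (auto simp: symplectic_bij_def)
  show "finite (carrier (WSp n))"
    by (rule finite_subset[OF _ finite_bij_between[OF finite_ground[of n]]])
      (auto simp: WSp_def symplectic_bij_def)
qed

lemma irr_char_conjugate:
  fixes G (structure)
  assumes grp: "group G" and \<phi>: "\<phi> \<in> irr_chars G" and c: "v \<in> carrier G" "w \<in> carrier G" "h \<in> carrier G"
    and conj: "h \<otimes> v = w \<otimes> h"
  shows "\<phi> v = \<phi> w"
proof -
  interpret group G by fact
  obtain d \<rho> where irr: "is_irr_rep G d \<rho>" and \<phi>: "\<phi> = rep_char G \<rho>"
    using \<phi> by (auto simp: irr_chars_def)
  note \<rho> = is_irr_repD(3)[OF irr] and mult = is_irr_repD(4)[OF irr]
  have "v = inv h \<otimes> (w \<otimes> h)" using c conj by (metis inv_closed inv_solve_left' m_closed)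
  then have "mtrace (\<rho> v) = mtrace (\<rho> (inv h) * \<rho> (w \<otimes> h))" using c by (simp add: mult)
  also have "\<dots> = mtrace (\<rho> (w \<otimes> h) * \<rho> (inv h))"
    using c by (intro mtrace_mult_commute[OF \<rho> \<rho>]) simp_all
  also have "\<rho> (w \<otimes> h) * \<rho> (inv h) = \<rho> (w \<otimes> h \<otimes> inv h)" using c by (intro mult[symmetric]) simp_all
  also have "w \<otimes> h \<otimes> inv h = w" using c by (simp add: m_assoc)
  finally show ?thesis using c by (simp add: \<phi> rep_char_def)
qed

text \<open>
  A relation between the columns of the table is a relation between the irreducible characters on the
  representatives, hence on the whole group, since characters are constant on conjugacy classes.
\<close>

lemma character_table_rows_independent:
  fixes r :: "'i \<Rightarrow> 'g" and chi :: "'i \<Rightarrow> 'g \<Rightarrow> complex"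
  assumes grp: "group G" "finite (carrier G)" and I: "finite I"
    and chars: "bij_betw chi I (irr_chars G)"
    and reps: "\<And>i. i \<in> I \<Longrightarrow> r i \<in> carrier G"
      "\<And>w. w \<in> carrier G \<Longrightarrow> \<exists>i\<in>I. \<exists>h\<in>carrier G. h \<otimes>\<^bsub>G\<^esub> w = r i \<otimes>\<^bsub>G\<^esub> h"
    and rows: "\<And>j. j \<in> I \<Longrightarrow> (\<Sum>i\<in>I. b i * chi j (r i)) = 0"
    and i: "i \<in> I"
  shows "b i = 0"
proof (rule square_system_transpose[OF I I refl _ rows i])
  fix a :: "'i \<Rightarrow> complex"
  assume cols: "\<And>i. i \<in> I \<Longrightarrow> (\<Sum>j\<in>I. chi j (r i) * a j) = 0"
  \<comment> \<open>The coefficients, indexed by the characters themselves.\<close>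
  define a' where "a' = (\<lambda>\<phi>. a (inv_into I chi \<phi>))"
  have a': "a' (chi j) = a j" if "j \<in> I" for j
    using chars that by (simp add: a'_def bij_betw_inv_into_left)
  have "a' (chi j) = 0" if j: "j \<in> I" for j
  proof (rule irr_chars_linearly_independent[OF grp, where F = "irr_chars G" and a = a'])
    show "finite (irr_chars G)" "irr_chars G \<subseteq> irr_chars G"
      using chars I bij_betw_finite by auto
    show "chi j \<in> irr_chars G" using chars j by (auto simp: bij_betw_def)
    fix w assume w: "w \<in> carrier G"
    then obtain i h where i: "i \<in> I" "h \<in> carrier G" "h \<otimes>\<^bsub>G\<^esub> w = r i \<otimes>\<^bsub>G\<^esub> h" using reps(2) by blast
    have "chi j w = chi j (r i)" if "j \<in> I" for j
      using irr_char_conjugate[OF grp(1) _ w reps(1)[OF i(1)] i(2,3)] chars that by (auto simp: bij_betw_def)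
    then have "(\<Sum>j\<in>I. a' (chi j) * chi j w) = (\<Sum>j\<in>I. chi j (r i) * a j)"
      using a' by (intro sum.cong) (simp_all add: mult.commute)
    also have "\<dots> = 0" by (rule cols[OF i(1)])
    finally show "(\<Sum>\<phi>\<in>irr_chars G. a' \<phi> * \<phi> w) = 0"
      using sum.reindex_bij_betw[OF chars, of "\<lambda>\<phi>. a' \<phi> * \<phi> w"] by simp
  qed
  then show "\<forall>j\<in>I. a j = 0" using a' by simp
qed

lemma finite_Part: "finite (Part t)"
proof (induction t rule: less_induct)
  case (less t)
  have "Part t \<subseteq> insert {#} (\<Union>a\<in>{1..t}. add_mset a ` Part (t - a))"
  proof
    fix \<mu> assume \<mu>: "\<mu> \<in> Part t"
    show "\<mu> \<in> insert {#} (\<Union>a\<in>{1..t}. add_mset a ` Part (t - a))"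
    proof (cases \<mu>)
      case (add a \<nu>)
      then have "a \<in> {1..t}" "\<nu> \<in> Part (t - a)" using \<mu> by (auto simp: Part_def)
      then show ?thesis using add by blast
    qed simp
  qed
  moreover have "finite (\<Union>a\<in>{1..t}. add_mset a ` Part (t - a))"
    using less by auto
  ultimately show ?case using finite_subset by blast
qed

lemma finite_SPart: "finite (SPart n)"
proof (rule finite_subset)
  show "SPart n \<subseteq> (\<Union>i\<in>{..n}. Part i) \<times> (\<Union>i\<in>{..n}. Part i)"
    by (auto simp: SPart_def Part_def)
qed (auto simp: finite_Part)

lemma (in finite_perm) cycle_type_in_Part: "image_mset card (mset_set cycles) \<in> Part (card X)"
proof -
  have "sum_mset (image_mset card (mset_set cycles)) = (\<Sum>C\<in>cycles. card C)"
    by (simp add: sum_unfold_sum_mset)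
  also have "\<dots> = card X" using sum_card_cycles[of cycles] Union_cycles by simp
  finally show ?thesis using cycle_card_pos by (fastforce simp: Part_def)
qed

lemma finite_perm_We: "w \<in> carrier (We t) \<Longrightarrow> finite_perm {1..t} (\<lambda>x. the (w x))"
  by (auto simp: We_def intro!: finite_perm.intro bij_betwD_the)

lemma class_rep_Inr:
  "class_rep n (Inr \<mu>) w \<longleftrightarrow> w \<in> carrier (We (sum_mset \<mu>))
    \<and> image_mset card (mset_set (orbit (\<lambda>x. the (w x)) ` {1..sum_mset \<mu>})) = \<mu>"
  by (simp add: cycle_lengths_def cycles_on_def)

text \<open>
  The bijection from \<open>{1..t}\<close> to an invariant set \<open>K\<close> that the trace formula needs.
\<close>

lemma conjugate_to_class_rep:
  assumes K: "finite_perm K g" and rep: "class_rep n (Inr \<mu>) w"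
    and type: "image_mset card (mset_set (orbit g ` K)) = \<mu>"
  shows "\<exists>h. bij_betw h {1..card K} K \<and> (\<forall>i\<in>{1..card K}. g (h i) = h (the (w i)))"
proof -
  have t: "sum_mset \<mu> = card K" using finite_perm.cycle_type_in_Part[OF K] type by (simp add: Part_def)
  have w: "w \<in> carrier (We (card K))" "image_mset card (mset_set (orbit (\<lambda>x. the (w x)) ` {1..card K})) = \<mu>"
    using rep unfolding class_rep_Inr t by auto
  show ?thesis
    using conjugate_if_same_cycle_type[OF finite_perm_We[OF w(1)] K] w(2) type by metis
qed

lemma We_conjugate_to_rep:
  assumes w: "w \<in> carrier (We t)" and rep: "\<And>\<mu>. \<mu> \<in> Part t \<Longrightarrow> class_rep n (Inr \<mu>) (r \<mu>)"
  shows "\<exists>\<mu>\<in>Part t. \<exists>h\<in>carrier (We t). h \<otimes>\<^bsub>We t\<^esub> w = r \<mu> \<otimes>\<^bsub>We t\<^esub> h"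
proof -
  define f where "f = (\<lambda>x. the (w x))"
  have f: "finite_perm {1..t} f" using finite_perm_We[OF w] by (simp add: f_def)
  define \<mu> where "\<mu> = image_mset card (mset_set (orbit f ` {1..t}))"
  have \<mu>: "\<mu> \<in> Part t" using finite_perm.cycle_type_in_Part[OF f] by (simp add: \<mu>_def)
  define v where "v = (\<lambda>x. the (r \<mu> x))"
  have r: "r \<mu> \<in> carrier (We t)" "image_mset card (mset_set (orbit v ` {1..t})) = \<mu>"
    using rep[OF \<mu>] \<mu> unfolding class_rep_Inr by (auto simp: Part_def v_def)
  have v: "finite_perm {1..t} v" using finite_perm_We[OF r(1)] by (simp add: v_def)
  obtain h where h: "bij_betw h {1..t} {1..t}" "\<And>x. x \<in> {1..t} \<Longrightarrow> h (f x) = v (h x)"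
    using conjugate_if_same_cycle_type[OF f v] r(2) by (auto simp: \<mu>_def)
  have wf: "w = map_on f {1..t}" and rv: "r \<mu> = map_on v {1..t}"
    using w r(1) by (auto simp: We_def bij_between_def f_def v_def map_on_the)
  have "map_on h {1..t} \<circ>\<^sub>m w = map_on (\<lambda>x. h (f x)) {1..t}"
    unfolding wf using finite_perm.f_in[OF f] by (intro map_on_comp) auto
  also have "\<dots> = map_on (\<lambda>x. v (h x)) {1..t}" by (rule map_on_cong) (rule h(2))
  also have "\<dots> = r \<mu> \<circ>\<^sub>m map_on h {1..t}"
    unfolding rv using h(1) by (intro map_on_comp[symmetric]) (auto simp: bij_betw_def)
  finally have "map_on h {1..t} \<otimes>\<^bsub>We t\<^esub> w = r \<mu> \<otimes>\<^bsub>We t\<^esub> map_on h {1..t}" by (simp add: We_def)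
  moreover have "map_on h {1..t} \<in> carrier (We t)" using h(1) by (simp add: We_def bij_between_map_on)
  ultimately show ?thesis using \<mu> by blast
qed

lemma signed_perm_ground:
  assumes "bij_betw g (ground n) (ground n)" "\<And>i. i \<in> ground n \<Longrightarrow> g (bar n i) = bar n (g i)"
  shows "signed_perm (ground n) g (bar n)"
  using assms by unfold_locales (auto simp: bar_in_ground bar_bar bar_neq)

lemma signed_perm_WSp:
  assumes "w \<in> carrier (WSp n)"
  shows "signed_perm (ground n) (\<lambda>x. the (w x)) (bar n)"
proof -
  obtain g where g: "w = map_on g (ground n)" "bij_betw g (ground n) (ground n)"
    "\<And>i. i \<in> ground n \<Longrightarrow> g (bar n i) = bar n (g i)"
    using assms by (auto simp: WSp_def elim: symplectic_bijE)
  have the: "the (w x) = g x" if "x \<in> ground n" for x using that by (simp add: g(1) map_on_def)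
  show ?thesis
  proof (rule signed_perm_ground)
    show "bij_betw (\<lambda>x. the (w x)) (ground n) (ground n)"
      using g(2) the by (subst bij_betw_cong[where g = g]) auto
  qed (simp add: the bar_in_ground g(3))
qed

lemma class_rep_Inl:
  assumes "w \<in> carrier (WSp n)"
  shows "class_rep n (Inl (\<gamma>, \<delta>)) w
    \<longleftrightarrow> image_mset card (mset_set (signed_perm.moved (ground n) (\<lambda>x. the (w x)) (bar n))) = \<gamma> + \<gamma>
      \<and> image_mset card (mset_set (signed_perm.stable (ground n) (\<lambda>x. the (w x)) (bar n))) = image_mset (\<lambda>a. 2 * a) \<delta>"
  using assms signed_perm.moved_def[OF signed_perm_WSp[OF assms]] signed_perm.stable_def[OF signed_perm_WSp[OF assms]]
  by (simp add: cycle_lengths_def cycles_on_def)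

text \<open>
  The isomorphism of signed permutations commutes with the bar, which is what makes it an element of \<open>WSp n\<close>.
\<close>

lemma WSp_conjugate_to_rep:
  assumes w: "w \<in> carrier (WSp n)" and rep: "\<And>\<alpha>. \<alpha> \<in> SPart n \<Longrightarrow> class_rep n (Inl \<alpha>) (r \<alpha>)"
  shows "\<exists>\<alpha>\<in>SPart n. \<exists>h\<in>carrier (WSp n). h \<otimes>\<^bsub>WSp n\<^esub> w = r \<alpha> \<otimes>\<^bsub>WSp n\<^esub> h"
proof -
  let ?X = "ground n"
  define f where "f = (\<lambda>x. the (w x))"
  interpret F: signed_perm ?X f "bar n" unfolding f_def by (rule signed_perm_WSp[OF w])
  obtain \<gamma> \<delta> where type: "0 \<notin># \<gamma>" "0 \<notin># \<delta>" "2 * (sum_mset \<gamma> + sum_mset \<delta>) = card ?X"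
    "image_mset card (mset_set F.moved) = \<gamma> + \<gamma>" "image_mset card (mset_set F.stable) = image_mset (\<lambda>a. 2 * a) \<delta>"
    using F.class_type_exists by blast
  have "sum_mset \<gamma> + sum_mset \<delta> = n" using type(3) unfolding card_ground by (metis nat_mult_eq_cancel1 zero_less_numeral)
  then have \<alpha>: "(\<gamma>, \<delta>) \<in> SPart n" using type(1,2) by (simp add: SPart_def)
  define v where "v = (\<lambda>x. the (r (\<gamma>, \<delta>) x))"
  have rW: "r (\<gamma>, \<delta>) \<in> carrier (WSp n)" using rep[OF \<alpha>] by simp
  interpret V: signed_perm ?X v "bar n" unfolding v_def by (rule signed_perm_WSp[OF rW])
  have "image_mset card (mset_set V.moved) = \<gamma> + \<gamma>" "image_mset card (mset_set V.stable) = image_mset (\<lambda>a. 2 * a) \<delta>"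
    using rep[OF \<alpha>] unfolding class_rep_Inl[OF rW] by (auto simp: v_def)
  then obtain h where h: "bij_betw h ?X ?X" "\<forall>x\<in>?X. h (f x) = v (h x)" "\<forall>x\<in>?X. h (bar n x) = bar n (h x)"
    using conjugate_if_same_signed_cycle_type[OF F.signed_perm_axioms V.signed_perm_axioms] type by auto
  have wf: "w = map_on f ?X" and rv: "r (\<gamma>, \<delta>) = map_on v ?X"
    using w rW by (auto simp: WSp_def symplectic_bij_def bij_between_def f_def v_def map_on_the)
  have "map_on h ?X \<circ>\<^sub>m w = map_on (\<lambda>x. h (f x)) ?X"
    unfolding wf using F.f_in by (intro map_on_comp) auto
  also have "\<dots> = map_on (\<lambda>x. v (h x)) ?X" using h(2) by (intro map_on_cong) simp
  also have "\<dots> = r (\<gamma>, \<delta>) \<circ>\<^sub>m map_on h ?X"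
    unfolding rv using h(1) by (intro map_on_comp[symmetric]) (auto simp: bij_betw_def)
  finally have "map_on h ?X \<otimes>\<^bsub>WSp n\<^esub> w = r (\<gamma>, \<delta>) \<otimes>\<^bsub>WSp n\<^esub> map_on h ?X" by (simp add: WSp_def)
  moreover have "map_on h ?X \<in> carrier (WSp n)" using h(1,3) by (simp add: WSp_def symplectic_bij_map_on_iff)
  ultimately show ?thesis using \<alpha> by blast
qed

section \<open>Character values and the A-matrix\<close>

lemma WSp_symplectic: "w \<in> carrier (WSp n) \<Longrightarrow> symplectic_inj n w"
  by (simp add: WSp_def symplectic_inj_def)

lemma idem_e_ne_one: "n \<ge> 1 \<Longrightarrow> s \<le> n \<Longrightarrow> idem_e s \<noteq> partial_id (ground n)"
proof
  assume n: "n \<ge> 1" "s \<le> n" and "idem_e s = partial_id (ground n)"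
  then have "{1..s} = ground n" by (metis dom_partial_id idem_e_def)
  then have "card {1..s} = 2 * n" by (simp add: card_ground)
  then show False using n by simp
qed

text \<open>
  The identity is not below any \<open>idem_e t\<close>, so with apex \<open>1\<close> all of them act as \<open>0\<close>; and \<open>w = w e\<close> with \<open>e = idem_e t\<close>
  for \<open>w\<close> in \<open>We t\<close>.
\<close>

lemma top_apex_values:
  assumes n: "n \<ge> 1" and aff: "affords_irr n (Inl \<alpha>) \<phi> \<psi>"
  shows "w \<in> carrier (WSp n) \<Longrightarrow> \<psi> w = \<phi> w"
    and "t \<le> n \<Longrightarrow> w \<in> carrier (We t) \<Longrightarrow> \<psi> w = 0"
proof -
  let ?one = "partial_id (ground n)"
  obtain d \<rho> where irr: "is_irr_rep (RSp n) d \<rho>" and \<psi>: "\<And>g. symplectic_inj n g \<Longrightarrow> \<psi> g = mtrace (\<rho> g)"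
    and apex: "\<And>f. f \<in> cross_section n \<Longrightarrow> \<rho> f \<noteq> 0\<^sub>m d d \<Longrightarrow> idem_le ?one f"
    and act: "acts_on_image_with_char (WSp n) d \<rho> ?one \<phi>"
    using aff unfolding affords_irr_def by auto
  have one: "\<rho> ?one = 1\<^sub>m d" using is_irr_repD(2)[OF irr] by simp
  show "\<psi> w = \<phi> w" if w: "w \<in> carrier (WSp n)"
  proof -
    note s = WSp_symplectic[OF w]
    have "\<rho> w \<in> carrier_mat d d" using is_irr_repD(3)[OF irr] s by simp
    then have "mtrace (\<rho> w) = \<phi> w"
      by (intro trace_eq_image_char[OF act w]) (simp_all add: one)
    then show ?thesis using \<psi>[OF s] by simp
  qed
  show "\<psi> w = 0" if t: "t \<le> n" and w: "w \<in> carrier (We t)"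
  proof -
    have e: "symplectic_inj n (idem_e t)"
      unfolding idem_e_def by (rule symplectic_inj_partial_id[OF n proper_admissible_initial[OF t]])
    have s: "symplectic_inj n w" by (rule We_symplectic_inj[OF n t w])
    have "{1..t} \<subseteq> ground n" using proper_admissible_initial[OF t] by (simp add: proper_admissible_def)
    then have "?one \<circ>\<^sub>m idem_e t = idem_e t" unfolding idem_e_def by (intro partial_id_comp) simp
    then have "\<not> idem_le ?one (idem_e t)"
      using idem_e_ne_one[OF n t] by (simp add: idem_le_def)
    then have zero: "\<rho> (idem_e t) = 0\<^sub>m d d"
      using apex[of "idem_e t"] t by (auto simp: cross_section_def)
    have "w \<circ>\<^sub>m idem_e t = w"
      using w by (simp add: idem_e_def comp_partial_id restrict_dom_subset We_def bij_between_def)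
    then have "\<rho> w = \<rho> w * \<rho> (idem_e t)" using is_irr_repD(4)[OF irr, of w "idem_e t"] s e by simp
    also have "\<dots> = 0\<^sub>m d d"
      unfolding zero using is_irr_repD(3)[OF irr, of w] s by (intro right_mult_zero_mat) simp
    finally show ?thesis using \<psi>[OF s] by (simp add: mtrace_def)
  qed
qed

definition invariant_sets :: "nat \<Rightarrow> (nat \<rightharpoonup> nat) \<Rightarrow> nat multiset \<Rightarrow> nat set set" where
  "invariant_sets n g \<beta> = {K. proper_admissible n K \<and> K \<subseteq> dom g \<and> map_image g K = K
     \<and> image_mset card (mset_set (orbit (\<lambda>x. the (g x)) ` K)) = \<beta>}"

lemma map_image_the: "K \<subseteq> dom g \<Longrightarrow> map_image g K = (\<lambda>x. the (g x)) ` K"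
  by (force simp: map_image_def dom_def)

lemma finite_perm_invariant_set:
  assumes g: "inj_on g (dom g)" and K: "finite K" "K \<subseteq> dom g" "map_image g K = K"
  shows "finite_perm K (\<lambda>x. the (g x))"
proof
  have "inj_on (\<lambda>x. the (g x)) (dom g)"
    using bij_betwD_the[of "dom g" "ran g" g] g by (simp add: bij_between_def bij_betw_def)
  then show "bij_betw (\<lambda>x. the (g x)) K K"
    using K by (auto simp: bij_betw_def map_image_the intro: inj_on_subset)
qed fact

text \<open>
  The trace formula, with the invariant sets grouped by the cycle type of \<open>g\<close> on them. The size of an invariant
  set is the sum of its cycle type, so \<open>\<beta> \<in> Part t\<close> implies \<open>card K = t\<close>.
\<close>

lemma lower_apex_values:
  assumes n: "n \<ge> 1" and t: "t \<le> n" and \<mu>: "\<mu> \<in> Part t" and aff: "affords_irr n (Inr \<mu>) \<phi> \<psi>"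
    and rep: "\<And>\<beta>. \<beta> \<in> Part t \<Longrightarrow> class_rep n (Inr \<beta>) (r \<beta>)"
    and g: "symplectic_inj n g"
  shows "\<psi> g = (\<Sum>\<beta>\<in>Part t. of_nat (card (invariant_sets n g \<beta>)) * \<phi> (r \<beta>))"
proof -
  have \<mu>t: "sum_mset \<mu> = t" using \<mu> by (simp add: Part_def)
  obtain d \<rho> where irr: "is_irr_rep (RSp n) d \<rho>" and \<psi>: "\<And>g. symplectic_inj n g \<Longrightarrow> \<psi> g = mtrace (\<rho> g)"
    and nz: "\<rho> (idem_e t) \<noteq> 0\<^sub>m d d"
    and apex: "\<And>f. f \<in> cross_section n \<Longrightarrow> \<rho> f \<noteq> 0\<^sub>m d d \<Longrightarrow> idem_le (idem_e t) f"
    and act: "acts_on_image_with_char (We t) d \<rho> (idem_e t) \<phi>"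
    using aff unfolding affords_irr_def by (auto simp: \<mu>t)
  have below: "\<rho> (idem_e s) = 0\<^sub>m d d" if s: "s < t" for s
  proof (rule ccontr)
    assume "\<rho> (idem_e s) \<noteq> 0\<^sub>m d d"
    moreover have "idem_e s \<in> cross_section n" using s t by (auto simp: cross_section_def)
    ultimately have "idem_le (idem_e t) (idem_e s)" by (intro apex)
    then have "partial_id ({1..t} \<inter> {1..s}) = partial_id {1..t}"
      by (simp add: idem_le_def idem_e_def comp_partial_id restrict_partial_id)
    then have "{1..t} \<inter> {1..s} = {1..t}" by (metis dom_partial_id)
    moreover have "t \<in> {1..t}" "t \<notin> {1..s}" using s by auto
    ultimately show False by blast
  qed
  interpret apex_rep n t d \<rho>
    using n t irr nz below by unfold_locales
  let ?f = "\<lambda>x. the (g x)"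
  define ty where "ty K = image_mset card (mset_set (orbit ?f ` K))" for K
  define F where "F = {K. proper_admissible n K \<and> card K = t \<and> K \<subseteq> dom g \<and> map_image g K = K}"
  have perm: "finite_perm K ?f" if "proper_admissible n K" "K \<subseteq> dom g" "map_image g K = K" for K
    using finite_perm_invariant_set[OF symplectic_injD(2)[OF n g] proper_admissible_finite] that by blast
  have tyF: "ty K \<in> Part (card K)" if "proper_admissible n K" "K \<subseteq> dom g" "map_image g K = K" for K
    using finite_perm.cycle_type_in_Part[OF perm[OF that]] by (simp add: ty_def)
  have "\<psi> g = (\<Sum>K\<in>F. \<phi> (r (ty K)))"
    unfolding \<psi>[OF g] F_def
  proof (rule trace_eq_sum[OF g act])
    fix K assume K: "proper_admissible n K" "card K = t" "K \<subseteq> dom g" "map_image g K = K"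
    note p = perm[OF K(1,3,4)]
    have tyK: "ty K \<in> Part t" using tyF[OF K(1,3,4)] K(2) by simp
    have "r (ty K) \<in> carrier (We t)"
      using rep[OF tyK] tyK by (simp add: Part_def)
    moreover have "\<exists>h. bij_betw h {1..t} K \<and> (\<forall>i\<in>{1..t}. the (g (h i)) = h (the (r (ty K) i)))"
      using conjugate_to_class_rep[OF p rep[OF tyK]] K(2) by (simp add: ty_def)
    ultimately show "r (ty K) \<in> carrier (We t)
        \<and> (\<exists>h. bij_betw h {1..t} K \<and> (\<forall>i\<in>{1..t}. the (g (h i)) = h (the (r (ty K) i))))" ..
  qed
  also have "\<dots> = (\<Sum>\<beta>\<in>Part t. \<Sum>K\<in>{K \<in> F. ty K = \<beta>}. \<phi> (r (ty K)))"
  proof (rule sum.group[symmetric])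
    show "finite F" by (rule finite_subset[OF _ finite_proper_admissible[of n]]) (auto simp: F_def)
    show "ty ` F \<subseteq> Part t" using tyF by (auto simp: F_def)
  qed (rule finite_Part)
  also have "\<dots> = (\<Sum>\<beta>\<in>Part t. of_nat (card (invariant_sets n g \<beta>)) * \<phi> (r \<beta>))"
  proof (rule sum.cong[OF refl])
    fix \<beta> assume \<beta>: "\<beta> \<in> Part t"
    have "card K = t" if "proper_admissible n K" "K \<subseteq> dom g" "map_image g K = K" "ty K = \<beta>" for K
      using tyF[OF that(1-3)] that(4) \<beta> by (simp add: Part_def)
    then have "{K \<in> F. ty K = \<beta>} = invariant_sets n g \<beta>"
      unfolding F_def invariant_sets_def ty_def[symmetric] by blast
    moreover have "(\<Sum>K\<in>{K \<in> F. ty K = \<beta>}. \<phi> (r (ty K))) = (\<Sum>K\<in>{K \<in> F. ty K = \<beta>}. \<phi> (r \<beta>))"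
      by (rule sum.cong) auto
    ultimately show "(\<Sum>K\<in>{K \<in> F. ty K = \<beta>}. \<phi> (r (ty K)))
        = of_nat (card (invariant_sets n g \<beta>)) * \<phi> (r \<beta>)" by simp
  qed
  finally show ?thesis .
qed

text \<open>
  All subsets of \<open>{1..s}\<close> are proper admissible, so only invariance restricts the choice of cycles.
\<close>

lemma card_invariant_sets_We:
  assumes s: "s \<le> n" and \<alpha>: "\<alpha> \<in> Part s" and rep: "class_rep n (Inr \<alpha>) w"
  shows "card (invariant_sets n w \<beta>) = part_binom \<alpha> \<beta>"
proof -
  have w: "w \<in> carrier (We s)" "image_mset card (mset_set (orbit (\<lambda>x. the (w x)) ` {1..s})) = \<alpha>"
    using rep \<alpha> unfolding class_rep_Inr by (auto simp: Part_def)
  have dom: "dom w = {1..s}" using w(1) by (simp add: We_def bij_between_def)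
  have "invariant_sets n w \<beta> = {K. K \<subseteq> {1..s} \<and> (\<lambda>x. the (w x)) ` K = K
      \<and> image_mset card (mset_set (orbit (\<lambda>x. the (w x)) ` K)) = \<beta>}"
    unfolding invariant_sets_def dom
    using proper_admissible_subset[OF proper_admissible_initial[OF s]] map_image_the[of _ w] dom by auto
  then show ?thesis
    using finite_perm.card_invariant_sets_of_type[OF finite_perm_We[OF w(1)]] w(2) by simp
qed

lemma card_invariant_sets_WSp:
  assumes rep: "class_rep n (Inl (\<gamma>, \<delta>)) w"
  shows "card (invariant_sets n w \<beta>) = 2 ^ size \<beta> * part_binom \<gamma> \<beta>"
proof -
  have w: "w \<in> carrier (WSp n)" using rep by simp
  interpret W: signed_perm "ground n" "\<lambda>x. the (w x)" "bar n" by (rule signed_perm_WSp[OF w])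
  have dom: "dom w = ground n" using w by (simp add: WSp_def symplectic_bij_def bij_between_def)
  have "W.paired_type + W.paired_type = \<gamma> + \<gamma>"
    using rep unfolding class_rep_Inl[OF w] by (simp add: W.moved_type)
  then have half: "W.paired_type = \<gamma>"
    by (intro multiset_eqI) (metis add_self_div_2 count_union)
  have "invariant_sets n w \<beta> = {K. K \<subseteq> ground n \<and> (\<lambda>x. the (w x)) ` K = K \<and> (\<forall>x\<in>K. bar n x \<notin> K)
      \<and> image_mset card (mset_set (orbit (\<lambda>x. the (w x)) ` K)) = \<beta>}"
    unfolding invariant_sets_def dom proper_admissible_def
    using map_image_the[of _ w] dom by auto
  then show ?thesis
    using W.card_invariant_admissible_sets_of_type[of \<beta>] by (simp add: half)
qed

fun A_entry :: "pindex \<Rightarrow> pindex \<Rightarrow> complex" where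
  "A_entry (Inl \<alpha>) (Inl \<beta>) = (if \<alpha> = \<beta> then 1 else 0)"
| "A_entry (Inl \<alpha>) (Inr \<beta>) = of_nat (2 ^ size \<beta> * part_binom (fst \<alpha>) \<beta>)"
| "A_entry (Inr \<alpha>) (Inl \<beta>) = 0"
| "A_entry (Inr \<alpha>) (Inr \<beta>) = of_nat (part_binom \<alpha> \<beta>)"

lemma Qidx_Inl [simp]: "Inl \<alpha> \<in> Qidx n \<longleftrightarrow> \<alpha> \<in> SPart n"
  and Qidx_Inr [simp]: "Inr \<mu> \<in> Qidx n \<longleftrightarrow> (\<exists>t\<le>n. \<mu> \<in> Part t)"
  by (auto simp: Qidx_def)

lemma finite_Qidx: "finite (Qidx n)"
  by (simp add: Qidx_def finite_SPart finite_Part)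

lemma sum_Y_Inl:
  "(\<Sum>\<beta>\<in>Qidx n. B \<beta> * Y_mat chibar r \<beta> (Inl \<mu>)) = (\<Sum>\<beta>\<in>SPart n. B (Inl \<beta>) * chibar (Inl \<mu>) (r (Inl \<beta>)))"
proof -
  have "(\<Sum>\<beta>\<in>Qidx n. B \<beta> * Y_mat chibar r \<beta> (Inl \<mu>)) = (\<Sum>\<beta>\<in>Inl ` SPart n. B \<beta> * Y_mat chibar r \<beta> (Inl \<mu>))"
  proof (rule sum.mono_neutral_right[OF finite_Qidx])
    show "\<forall>\<beta>\<in>Qidx n - Inl ` SPart n. B \<beta> * Y_mat chibar r \<beta> (Inl \<mu>) = 0"
      by (auto simp: Qidx_def Y_mat_def)
  qed auto
  then show ?thesis by (simp add: sum.reindex Y_mat_def)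
qed

lemma sum_Y_Inr:
  assumes "t \<le> n" "\<mu> \<in> Part t"
  shows "(\<Sum>\<beta>\<in>Qidx n. B \<beta> * Y_mat chibar r \<beta> (Inr \<mu>)) = (\<Sum>\<beta>\<in>Part t. B (Inr \<beta>) * chibar (Inr \<mu>) (r (Inr \<beta>)))"
proof -
  have \<mu>: "sum_mset \<mu> = t" using assms by (simp add: Part_def)
  have "(\<Sum>\<beta>\<in>Qidx n. B \<beta> * Y_mat chibar r \<beta> (Inr \<mu>)) = (\<Sum>\<beta>\<in>Inr ` Part t. B \<beta> * Y_mat chibar r \<beta> (Inr \<mu>))"
  proof (rule sum.mono_neutral_right[OF finite_Qidx])
    show "\<forall>\<beta>\<in>Qidx n - Inr ` Part t. B \<beta> * Y_mat chibar r \<beta> (Inr \<mu>) = 0"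
      using \<mu> by (auto simp: Qidx_def Y_mat_def Part_def)
  qed (use assms in auto)
  also have "\<dots> = (\<Sum>\<beta>\<in>Part t. B (Inr \<beta>) * Y_mat chibar r (Inr \<beta>) (Inr \<mu>))"
    by (simp add: sum.reindex)
  also have "\<dots> = (\<Sum>\<beta>\<in>Part t. B (Inr \<beta>) * chibar (Inr \<mu>) (r (Inr \<beta>)))"
    using \<mu> by (intro sum.cong refl) (simp add: Y_mat_def Part_def)
  finally show ?thesis .
qed

text \<open>
  For a column with apex \<open>idem_e t\<close>, the entries of \<open>A\<close> count invariant sets in rows of both kinds.
\<close>

lemma M_factorization:
  assumes n: "n \<ge> 1" and rep: "\<And>\<alpha>. \<alpha> \<in> Qidx n \<Longrightarrow> class_rep n \<alpha> (r \<alpha>)"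
    and aff: "\<And>\<mu>. \<mu> \<in> Qidx n \<Longrightarrow> affords_irr n \<mu> (chibar \<mu>) (chi \<mu>)"
    and \<alpha>: "\<alpha> \<in> Qidx n" and \<mu>: "\<mu> \<in> Qidx n"
  shows "M_mat chi r \<alpha> \<mu> = (\<Sum>\<beta>\<in>Qidx n. A_entry \<alpha> \<beta> * Y_mat chibar r \<beta> \<mu>)"
proof (cases \<mu>)
  case (Inl \<nu>)
  show ?thesis
  proof (cases \<alpha>)
    case (Inl \<kappa>)
    have \<kappa>: "\<kappa> \<in> SPart n" using \<alpha> Inl by simp
    have "r \<alpha> \<in> carrier (WSp n)" using rep[OF \<alpha>] Inl by (cases \<kappa>) simp
    then have "chi \<mu> (r \<alpha>) = chibar \<mu> (r \<alpha>)"
      using top_apex_values(1)[OF n, of \<nu>] aff[OF \<mu>] \<open>\<mu> = Inl \<nu>\<close> by simp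
    moreover have "(\<Sum>\<beta>\<in>SPart n. A_entry \<alpha> (Inl \<beta>) * chibar \<mu> (r (Inl \<beta>))) = chibar \<mu> (r \<alpha>)"
      unfolding Inl using \<kappa> finite_SPart by (simp add: if_distrib[of "\<lambda>c. c * _"] cong: if_cong)
    ultimately show ?thesis unfolding M_mat_def \<open>\<mu> = Inl \<nu>\<close> sum_Y_Inl by simp
  next
    case (Inr \<kappa>)
    then obtain s where s: "s \<le> n" "\<kappa> \<in> Part s" using \<alpha> by auto
    have "r \<alpha> \<in> carrier (We s)" using rep[OF \<alpha>] Inr s(2) by (simp add: Part_def)
    then have "chi \<mu> (r \<alpha>) = 0"
      using top_apex_values(2)[OF n, of \<nu>] aff[OF \<mu>] \<open>\<mu> = Inl \<nu>\<close> s(1) by simp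
    then show ?thesis unfolding M_mat_def \<open>\<mu> = Inl \<nu>\<close> sum_Y_Inl by (simp add: Inr)
  qed
next
  case (Inr \<nu>)
  then obtain t where t: "t \<le> n" "\<nu> \<in> Part t" using \<mu> by auto
  have rep_t: "class_rep n (Inr \<beta>) (r (Inr \<beta>))" if "\<beta> \<in> Part t" for \<beta>
    using that t(1) by (intro rep) auto
  have "symplectic_inj n (r \<alpha>) \<and> (\<forall>\<beta>. A_entry \<alpha> (Inr \<beta>) = of_nat (card (invariant_sets n (r \<alpha>) \<beta>)))"
  proof (cases \<alpha>)
    case (Inl \<kappa>)
    obtain \<gamma> \<delta> where "\<kappa> = (\<gamma>, \<delta>)" by (cases \<kappa>)
    then have \<alpha>_eq: "\<alpha> = Inl (\<gamma>, \<delta>)" using Inl by simp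
    have c: "class_rep n (Inl (\<gamma>, \<delta>)) (r \<alpha>)" using rep[OF \<alpha>] unfolding \<alpha>_eq .
    then have "symplectic_inj n (r \<alpha>)" by (intro WSp_symplectic) simp
    moreover have "A_entry \<alpha> (Inr \<beta>) = of_nat (card (invariant_sets n (r \<alpha>) \<beta>))" for \<beta>
      unfolding card_invariant_sets_WSp[OF c] by (simp add: \<alpha>_eq)
    ultimately show ?thesis by blast
  next
    case (Inr \<kappa>)
    then obtain s where s: "s \<le> n" "\<kappa> \<in> Part s" using \<alpha> by auto
    have c: "class_rep n (Inr \<kappa>) (r \<alpha>)" using rep[OF \<alpha>] Inr by simp
    then have "r \<alpha> \<in> carrier (We s)" using s(2) by (simp add: Part_def)
    then show ?thesis
      using We_symplectic_inj[OF n s(1)] card_invariant_sets_We[OF s c] by (simp add: Inr)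
  qed
  then have "M_mat chi r \<alpha> \<mu> = (\<Sum>\<beta>\<in>Part t. A_entry \<alpha> (Inr \<beta>) * chibar \<mu> (r (Inr \<beta>)))"
    unfolding M_mat_def Inr
    using lower_apex_values[OF n t _ rep_t, of "chibar (Inr \<nu>)" "chi (Inr \<nu>)"] aff[OF \<mu>] Inr by simp
  then show ?thesis unfolding Inr sum_Y_Inr[OF t] .
qed

lemma Y_rows_independent:
  assumes rep: "\<And>\<alpha>. \<alpha> \<in> Qidx n \<Longrightarrow> class_rep n \<alpha> (r \<alpha>)"
    and W: "bij_betw (\<lambda>\<mu>. chibar (Inl \<mu>)) (SPart n) (irr_chars (WSp n))"
    and S: "\<And>t. t \<le> n \<Longrightarrow> bij_betw (\<lambda>\<mu>. chibar (Inr \<mu>)) (Part t) (irr_chars (We t))"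
    and zero: "\<And>\<mu>. \<mu> \<in> Qidx n \<Longrightarrow> (\<Sum>\<beta>\<in>Qidx n. B \<beta> * Y_mat chibar r \<beta> \<mu>) = 0"
    and \<beta>: "\<beta> \<in> Qidx n"
  shows "B \<beta> = 0"
proof (cases \<beta>)
  case (Inl \<alpha>)
  have rep': "class_rep n (Inl \<alpha>) (r (Inl \<alpha>))" if "\<alpha> \<in> SPart n" for \<alpha> using rep that by simp
  have "B (Inl \<alpha>) = 0"
  proof (rule character_table_rows_independent[OF group_WSp finite_WSp finite_SPart W,
        where r = "\<lambda>\<alpha>. r (Inl \<alpha>)" and b = "\<lambda>\<alpha>. B (Inl \<alpha>)"])
    show "r (Inl \<alpha>) \<in> carrier (WSp n)" if "\<alpha> \<in> SPart n" for \<alpha> using rep'[OF that] by (cases \<alpha>) simp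
    show "(\<Sum>\<alpha>\<in>SPart n. B (Inl \<alpha>) * chibar (Inl \<mu>) (r (Inl \<alpha>))) = 0" if "\<mu> \<in> SPart n" for \<mu>
      using zero[of "Inl \<mu>"] that by (simp add: sum_Y_Inl)
    show "\<alpha> \<in> SPart n" using \<beta> Inl by simp
  qed (rule WSp_conjugate_to_rep[OF _ rep'])
  then show ?thesis using Inl by simp
next
  case (Inr \<nu>)
  then obtain t where t: "t \<le> n" "\<nu> \<in> Part t" using \<beta> by auto
  have rep': "class_rep n (Inr \<mu>) (r (Inr \<mu>))" if "\<mu> \<in> Part t" for \<mu>
    using that t(1) by (intro rep) auto
  have "B (Inr \<nu>) = 0"
  proof (rule character_table_rows_independent[OF group_We finite_We finite_Part S[OF t(1)],
        where r = "\<lambda>\<alpha>. r (Inr \<alpha>)" and b = "\<lambda>\<alpha>. B (Inr \<alpha>)"])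
    show "r (Inr \<mu>) \<in> carrier (We t)" if "\<mu> \<in> Part t" for \<mu> using rep'[OF that] that by (simp add: Part_def)
    show "(\<Sum>\<alpha>\<in>Part t. B (Inr \<alpha>) * chibar (Inr \<mu>) (r (Inr \<alpha>))) = 0" if "\<mu> \<in> Part t" for \<mu>
      using zero[of "Inr \<mu>"] that t(1) by (auto simp: sum_Y_Inr[OF t(1) that])
  qed (use t in \<open>simp_all add: We_conjugate_to_rep[OF _ rep']\<close>)
  then show ?thesis using Inr by simp
qed

theorem theorem4p2p4:
  fixes n :: nat
    and chibar chi :: "pindex \<Rightarrow> (nat \<rightharpoonup> nat) \<Rightarrow> complex"
    and r :: "pindex \<Rightarrow> (nat \<rightharpoonup> nat)"
    and A :: "pindex \<Rightarrow> pindex \<Rightarrow> complex"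
  assumes "n \<ge> 1"
    and "\<And>\<alpha>. \<alpha> \<in> Qidx n \<Longrightarrow> class_rep n \<alpha> (r \<alpha>)"
    and "bij_betw (\<lambda>\<mu>. chibar (Inl \<mu>)) (SPart n) (irr_chars (WSp n))"
    and "\<And>t. t \<le> n \<Longrightarrow> bij_betw (\<lambda>\<mu>. chibar (Inr \<mu>)) (Part t) (irr_chars (We t))"
    and "\<And>\<mu>. \<mu> \<in> Qidx n \<Longrightarrow> affords_irr n \<mu> (chibar \<mu>) (chi \<mu>)"
  shows "is_A_matrix n (M_mat chi r) (Y_mat chibar r) A \<longleftrightarrow>
      (\<forall>\<alpha>\<in>SPart n. \<forall>\<beta>\<in>SPart n. A (Inl \<alpha>) (Inl \<beta>) = (if \<alpha> = \<beta> then 1 else 0))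
    \<and> (\<forall>(\<gamma>, \<delta>)\<in>SPart n. \<forall>t\<le>n. \<forall>\<mu>\<in>Part t.
         A (Inl (\<gamma>, \<delta>)) (Inr \<mu>) = 2 ^ (\<Sum>i\<in>set_mset \<mu>. count \<mu> i) * of_nat (part_binom \<gamma> \<mu>))
    \<and> (\<forall>t\<le>n. \<forall>\<alpha>\<in>Part t. \<forall>\<beta>\<in>SPart n. A (Inr \<alpha>) (Inl \<beta>) = 0)
    \<and> (\<forall>t\<^sub>1\<le>n. \<forall>t\<^sub>2\<le>n. \<forall>\<alpha>\<in>Part t\<^sub>1. \<forall>\<mu>\<in>Part t\<^sub>2.
         A (Inr \<alpha>) (Inr \<mu>) = of_nat (part_binom \<alpha> \<mu>))"
  (is "_ \<longleftrightarrow> ?entries")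
proof -
  note M = M_factorization[OF assms(1,2,5)]
  have "is_A_matrix n (M_mat chi r) (Y_mat chibar r) A
      \<longleftrightarrow> (\<forall>\<alpha>\<in>Qidx n. \<forall>\<beta>\<in>Qidx n. A \<alpha> \<beta> = A_entry \<alpha> \<beta>)"
  proof
    assume A: "is_A_matrix n (M_mat chi r) (Y_mat chibar r) A"
    show "\<forall>\<alpha>\<in>Qidx n. \<forall>\<beta>\<in>Qidx n. A \<alpha> \<beta> = A_entry \<alpha> \<beta>"
    proof (intro ballI)
      fix \<alpha> \<beta> assume \<alpha>: "\<alpha> \<in> Qidx n" and \<beta>: "\<beta> \<in> Qidx n"
      have "A \<alpha> \<beta> - A_entry \<alpha> \<beta> = 0"
      proof (rule Y_rows_independent[OF assms(2,3,4) _ \<beta>, where B = "\<lambda>\<beta>. A \<alpha> \<beta> - A_entry \<alpha> \<beta>"])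
        fix \<mu> assume \<mu>: "\<mu> \<in> Qidx n"
        have "(\<Sum>\<beta>\<in>Qidx n. A \<alpha> \<beta> * Y_mat chibar r \<beta> \<mu>) = (\<Sum>\<beta>\<in>Qidx n. A_entry \<alpha> \<beta> * Y_mat chibar r \<beta> \<mu>)"
          using A M[OF _ _ \<alpha> \<mu>] \<alpha> \<mu> by (simp add: is_A_matrix_def)
        then show "(\<Sum>\<beta>\<in>Qidx n. (A \<alpha> \<beta> - A_entry \<alpha> \<beta>) * Y_mat chibar r \<beta> \<mu>) = 0"
          by (simp add: left_diff_distrib sum_subtractf)
      qed
      then show "A \<alpha> \<beta> = A_entry \<alpha> \<beta>" by simp
    qed
  next
    assume A: "\<forall>\<alpha>\<in>Qidx n. \<forall>\<beta>\<in>Qidx n. A \<alpha> \<beta> = A_entry \<alpha> \<beta>"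
    show "is_A_matrix n (M_mat chi r) (Y_mat chibar r) A"
      unfolding is_A_matrix_def
    proof (intro ballI)
      fix \<alpha> \<mu> assume a: "\<alpha> \<in> Qidx n" "\<mu> \<in> Qidx n"
      have "M_mat chi r \<alpha> \<mu> = (\<Sum>\<beta>\<in>Qidx n. A_entry \<alpha> \<beta> * Y_mat chibar r \<beta> \<mu>)"
        using a by (rule M[rotated 2])
      also have "\<dots> = (\<Sum>\<beta>\<in>Qidx n. A \<alpha> \<beta> * Y_mat chibar r \<beta> \<mu>)"
        using A a by (intro sum.cong) simp_all
      finally show "M_mat chi r \<alpha> \<mu> = (\<Sum>\<beta>\<in>Qidx n. A \<alpha> \<beta> * Y_mat chibar r \<beta> \<mu>)" .
    qed
  qed
  also have "\<dots> \<longleftrightarrow> ?entries"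
  proof -
    have Q: "(\<forall>\<alpha>\<in>Qidx n. P \<alpha>) \<longleftrightarrow> (\<forall>\<alpha>\<in>SPart n. P (Inl \<alpha>)) \<and> (\<forall>t\<le>n. \<forall>\<alpha>\<in>Part t. P (Inr \<alpha>))" for P
    proof
      assume "\<forall>\<alpha>\<in>Qidx n. P \<alpha>"
      then show "(\<forall>\<alpha>\<in>SPart n. P (Inl \<alpha>)) \<and> (\<forall>t\<le>n. \<forall>\<alpha>\<in>Part t. P (Inr \<alpha>))"
        by (metis Qidx_Inl Qidx_Inr)
    next
      assume P: "(\<forall>\<alpha>\<in>SPart n. P (Inl \<alpha>)) \<and> (\<forall>t\<le>n. \<forall>\<alpha>\<in>Part t. P (Inr \<alpha>))"
      show "\<forall>\<alpha>\<in>Qidx n. P \<alpha>"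
      proof
        fix \<alpha> assume "\<alpha> \<in> Qidx n"
        then show "P \<alpha>" using P by (cases \<alpha>) auto
      qed
    qed
    have U: "(\<forall>(\<gamma>, \<delta>)\<in>SPart n. \<forall>t\<le>n. \<forall>\<mu>\<in>Part t.
         A (Inl (\<gamma>, \<delta>)) (Inr \<mu>) = 2 ^ (\<Sum>i\<in>set_mset \<mu>. count \<mu> i) * of_nat (part_binom \<gamma> \<mu>))
      \<longleftrightarrow> (\<forall>\<alpha>\<in>SPart n. \<forall>t\<le>n. \<forall>\<mu>\<in>Part t. A (Inl \<alpha>) (Inr \<mu>) = A_entry (Inl \<alpha>) (Inr \<mu>))"
      by (simp add: case_prod_beta flip: size_multiset_overloaded_eq)
    have T: "(\<forall>t\<^sub>1\<le>n. \<forall>t\<^sub>2\<le>n. \<forall>\<alpha>\<in>Part t\<^sub>1. \<forall>\<mu>\<in>Part t\<^sub>2. R \<alpha> \<mu>)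
      \<longleftrightarrow> (\<forall>t\<^sub>1\<le>n. \<forall>\<alpha>\<in>Part t\<^sub>1. \<forall>t\<^sub>2\<le>n. \<forall>\<mu>\<in>Part t\<^sub>2. R \<alpha> \<mu>)" for R
      by blast
    show ?thesis
      unfolding Q U T A_entry.simps(1,3,4)
      by (simp only: ball_conj_distrib all_conj_distrib imp_conjR conj_assoc)
  qed
  finally show ?thesis .
qed

end
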